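(* Let $F$ be a totally real number field and let $d$ be a positive integer. Then there are at most finitely many totally real number fields $K\supseteq F$ (inside a fixed algebraic closure of $F$) with $[K:F]=d$ for which there exists an $\mathcal{O}_F$-lattice $L$ such that $L\otimes_{\mathcal{O}_F}\mathcal{O}_K$ is universal over $\mathcal{O}_K$.
   Context: For a totally real number field $F$, $\mathcal{O}_F$ is its ring of integers. An element $\alpha\in F$ is totally positive if $\rho(\alpha)>0$ for every embedding $\rho:F\to\mathbb{R}$; $\mathcal{O}_F^+$ is the set of totally positive elements of $\mathcal{O}_F$. A quadratic space over $F$ is a finite-dimensional $F$-vector space $V$ with a non-degenerate symmetric bilinear form $B:V\times V\to F$, with associated quadratic form $Q(v)=B(v,v)$. All quadratic spaces are assumed totally positive definite: $Q(v)$ is totally positive for all $v\in V\setminus\{0\}$. An $\mathcal{O}_F$-lattice $L$ on $V$ is a finitely generated $\mathcal{O}_F$-submodule of $V$ with $FL=V$; lattices are integral in the sense that $Q(v)\in\mathcal{O}_F$ for all $v\in L$ (so a free lattice corresponds to a quadratic form $\sum_{i\le j}a_{ij}x_ix_j$ with all $a_{ij}\in\mathcal{O}_F$). $L$ represents $\alpha$ if $Q(v)=\alpha$ for some $v\in L$, and $L$ is universal over $\mathcal{O}_F$ if it represents every element of $\mathcal{O}_F^+$. For a totally real field $K\supseteq F$, $L\otimes_{\mathcal{O}_F}\mathcal{O}_K$ is the $\mathcal{O}_K$-lattice on $V\otimes_F K$ obtained by extension of scalars (with $B$, $Q$ extended $K$-linearly); the same terminology applies to it over $\mathcal{O}_K$.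 *)

theory Defs
  imports
    Complex_Main
    "HOL-Algebra.Algebraic_Closure"
    "Jordan_Normal_Form.VS_Connect"
begin

text \<open>
  All number fields are subsets of one ambient field type of characteristic 0, so that the prime
  field is \<^term>\<open>\<rat>\<close>. \<^term>\<open>class_ring\<close> is that type regarded as a ring record.
\<close>

abbreviation ring_on :: "'a::field set \<Rightarrow> 'a ring" where
  "ring_on K \<equiv> class_ring\<lparr>carrier := K\<rparr>"

definition number_field :: "'a::field_char_0 set \<Rightarrow> bool" where
  "number_field K \<longleftrightarrow> subfield K class_ring \<and> ring.finite_dimension class_ring \<rat> K"

definition embeddings :: "'a::field set \<Rightarrow> ('a \<Rightarrow> 'b::field) set" where
  "embeddings K = Ring.ring_hom (ring_on K) class_ring"

definition totally_real :: "'a::field_char_0 set \<Rightarrow> bool" where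
  "totally_real K \<longleftrightarrow> number_field K \<and> (\<forall>\<sigma> \<in> (embeddings K :: ('a \<Rightarrow> complex) set). \<sigma> ` K \<subseteq> \<real>)"

definition ring_of_integers :: "'a::field_char_0 set \<Rightarrow> 'a set" where
  "ring_of_integers K = {x \<in> K. algebraic_int x}"

definition totally_positive :: "'a::field_char_0 set \<Rightarrow> 'a \<Rightarrow> bool" where
  "totally_positive K x \<longleftrightarrow> x \<in> K \<and> (\<forall>\<rho> \<in> (embeddings K :: ('a \<Rightarrow> real) set). \<rho> x > 0)"

text \<open>
  After the choice of a basis, a quadratic space of dimension \<open>n\<close> over \<open>K\<close> is \<open>K\<^sup>n\<close> with
  \<open>B(v,w) = v\<^sup>T G w\<close> for a symmetric Gram matrix \<open>G\<close> over \<open>K\<close>. Extending scalars from \<open>F\<close> to \<open>K\<close>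
  then turns \<open>F\<^sup>n\<close> into \<open>K\<^sup>n\<close> and keeps \<open>G\<close>.
\<close>

definition coord_space :: "'a::field set \<Rightarrow> nat \<Rightarrow> 'a vec set" where
  "coord_space K n = {v \<in> carrier_vec n. set\<^sub>v v \<subseteq> K}"

definition bilin :: "'a::field mat \<Rightarrow> 'a vec \<Rightarrow> 'a vec \<Rightarrow> 'a" where
  "bilin G v w = v \<bullet> (G *\<^sub>v w)"

definition quad :: "'a::field mat \<Rightarrow> 'a vec \<Rightarrow> 'a" where
  "quad G v = bilin G v v"

definition nondegenerate :: "'a::field set \<Rightarrow> nat \<Rightarrow> 'a mat \<Rightarrow> bool" where
  "nondegenerate K n G \<longleftrightarrow>
     (\<forall>v \<in> coord_space K n. (\<forall>w \<in> coord_space K n. bilin G v w = 0) \<longrightarrow> v = 0\<^sub>v n)"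

definition pos_def_quadratic_space :: "'a::field_char_0 set \<Rightarrow> nat \<Rightarrow> 'a mat \<Rightarrow> bool" where
  "pos_def_quadratic_space K n G \<longleftrightarrow>
     G \<in> carrier_mat n n \<and> elements_mat G \<subseteq> K \<and> transpose_mat G = G \<and>
     nondegenerate K n G \<and>
     (\<forall>v \<in> coord_space K n - {0\<^sub>v n}. totally_positive K (quad G v))"

abbreviation span_over :: "'a::field set \<Rightarrow> nat \<Rightarrow> 'a vec set \<Rightarrow> 'a vec set" where
  "span_over R n S \<equiv> LinearCombinations.module.span (ring_on R) (module_vec TYPE('a) n) S"

definition integral_lattice :: "'a::field_char_0 set \<Rightarrow> nat \<Rightarrow> 'a mat \<Rightarrow> 'a vec set \<Rightarrow> bool" where
  "integral_lattice K n G L \<longleftrightarrow>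
     pos_def_quadratic_space K n G \<and>
     (\<exists>A. finite A \<and> A \<subseteq> coord_space K n \<and> L = span_over (ring_of_integers K) n A) \<and>
     span_over K n L = coord_space K n \<and>
     (\<forall>v \<in> L. quad G v \<in> ring_of_integers K)"

text \<open>
  For a lattice \<open>L\<close> on \<open>F\<^sup>n\<close> the natural map from \<open>L \<otimes> O\<^sub>K\<close> to \<open>F\<^sup>n \<otimes> K = K\<^sup>n\<close> is injective,
  because \<open>L\<close> is projective over \<open>O\<^sub>F\<close>; its image is the \<open>O\<^sub>K\<close>-span of \<open>L\<close>.
\<close>

definition extend_lattice :: "'a::field_char_0 set \<Rightarrow> nat \<Rightarrow> 'a vec set \<Rightarrow> 'a vec set" where
  "extend_lattice K n L = span_over (ring_of_integers K) n L"

definition represents :: "'a::field mat \<Rightarrow> 'a vec set \<Rightarrow> 'a \<Rightarrow> bool" where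
  "represents G L a \<longleftrightarrow> (\<exists>v \<in> L. quad G v = a)"

definition universal :: "'a::field_char_0 set \<Rightarrow> 'a mat \<Rightarrow> 'a vec set \<Rightarrow> bool" where
  "universal K G L \<longleftrightarrow> (\<forall>a \<in> ring_of_integers K. totally_positive K a \<longrightarrow> represents G L a)"

end

theory Submission
  imports
    Defs
    "Jordan_Normal_Form.Char_Poly"
    "HOL-Computational_Algebra.Fundamental_Theorem_Algebra"
    "HOL-Analysis.Convex"
begin

text \<open>
Call a field \<open>K\<close> admissible if it is totally real of degree \<open>d\<close> over \<open>F\<close> and some lattice over \<open>O\<^sub>F\<close>
becomes universal over \<open>O\<^sub>K\<close>. The theorem holds because an admissible field is generated over \<open>F\<close>
by algebraic integers whose size is bounded in terms of \<open>F\<close> and \<open>d\<close>. Precisely, there is a finite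
set \<open>S\<close> such that every subfield \<open>E\<close> containing \<open>F\<close> and \<open>K \<inter> S\<close> contains \<open>K\<close>
(\<open>subfield_of_short_integers\<close>). Taking for \<open>E\<close> another admissible field shows that \<open>K \<inter> S\<close>
determines \<open>K\<close>, so there are at most as many admissible fields as subsets of \<open>S\<close>.

Let \<open>t\<close> be the trace of \<open>K\<close>, up to a positive factor. The form \<open>t(x y)\<close> is positive definite on
\<open>K\<close> and integral on \<open>O\<^sub>K\<close>, and reduction theory (\<open>reduced_basis\<close>) provides a basis \<open>e\<^sub>i\<close> of \<open>O\<^sub>K\<close>
over the integers whose coordinate functionals satisfy \<open>Y\<^sub>i(x)\<^sup>2 t(e\<^sub>i\<^sup>2) \<le> C t(x\<^sup>2)\<close>, where \<open>C\<close> depends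
only on the rank. Suppose that some \<open>e\<^sub>i\<close> are outside \<open>E\<close>. Let \<open>e\<^sub>j\<close> be the shortest of
them and \<open>T\<^sup>2 = t(e\<^sub>j\<^sup>2)\<close>. All conjugates of \<open>e\<^sub>j\<close> are at most \<open>T\<close> in absolute value, so
\<open>\<alpha> = e\<^sub>j + \<lfloor>T\<rfloor> + 1\<close> is totally positive with conjugates at most \<open>3T\<close>, and it is outside \<open>E\<close>.
By universality \<open>\<alpha> = Q(v)\<close> with \<open>v\<close> in \<open>L \<otimes> O\<^sub>K\<close>.

The point is that \<open>\<alpha>\<close> has size about \<open>T\<close>, so \<open>v\<close> has size about the square root of \<open>T\<close>, and
for large \<open>T\<close> the long \<open>e\<^sub>i\<close> cannot occur in its coordinates (\<open>long_coordinate_vanishes\<close>). To see this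
without any control over \<open>L\<close>, apply the functional \<open>Y\<^sub>i\<close> to \<open>v\<close>: trace duality over \<open>F\<close>
(\<open>trace_representation\<close>) turns the result into a vector \<open>p\<close> over \<open>F\<close> such that a bounded multiple
\<open>D p\<close> lies in \<open>L\<close>. One has \<open>t(Q(p)) = Y\<^sub>i(B(p,v))\<close>, and Cauchy-Schwarz at every embedding
bounds this by \<open>t(Q(p)) \<le> 3 C T / t(e\<^sub>i\<^sup>2) \<le> 3 C / T\<close>. If \<open>p\<close> is not zero, then \<open>Q(D p)\<close> is a totally positive
integer, so its trace is at least 1, and \<open>T\<close> is bounded. For larger \<open>T\<close> therefore \<open>Y\<^sub>i(v) = 0\<close> for
all \<open>e\<^sub>i\<close> outside \<open>E\<close>. Then the coordinates of \<open>v\<close> lie in \<open>E\<close>, hence so does \<open>\<alpha> = Q(v)\<close>, which is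
absurd. So \<open>T\<close> is bounded, \<open>e\<^sub>j\<close> belongs to \<open>K \<inter> S\<close>, and this contradicts \<open>e\<^sub>j \<notin> E\<close>.

Only \<open>O\<^sub>K\<close> is ever reduced, not \<open>L\<close>; this is why no constant depends on \<open>L\<close> or on its rank.
The constants are uniform in \<open>K\<close> because the trace of \<open>K\<close> is built from that of \<open>F\<close> by adjoining
\<open>d\<close> elements of degree at most \<open>d\<close> (\<open>trace_list_extension\<close>).
\<close>

section \<open>Algebraic integers form a ring\<close>

definition int_span :: "nat \<Rightarrow> (nat \<Rightarrow> 'a::ring_1) \<Rightarrow> 'a set" where
  "int_span n v = range (\<lambda>c. \<Sum>j<n. of_int (c j) * v j)"

lemma int_span_add: "x \<in> int_span n v \<Longrightarrow> y \<in> int_span n v \<Longrightarrow> x + y \<in> int_span n v"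
  unfolding int_span_def
  by (auto simp flip: sum.distrib distrib_right of_int_add intro!: image_eqI[of _ _ "\<lambda>j. _ j + _ j"])

lemma int_span_scale: "x \<in> int_span n v \<Longrightarrow> of_int k * x \<in> int_span n v"
  unfolding int_span_def
  by (auto simp: sum_distrib_left mult.assoc[symmetric] simp flip: of_int_mult
      intro!: image_eqI[of _ _ "\<lambda>j. k * _ j"])

lemma int_span_base: "i < n \<Longrightarrow> v i \<in> int_span n v"
  unfolding int_span_def by (auto intro!: image_eqI[of _ _ "\<lambda>j. if j = i then 1 else 0"]
    simp: if_distrib[of of_int] if_distrib[of "\<lambda>x. x * _"] cong: if_cong)

lemma int_span_0: "0 \<in> int_span n v"
  unfolding int_span_def by (auto intro!: image_eqI[of _ _ "\<lambda>j. 0"])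

lemma int_span_sum: "(\<And>i. i \<in> I \<Longrightarrow> f i \<in> int_span n v) \<Longrightarrow> sum f I \<in> int_span n v"
  by (induction I rule: infinite_finite_induct) (auto intro: int_span_0 int_span_add)

lemma int_span_mult:
  fixes v :: "nat \<Rightarrow> 'a::comm_ring_1"
  assumes "\<And>i. i < n \<Longrightarrow> x * v i \<in> int_span n v" and "y \<in> int_span n v"
  shows "x * y \<in> int_span n v"
proof -
  from assms(2) obtain c where c: "y = (\<Sum>j<n. of_int (c j) * v j)" by (auto simp: int_span_def)
  have "x * y = (\<Sum>j<n. of_int (c j) * (x * v j))"
    by (simp add: c sum_distrib_left mult_ac)
  thus ?thesis using assms(1) by (auto intro!: int_span_sum int_span_scale)
qed

text \<open>
Multiplication by \<open>x\<close> acts on the span through an integer matrix that has \<open>v\<close> as an eigenvector, so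
\<open>x\<close> is a root of its characteristic polynomial, which is monic with integer coefficients.
\<close>

lemma algebraic_int_if_stable_int_span:
  fixes x :: "'a::field_char_0"
  assumes nz: "i0 < n" "v i0 \<noteq> 0" and st: "\<And>i. i < n \<Longrightarrow> x * v i \<in> int_span n v"
  shows "algebraic_int x"
proof -
  have "\<forall>i. \<exists>c::nat \<Rightarrow> int. i < n \<longrightarrow> x * v i = (\<Sum>j<n. of_int (c j) * v j)"
    using st by (auto simp: int_span_def)
  then obtain A where A: "\<And>i. i < n \<Longrightarrow> x * v i = (\<Sum>j<n. of_int (A i j) * v j)" by metis
  define M where "M = mat n n (\<lambda>(i,j). A i j)"
  define M' where "M' = map_mat (of_int :: int \<Rightarrow> 'a) M"
  have M: "M \<in> carrier_mat n n" "M' \<in> carrier_mat n n" by (auto simp: M_def M'_def)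
  have "eigenvector M' (vec n v) x"
    unfolding eigenvector_def
  proof (intro conjI)
    show "vec n v \<noteq> 0\<^sub>v (dim_row M')" using nz M by (auto simp: vec_eq_iff)
    show "M' *\<^sub>v vec n v = x \<cdot>\<^sub>v vec n v" using A
      by (intro eq_vecI) (auto simp: M'_def M_def scalar_prod_def lessThan_atLeast0)
  qed (use M in auto)
  hence "eigenvalue M' x" by (auto simp: eigenvalue_def)
  hence "poly (char_poly M') x = 0" using eigenvalue_root_char_poly[OF M(2)] by auto
  moreover have "char_poly M' = map_poly of_int (char_poly M)"
    unfolding M'_def by (rule of_int_hom.char_poly_hom[OF M(1)])
  ultimately have "poly (map_poly of_int (char_poly M)) x = 0" by simp
  moreover have "lead_coeff (char_poly M) = 1" using degree_monic_char_poly[OF M(1)] by simp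
  ultimately show ?thesis unfolding algebraic_int_altdef_ipoly by blast
qed

lemma algebraic_int_power_reduction:
  assumes "algebraic_int (x::'a::field_char_0)"
  obtains n c where "n > 0" "x ^ n = (\<Sum>i<n. of_int (c i) * x ^ i)"
proof -
  obtain p where p: "poly (map_poly of_int p) x = 0" "lead_coeff p = 1"
    using assms unfolding algebraic_int_altdef_ipoly by auto
  let ?n = "degree p"
  have n: "?n > 0"
  proof (rule ccontr)
    assume "\<not> ?thesis" then obtain k where "p = [:k:]" by (auto elim: degree_eq_zeroE)
    with p show False by auto
  qed
  have deg: "degree (map_poly (of_int :: int \<Rightarrow> 'a) p) = ?n"
    by (rule degree_map_poly) (use p in auto)
  have "0 = (\<Sum>i\<le>?n. of_int (coeff p i) * x ^ i)"
    using p(1) unfolding poly_altdef deg by (simp add: coeff_map_poly)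
  also have "\<dots> = (\<Sum>i<?n. of_int (coeff p i) * x ^ i) + x ^ ?n"
    using p(2) by (simp add: lessThan_Suc_atMost[symmetric])
  finally have "x ^ ?n = (\<Sum>i<?n. of_int (- coeff p i) * x ^ i)"
    by (simp add: sum_negf add_eq_0_iff)
  with n show thesis by (rule that)
qed

text \<open>
The monomials \<open>x\<^sup>i y\<^sup>j\<close> with exponents below the two degrees span a group that is stable under \<open>x\<close> and
\<open>y\<close>, hence under \<open>x + y\<close> and \<open>x y\<close>.
\<close>

lemma algebraic_int_common_span:
  assumes "algebraic_int (x::'a::field_char_0)" "algebraic_int y"
  obtains n :: nat and v where "n > 0" "v 0 = 1"
    "\<And>i. i < n \<Longrightarrow> x * v i \<in> int_span n v" "\<And>i. i < n \<Longrightarrow> y * v i \<in> int_span n v"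
proof -
  obtain n c where n: "n > 0" and c: "x ^ n = (\<Sum>i<n. of_int (c i) * x ^ i)"
    using algebraic_int_power_reduction[OF assms(1)] by blast
  obtain m d where m: "m > 0" and d: "y ^ m = (\<Sum>i<m. of_int (d i) * y ^ i)"
    using algebraic_int_power_reduction[OF assms(2)] by blast
  define v where "v = (\<lambda>k. x ^ (k div m) * y ^ (k mod m))"
  have V: "x ^ i * y ^ j \<in> int_span (n * m) v" if "i < n" "j < m" for i j
  proof -
    have "i * m + j < (i + 1) * m" using that by simp
    also have "\<dots> \<le> n * m" using that by (intro mult_right_mono) auto
    finally have "v (i * m + j) \<in> int_span (n * m) v" by (rule int_span_base)
    thus ?thesis using that by (simp add: v_def)
  qed
  have X: "x ^ i * y ^ j \<in> int_span (n * m) v" if "i \<le> n" "j < m" for i j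
  proof (cases "i = n")
    case True
    have "x ^ i * y ^ j = (\<Sum>k<n. of_int (c k) * (x ^ k * y ^ j))"
      unfolding True c sum_distrib_right by (simp only: mult.assoc)
    thus ?thesis using that by (auto intro!: int_span_sum int_span_scale V)
  qed (use that V in auto)
  have Y: "x ^ i * y ^ j \<in> int_span (n * m) v" if "i < n" "j \<le> m" for i j
  proof (cases "j = m")
    case True
    have "x ^ i * y ^ j = (\<Sum>k<m. of_int (d k) * (x ^ i * y ^ k))"
      unfolding True d sum_distrib_left by (simp only: mult.left_commute)
    thus ?thesis using that by (auto intro!: int_span_sum int_span_scale V)
  qed (use that V in auto)
  have bd: "k div m < n" "k mod m < m" if "k < n * m" for k
    using that m by (auto simp: less_mult_imp_div_less)
  show thesis
  proof (rule that[of "n * m" v])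
    show "x * v k \<in> int_span (n * m) v" if "k < n * m" for k
      using X[of "Suc (k div m)" "k mod m"] bd[OF that] by (simp add: v_def mult_ac)
    show "y * v k \<in> int_span (n * m) v" if "k < n * m" for k
      using Y[of "k div m" "Suc (k mod m)"] bd[OF that] by (simp add: v_def mult_ac Suc_le_eq)
  qed (use n m in \<open>auto simp: v_def\<close>)
qed

lemma algebraic_int_add:
  assumes "algebraic_int (x::'a::field_char_0)" "algebraic_int y" shows "algebraic_int (x + y)"
proof -
  obtain n and v :: "nat \<Rightarrow> 'a" where v: "n > 0" "v 0 = 1"
    "\<And>i. i < n \<Longrightarrow> x * v i \<in> int_span n v" "\<And>i. i < n \<Longrightarrow> y * v i \<in> int_span n v"
    by (rule algebraic_int_common_span[OF assms]) blast
  show ?thesis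
  proof (rule algebraic_int_if_stable_int_span[of 0 n v])
    fix i assume i: "i < n"
    show "(x + y) * v i \<in> int_span n v"
      unfolding distrib_right using v(3,4)[OF i] by (rule int_span_add)
  qed (use v in auto)
qed

lemma algebraic_int_mult:
  assumes "algebraic_int (x::'a::field_char_0)" "algebraic_int y" shows "algebraic_int (x * y)"
proof -
  obtain n and v :: "nat \<Rightarrow> 'a" where v: "n > 0" "v 0 = 1"
    "\<And>i. i < n \<Longrightarrow> x * v i \<in> int_span n v" "\<And>i. i < n \<Longrightarrow> y * v i \<in> int_span n v"
    by (rule algebraic_int_common_span[OF assms]) blast
  show ?thesis
  proof (rule algebraic_int_if_stable_int_span[of 0 n v])
    fix i assume i: "i < n"
    show "x * y * v i \<in> int_span n v"
      unfolding mult.assoc by (rule int_span_mult[OF v(3) v(4)[OF i]])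
  qed (use v in auto)
qed

lemma algebraic_int_diff:
  "algebraic_int (x::'a::field_char_0) \<Longrightarrow> algebraic_int y \<Longrightarrow> algebraic_int (x - y)"
  using algebraic_int_add[of x "- y"] by (simp only: algebraic_int_minus_iff diff_conv_add_uminus)

lemma algebraic_int_sum:
  assumes "\<And>i. i \<in> I \<Longrightarrow> algebraic_int (f i :: 'a::field_char_0)"
  shows "algebraic_int (sum f I)"
proof -
  have "finite J \<Longrightarrow> J \<subseteq> I \<Longrightarrow> algebraic_int (sum f J)" for J
  proof (induction J rule: finite_induct)
    case (insert j J)
    have "algebraic_int (f j)" using assms insert.prems by simp
    moreover have "algebraic_int (sum f J)" using insert by simp
    ultimately have "algebraic_int (f j + sum f J)" by (rule algebraic_int_add)
    thus ?case by (simp only: sum.insert[OF insert.hyps])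
  qed (simp only: sum.empty algebraic_int_0)
  thus ?thesis by (cases "finite I") (simp_all only: sum.infinite algebraic_int_0 subset_refl not_False_eq_True)
qed

section \<open>Newton's identities\<close>

lemma coeff_synthetic_div:
  fixes p :: "'a::idom poly"
  shows "coeff (synthetic_div p z) k =
    (\<Sum>j\<in>{k<..degree p}. coeff p j * z ^ (j - Suc k))"
proof (induction p arbitrary: k)
  case 0
  show ?case by simp
next
  case (pCons a p)
  show ?case
  proof (cases "p = 0")
    case True
    thus ?thesis by simp
  next
    case False
    have shift: "(\<Sum>j\<in>{k<..Suc n}. f j) = (\<Sum>j\<in>{k..n}. f (Suc j))" for f :: "nat \<Rightarrow> 'a" and k n
      by (rule sum.reindex_bij_witness[of _ Suc "\<lambda>i. i - 1"]) auto
    have eq: "degree (pCons a p) = Suc (degree p)" using False by simp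
    show ?thesis
    proof (cases k)
      case 0
      show ?thesis unfolding eq shift 0 synthetic_div_pCons
        by (simp add: poly_altdef atMost_atLeast0)
    next
      case (Suc k')
      have "{Suc k'..degree p} = {k'<..degree p}" by auto
      thus ?thesis unfolding eq shift Suc synthetic_div_pCons
        using pCons.IH[of k'] by simp
    qed
  qed
qed

text \<open>
The product rule writes \<open>p'\<close> as the sum of the quotients of \<open>p\<close> by \<open>X - z\<close>. As synthetic
divisions these have explicit coefficients.
\<close>

lemma pderiv_prod_list_linear:
  fixes zs :: "'a::field list"
  defines "p \<equiv> \<Prod>z\<leftarrow>zs. [:- z, 1:]"
  shows "pderiv p = (\<Sum>z\<leftarrow>zs. synthetic_div p z)"
proof -
  have lin: "synthetic_div ([:- w, 1:] * q) w = q" for w and q :: "'a poly"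
  proof -
    have "[:- w, 1:] * q = [:- w, 1:] * synthetic_div ([:- w, 1:] * q) w"
      using synthetic_div_correct'[of w "[:- w, 1:] * q"] by simp
    thus ?thesis by (metis mult_cancel_left pCons_eq_0_iff zero_neq_one)
  qed
  have mult: "synthetic_div (r * q) w = r * synthetic_div q w" if "poly q w = 0" for w and q r :: "'a poly"
  proof -
    have "q = [:- w, 1:] * synthetic_div q w"
      using synthetic_div_correct'[of w q] that by simp
    thus ?thesis using lin[of w "r * synthetic_div q w"] by (metis mult.left_commute)
  qed
  have root: "poly (\<Prod>z\<leftarrow>zs. [:- z, 1:]) w = 0" if "w \<in> set zs" for w and zs :: "'a list"
    using that by (induction zs) auto
  show ?thesis unfolding p_def
  proof (induction zs)
    case Nil
    show ?case by (simp add: pderiv_1)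
  next
    case (Cons w zs)
    let ?q = "\<Prod>z\<leftarrow>zs. [:- z, 1:]"
    have "(\<Sum>z\<leftarrow>zs. synthetic_div ([:- w, 1:] * ?q) z) = (\<Sum>z\<leftarrow>zs. [:- w, 1:] * synthetic_div ?q z)"
      by (intro arg_cong[of _ _ sum_list] map_cong refl mult root)
    also have "\<dots> = [:- w, 1:] * pderiv ?q" by (simp only: sum_list_const_mult Cons.IH)
    finally show ?case
      by (simp add: pderiv_mult pderiv_pCons lin del: mult_pCons_left)
  qed
qed

lemma degree_prod_list_linear:
  "degree (\<Prod>z\<leftarrow>zs. [:- z, 1:]) = length (zs :: 'a::field list)"
  "lead_coeff (\<Prod>z\<leftarrow>zs. [:- z, 1:]) = 1"
proof -
  have "degree (\<Prod>z\<leftarrow>zs. [:- z, 1:]) = length zs \<and>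
    lead_coeff (\<Prod>z\<leftarrow>zs. [:- z, 1:]) = 1"
  proof (induction zs)
    case (Cons w zs)
    let ?q = "\<Prod>z\<leftarrow>zs. [:- z, 1:]"
    from Cons have q: "?q \<noteq> 0" "lead_coeff ?q = 1" by auto
    have "lead_coeff ([:- w, 1:] * ?q) = 1" unfolding lead_coeff_mult q by simp
    moreover have "degree ([:- w, 1:] * ?q) = Suc (length zs)"
      using q Cons by (subst degree_mult_eq) auto
    ultimately show ?case by simp
  qed auto
  thus "degree (\<Prod>z\<leftarrow>zs. [:- z, 1:]) = length (zs :: 'a::field list)"
    "lead_coeff (\<Prod>z\<leftarrow>zs. [:- z, 1:]) = 1" by auto
qed

lemma poly_prod_list_linear_root:
  "z \<in> set zs \<Longrightarrow> poly (\<Prod>z\<leftarrow>zs. [:- z, 1:]) (z :: 'a::field) = 0"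
  by (induction zs) auto

lemma sum_list_sum_commute:
  "(\<Sum>x\<leftarrow>xs. \<Sum>j\<in>A. f j x) = (\<Sum>j\<in>A. \<Sum>x\<leftarrow>xs. f j x :: 'b::comm_monoid_add)"
  by (induction xs) (auto simp: sum.distrib)

text \<open>
Compare coefficients in \<open>p' = \<Sum> p / (X - z)\<close>. Read in one direction, the identity computes power sums of
exponent below the degree from the coefficients; in the other, the coefficients from power sums.
\<close>

lemma newton_identity:
  fixes zs :: "'a::field list"
  assumes p: "p = (\<Prod>z\<leftarrow>zs. [:- z, 1:])"
  shows "of_nat (Suc k) * coeff p (Suc k) =
    (\<Sum>j\<in>{k<..length zs}. coeff p j * (\<Sum>z\<leftarrow>zs. z ^ (j - Suc k)))"
proof -
  have sw: "coeff (\<Sum>z\<leftarrow>ws. f z) k = (\<Sum>z\<leftarrow>ws. coeff (f z) k)"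
    for ws :: "'a list" and f :: "'a \<Rightarrow> 'a poly"
    by (induction ws) auto
  have "of_nat (Suc k) * coeff p (Suc k) = coeff (pderiv p) k"
    by (simp add: coeff_pderiv)
  also have "\<dots> = (\<Sum>z\<leftarrow>zs. coeff (synthetic_div p z) k)"
    unfolding p pderiv_prod_list_linear sw ..
  also have "\<dots> = (\<Sum>z\<leftarrow>zs. \<Sum>j\<in>{k<..length zs}. coeff p j * z ^ (j - Suc k))"
    unfolding coeff_synthetic_div p degree_prod_list_linear ..
  finally show ?thesis by (simp add: sum_list_sum_commute sum_list_const_mult)
qed

text \<open>
The term \<open>j = k\<close> in Newton's identity has the power sum \<open>n\<close>, the number of roots, so the identity can be
solved for the coefficient at \<open>k\<close> after division by \<open>k - n\<close>, going down from the
leading coefficient. The constant coefficient comes from summing \<open>p(z) = 0\<close> over the roots instead.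
\<close>

lemma Rats_coeff_if_power_sums:
  fixes zs :: "'a::field_char_0 list"
  assumes p: "p = (\<Prod>z\<leftarrow>zs. [:- z, 1:])"
    and s: "\<And>m. (\<Sum>z\<leftarrow>zs. z ^ m) \<in> \<rat>"
  shows "coeff p k \<in> \<rat>"
proof (induction "length zs - k" arbitrary: k rule: less_induct)
  case less
  let ?n = "length zs" and ?s = "\<lambda>m. \<Sum>z\<leftarrow>zs. z ^ m"
  consider "k > ?n" | "k = ?n" | "k < ?n" by linarith
  thus ?case
  proof cases
    case 1
    thus ?thesis by (simp add: p coeff_eq_0 degree_prod_list_linear)
  next
    case 2
    thus ?thesis using degree_prod_list_linear[of zs] by (simp add: p)
  next
    case 3
    show ?thesis
    proof (cases k)
      case 0
      have root: "poly p z = 0" if "z \<in> set zs" for z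
        using that unfolding p by (induction zs) auto
      have "0 = (\<Sum>z\<leftarrow>zs. poly p z)" using root by (simp cong: map_cong)
      also have "\<dots> = (\<Sum>z\<leftarrow>zs. \<Sum>j\<le>?n. coeff p j * z ^ j)"
        by (simp add: poly_altdef p degree_prod_list_linear)
      also have "\<dots> = (\<Sum>j\<le>?n. coeff p j * ?s j)"
        by (simp add: sum_list_sum_commute sum_list_const_mult)
      also have "{..?n} = insert 0 {0<..?n}" by auto
      finally have "coeff p 0 * of_nat ?n = - (\<Sum>j\<in>{0<..?n}. coeff p j * ?s j)"
        by (simp add: sum_list_triv eq_neg_iff_add_eq_0)
      hence "coeff p 0 = - (\<Sum>j\<in>{0<..?n}. coeff p j * ?s j) / of_nat ?n"
        using 3 0 by (subst eq_divide_eq) auto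
      also have "\<dots> \<in> \<rat>" using less 3 0
        by (intro Rats_divide Rats_minus_iff[THEN iffD2] Rats_sum Rats_mult s) auto
      finally show ?thesis using 0 by simp
    next
      case (Suc k')
      have "of_nat k * coeff p k = (\<Sum>j\<in>{k'<..?n}. coeff p j * ?s (j - k))"
        using newton_identity[OF p, of k'] by (simp add: Suc)
      also have "{k'<..?n} = insert k {k<..?n}" using 3 Suc by auto
      finally have "of_nat k * coeff p k =
          coeff p k * of_nat ?n + (\<Sum>j\<in>{k<..?n}. coeff p j * ?s (j - k))"
        by (simp add: sum_list_triv)
      hence "coeff p k * (of_nat k - of_nat ?n) =
          (\<Sum>j\<in>{k<..?n}. coeff p j * ?s (j - k))" by (simp add: algebra_simps)
      hence "coeff p k = (\<Sum>j\<in>{k<..?n}. coeff p j * ?s (j - k)) / (of_nat k - of_nat ?n)"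
        using 3 by (simp add: eq_divide_eq)
      also have "\<dots> \<in> \<rat>" using less 3 by (intro Rats_divide Rats_sum Rats_mult s) auto
      finally show ?thesis .
    qed
  qed
qed

section \<open>Subfields, polynomials over them, and finite extensions\<close>

definition is_subfield :: "'a::field set \<Rightarrow> bool" where
  "is_subfield E \<longleftrightarrow> 1 \<in> E \<and> (\<forall>x\<in>E. \<forall>y\<in>E. x - y \<in> E \<and> x * y \<in> E) \<and> (\<forall>x\<in>E. inverse x \<in> E)"

lemma is_subfieldD:
  assumes "is_subfield E"
  shows "0 \<in> E" "1 \<in> E" "x \<in> E \<Longrightarrow> y \<in> E \<Longrightarrow> x - y \<in> E" "x \<in> E \<Longrightarrow> y \<in> E \<Longrightarrow> x * y \<in> E"
    "x \<in> E \<Longrightarrow> inverse x \<in> E" "x \<in> E \<Longrightarrow> - x \<in> E" "x \<in> E \<Longrightarrow> y \<in> E \<Longrightarrow> x + y \<in> E"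
    "x \<in> E \<Longrightarrow> y \<in> E \<Longrightarrow> x / y \<in> E" "x \<in> E \<Longrightarrow> x ^ n \<in> E"
proof -
  show 0: "0 \<in> E" using assms unfolding is_subfield_def by (metis diff_self)
  show "1 \<in> E" "x \<in> E \<Longrightarrow> y \<in> E \<Longrightarrow> x - y \<in> E" "x \<in> E \<Longrightarrow> y \<in> E \<Longrightarrow> x * y \<in> E" "x \<in> E \<Longrightarrow> inverse x \<in> E"
    using assms by (auto simp: is_subfield_def)
  show neg: "- x \<in> E" if "x \<in> E" for x using assms 0 that unfolding is_subfield_def by (metis diff_0)
  show "x \<in> E \<Longrightarrow> y \<in> E \<Longrightarrow> x + y \<in> E" using assms neg unfolding is_subfield_def by (metis diff_minus_eq_add)
  show "x \<in> E \<Longrightarrow> y \<in> E \<Longrightarrow> x / y \<in> E" using assms unfolding is_subfield_def by (metis divide_inverse)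
  show "x \<in> E \<Longrightarrow> x ^ n \<in> E" using assms by (induction n) (auto simp: is_subfield_def)
qed

lemma is_subfield_sum: "is_subfield E \<Longrightarrow> (\<And>i. i \<in> I \<Longrightarrow> f i \<in> E) \<Longrightarrow> sum f I \<in> E"
  by (induction I rule: infinite_finite_induct) (auto intro: is_subfieldD)

lemma is_subfield_of_int: "is_subfield E \<Longrightarrow> of_int k \<in> E"
proof (induction k rule: int_induct[of _ 0])
  case (step1 i)
  thus ?case using is_subfieldD(7)[of E "of_int i" 1] is_subfieldD(2)[of E] by simp
next
  case (step2 i)
  thus ?case using is_subfieldD(3)[of E "of_int i" 1] is_subfieldD(2)[of E] by simp
qed (simp add: is_subfieldD)

lemma is_subfield_of_nat: "is_subfield E \<Longrightarrow> of_nat k \<in> E"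
  using is_subfield_of_int[of E "int k"] by simp

lemma is_subfield_Rats_subset:
  fixes E :: "'a::field_char_0 set"
  assumes "is_subfield E" shows "\<rat> \<subseteq> E"
proof
  fix x :: 'a assume "x \<in> \<rat>"
  then obtain r where r: "x = of_rat r" by (rule Rats_cases)
  obtain a b where "r = Rat.Fract a b" "b > 0" by (cases r) auto
  hence "x = of_int a / of_int b" by (simp add: r of_rat_rat)
  thus "x \<in> E" using assms by (auto intro: is_subfieldD is_subfield_of_int)
qed

lemma is_subfield_Rats: "is_subfield (\<rat> :: 'a::field_char_0 set)"
  by (auto simp: is_subfield_def)

lemma is_subfield_if_subfield:
  fixes E :: "'a::field set"
  assumes "subfield E class_ring" shows "is_subfield E"
proof -
  interpret subfield E class_ring by fact
  have ring: "subring E class_ring" by (rule subring_axioms)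
  have minus: "\<ominus>\<^bsub>class_ring\<^esub> x = - x" for x :: 'a
    by (simp add: class_ring_simps)
  have closed: "x * y \<in> E" "x + y \<in> E" "1 \<in> E" "- x \<in> E" if "x \<in> E" "y \<in> E" for x y
    using subringE[OF ring] that minus by auto
  have "1 \<in> E" using subringE(3)[OF ring] by simp
  moreover have "inverse x \<in> E" if x: "x \<in> E" for x
  proof (cases "x = 0")
    case False
    hence "x \<in> Units (class_ring\<lparr>carrier := E\<rparr>)" using subfield_Units x by simp
    then obtain y where "y \<in> E" "y * x = 1" by (auto simp: Units_def)
    thus ?thesis using inverse_unique[of x y] by (simp add: mult.commute)
  qed (use subringE(2)[OF ring] in auto)
  ultimately show ?thesis unfolding is_subfield_def
    using closed by (metis (no_types, lifting) diff_conv_add_uminus)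
qed

text \<open>
Elimination of one unknown per equation. Over \<open>F\<close> this makes the elements of a finite extension
algebraic of bounded degree, and over \<open>\<rat>\<close> it bounds the rank of the ring of integers.
\<close>

lemma nontrivial_solution:
  fixes E :: "'a::field set"
  assumes E: "is_subfield E" and "finite J" "finite I" "card J < card I"
    and "\<And>i j. i \<in> I \<Longrightarrow> j \<in> J \<Longrightarrow> a i j \<in> E"
  shows "\<exists>c. (\<forall>i\<in>I. c i \<in> E) \<and> (\<exists>i\<in>I. c i \<noteq> 0) \<and> (\<forall>j\<in>J. (\<Sum>i\<in>I. c i * a i j) = 0)"
  using assms(2-)
proof (induction J arbitrary: I a rule: finite_induct)
  case empty
  thus ?case using is_subfieldD(2)[OF E] by (intro exI[of _ "\<lambda>_. 1"]) (auto simp: card_gt_0_iff)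
next
  case (insert l J)
  show ?case
  proof (cases "\<forall>i\<in>I. a i l = 0")
    case True
    have "card J < card I" using insert by simp
    from insert.IH[OF insert.prems(1) this, of a] insert.prems(3)
    obtain c where "\<forall>i\<in>I. c i \<in> E" "\<exists>i\<in>I. c i \<noteq> 0" "\<forall>j\<in>J. (\<Sum>i\<in>I. c i * a i j) = 0" by auto
    thus ?thesis using True by (intro exI[of _ c]) auto
  next
    case False
    then obtain k where k: "k \<in> I" "a k l \<noteq> 0" by blast
    define a' where "a' = (\<lambda>i j. a i j - a i l / a k l * a k j)"
    have "card J < card (I - {k})" using insert k by simp
    moreover have "a' i j \<in> E" if "i \<in> I - {k}" "j \<in> J" for i j
      using that insert.prems(3) k unfolding a'_def by (auto intro!: is_subfieldD[OF E])
    ultimately obtain c where c: "\<forall>i\<in>I - {k}. c i \<in> E" "\<exists>i\<in>I - {k}. c i \<noteq> 0"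
        "\<forall>j\<in>J. (\<Sum>i\<in>I - {k}. c i * a' i j) = 0"
      using insert.IH[of "I - {k}" a'] insert.prems(1) by auto
    define s where "s = - (\<Sum>i\<in>I - {k}. c i * (a i l / a k l))"
    define c' where "c' = c(k := s)"
    have split: "(\<Sum>i\<in>I. c' i * a i j) = s * a k j + (\<Sum>i\<in>I - {k}. c i * a i j)" for j
      using k insert.prems(1) by (simp add: sum.remove[of I k] c'_def)
    have "(\<Sum>i\<in>I. c' i * a i j) = (\<Sum>i\<in>I - {k}. c i * a' i j)" for j
      unfolding split a'_def s_def
      by (simp add: right_diff_distrib sum_subtractf sum_distrib_right mult.assoc)
    moreover have "(\<Sum>i\<in>I - {k}. c i * a' i l) = 0" using k by (simp add: a'_def)
    moreover have "s \<in> E" unfolding s_def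
      using c k insert.prems(3) by (auto intro!: is_subfieldD[OF E] is_subfield_sum[OF E])
    ultimately show ?thesis using c
      by (intro exI[of _ c']) (auto simp: c'_def)
  qed
qed

definition polys :: "'a::zero set \<Rightarrow> 'a poly set" where
  "polys E = {p. \<forall>i. coeff p i \<in> E}"

lemma polysD: "p \<in> polys E \<Longrightarrow> coeff p i \<in> E"
  by (simp add: polys_def)

lemma polys_closed:
  assumes E: "is_subfield E"
  shows "0 \<in> polys E" "1 \<in> polys E" "p \<in> polys E \<Longrightarrow> q \<in> polys E \<Longrightarrow> p + q \<in> polys E"
    "p \<in> polys E \<Longrightarrow> q \<in> polys E \<Longrightarrow> p - q \<in> polys E" "p \<in> polys E \<Longrightarrow> - p \<in> polys E"
    "p \<in> polys E \<Longrightarrow> q \<in> polys E \<Longrightarrow> p * q \<in> polys E"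
    "c \<in> E \<Longrightarrow> monom c n \<in> polys E" "c \<in> E \<Longrightarrow> p \<in> polys E \<Longrightarrow> Polynomial.smult c p \<in> polys E"
    "c \<in> E \<Longrightarrow> p \<in> polys E \<Longrightarrow> pCons c p \<in> polys E"
  using is_subfieldD[OF E]
  by (auto simp: polys_def coeff_mult coeff_pCons intro!: is_subfield_sum[OF E] split: nat.splits)

lemma polys_division:
  assumes E: "is_subfield E" and p: "p \<in> polys E" "p \<noteq> 0" and g: "g \<in> polys E"
  shows "\<exists>q\<in>polys E. \<exists>r\<in>polys E. g = p * q + r \<and> (r = 0 \<or> degree r < degree p)"
  using g
proof (induction "degree g" arbitrary: g rule: less_induct)
  case less
  show ?case
  proof (cases "g = 0 \<or> degree g < degree p")
    case True
    thus ?thesis using less.prems polys_closed[OF E] by (intro bexI[of _ 0] bexI[of _ g]) auto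
  next
    case False
    let ?m = "monom (lead_coeff g / lead_coeff p) (degree g - degree p)"
    have m: "?m \<in> polys E" using p less.prems
      by (intro polys_closed[OF E] is_subfieldD[OF E] polysD)
    define h where "h = g - p * ?m"
    have h: "h \<in> polys E" unfolding h_def using m p less.prems by (intro polys_closed(4,6)[OF E])
    have deg: "degree (p * ?m) = degree g"
      using False p by (subst degree_mult_eq) (auto simp: degree_monom_eq)
    have lc: "coeff (p * ?m) (degree g) = lead_coeff g"
      using False p lead_coeff_mult[of p ?m] deg by (simp add: degree_monom_eq)
    have "h = 0 \<or> degree h < degree g"
    proof (cases "degree g = 0")
      case True
      hence "degree h = 0" unfolding h_def using deg by (metis degree_diff_le le_0_eq le_refl)
      moreover have "coeff h 0 = 0" using lc True by (simp add: h_def)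
      ultimately show ?thesis by (metis leading_coeff_0_iff)
    next
      case False
      have "degree h \<le> degree g" unfolding h_def using deg by (intro degree_diff_le) auto
      moreover have "coeff h (degree g) = 0" using lc by (simp add: h_def)
      ultimately show ?thesis using False by (metis leading_coeff_0_iff le_neq_implies_less)
    qed
    hence "\<exists>q\<in>polys E. \<exists>r\<in>polys E. h = p * q + r \<and> (r = 0 \<or> degree r < degree p)"
      using less.hyps[of h] h polys_closed(1)[OF E] by (metis add_0 mult_zero_right)
    then obtain q r where "q \<in> polys E" "r \<in> polys E" "h = p * q + r"
        "r = 0 \<or> degree r < degree p" by blast
    moreover from this have "g = p * (q + ?m) + r" by (simp add: h_def algebra_simps)
    ultimately show ?thesis using m polys_closed(3)[OF E] by blast
  qed
qed

lemma minimal_polynomial: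
  assumes E: "is_subfield E" and f: "f \<in> polys E" "f \<noteq> 0" "poly f x = 0"
  obtains p where "p \<in> polys E" "lead_coeff p = 1" "poly p x = 0"
    "degree p \<le> degree f" "degree p > 0"
    "\<And>g. g \<in> polys E \<Longrightarrow> poly g x = 0 \<Longrightarrow> g \<noteq> 0 \<Longrightarrow> degree p \<le> degree g"
proof -
  let ?P = "\<lambda>p. p \<in> polys E \<and> p \<noteq> 0 \<and> poly p x = 0"
  obtain p where p: "?P p" and min: "\<And>g. ?P g \<Longrightarrow> degree p \<le> degree g"
    using ex_has_least_nat[of ?P f degree] f by blast
  define q where "q = Polynomial.smult (inverse (lead_coeff p)) p"
  have q: "q \<in> polys E" unfolding q_def using p
    by (intro polys_closed[OF E] is_subfieldD[OF E] polysD) auto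
  have deg: "degree q = degree p" using p by (simp add: q_def)
  have lc: "lead_coeff q = 1" using p by (simp add: q_def)
  have root: "poly q x = 0" using p by (simp add: q_def)
  show thesis
  proof (rule that[of q])
    show "degree q > 0"
    proof (rule ccontr)
      assume "\<not> ?thesis"
      then obtain c where "q = [:c:]" by (auto elim: degree_eq_zeroE)
      with lc root show False by simp
    qed
  qed (use q deg lc root f min in auto)
qed

definition adjoin :: "'a::field set \<Rightarrow> 'a \<Rightarrow> 'a set" where
  "adjoin E x = (\<lambda>g. poly g x) ` polys E"

lemma adjoinI: "g \<in> polys E \<Longrightarrow> poly g x \<in> adjoin E x"
  by (simp add: adjoin_def)

lemma adjoin_mem:
  assumes "is_subfield E" shows "E \<subseteq> adjoin E x" "x \<in> adjoin E x"
proof -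
  show "E \<subseteq> adjoin E x"
    using adjoinI[of "[:c:]" E x for c] polys_closed(9,1)[OF assms] by auto
  show "x \<in> adjoin E x"
    using adjoinI[of "[:0, 1:]" E x] polys_closed(9,1)[OF assms] is_subfieldD(1,2)[OF assms] by auto
qed

lemma adjoin_minimal:
  assumes "is_subfield K" "E \<subseteq> K" "x \<in> K" shows "adjoin E x \<subseteq> K"
  using assms by (auto simp: adjoin_def poly_altdef polys_def intro!: is_subfield_sum is_subfieldD(4,9))

lemma is_subfield_adjoin:
  assumes E: "is_subfield E" and f: "f \<in> polys E" "f \<noteq> 0" "poly f x = 0"
  shows "is_subfield (adjoin E x)"
proof -
  obtain p where p: "p \<in> polys E" "lead_coeff p = 1" "poly p x = 0" "degree p > 0"
    and min: "\<And>g. g \<in> polys E \<Longrightarrow> poly g x = 0 \<Longrightarrow> g \<noteq> 0 \<Longrightarrow> degree p \<le> degree g"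
    using minimal_polynomial[OF E f] by metis
  have p0: "p \<noteq> 0" using p by auto
  have sub: "y - z \<in> adjoin E x" "y * z \<in> adjoin E x" if yz: "y \<in> adjoin E x" "z \<in> adjoin E x" for y z
  proof -
    obtain g h where gh: "y = poly g x" "z = poly h x" "g \<in> polys E" "h \<in> polys E"
      using yz by (auto simp: adjoin_def)
    show "y - z \<in> adjoin E x" using adjoinI[of "g - h" E x] gh polys_closed[OF E] by simp
    show "y * z \<in> adjoin E x" using adjoinI[of "g * h" E x] gh polys_closed[OF E] by simp
  qed
  have zero: "0 \<in> adjoin E x" using adjoinI[of 0 E x] polys_closed[OF E] by simp
  have neg: "- y \<in> adjoin E x" if "y \<in> adjoin E x" for y using sub(1)[OF zero that] by simp
  \<comment> \<open>Euclid's algorithm on \<open>p\<close> and \<open>g\<close>, run on values at \<open>x\<close>.\<close>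
  have inv: "inverse (poly g x) \<in> adjoin E x" if "g \<in> polys E" "poly g x \<noteq> 0" for g
    using that
  proof (induction "degree g" arbitrary: g rule: less_induct)
    case less
    have g0: "g \<noteq> 0" using less by auto
    consider "degree g = 0" | "degree g > 0" "degree g < degree p"
      | "degree g \<ge> degree p" by linarith
    thus ?case
    proof cases
      case 1
      then obtain c where c: "g = [:c:]" by (auto elim: degree_eq_zeroE)
      hence "c \<in> E" using less.prems polysD[of g E 0] by simp
      thus ?thesis using c is_subfieldD(5)[OF E] adjoin_mem(1)[OF E, of x] by auto
    next
      case 2
      obtain q r where qr: "q \<in> polys E" "r \<in> polys E" "p = g * q + r" "r = 0 \<or> degree r < degree g"
        using polys_division[OF E less.prems(1) g0 p(1)] by blast
      have q0: "q \<noteq> 0" using qr 2 p0 by auto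
      have "degree p = degree (g * q)"
      proof (cases "r = 0")
        case False
        have "degree (g * q) \<ge> degree g" using q0 g0 by (simp add: degree_mult_eq)
        hence "degree r < degree (g * q)" using qr False by linarith
        thus ?thesis using qr(3) by (simp add: degree_add_eq_left)
      qed (use qr in simp)
      hence "degree q < degree p" using q0 g0 2 by (simp add: degree_mult_eq)
      hence qx: "poly q x \<noteq> 0" using min[OF qr(1)] q0 by force
      have rx: "poly r x = - (poly g x * poly q x)"
        using arg_cong[OF qr(3), of "\<lambda>p. poly p x"] p by (simp add: eq_neg_iff_add_eq_0 add.commute)
      hence "poly r x \<noteq> 0" using qx less.prems by simp
      hence "inverse (poly r x) \<in> adjoin E x" using less.hyps[of r] qr by fastforce
      hence "- (poly q x * inverse (poly r x)) \<in> adjoin E x"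
        using adjoinI[OF qr(1)] by (intro neg sub)
      also have "- (poly q x * inverse (poly r x)) = inverse (poly g x)"
        using rx qx less.prems by (simp add: field_simps)
      finally show ?thesis .
    next
      case 3
      obtain q r where qr: "q \<in> polys E" "r \<in> polys E" "g = p * q + r" "r = 0 \<or> degree r < degree p"
        using polys_division[OF E p(1) p0 less.prems(1)] by blast
      have "poly g x = poly r x" using arg_cong[OF qr(3), of "\<lambda>p. poly p x"] p by simp
      thus ?thesis using less.hyps[of r] less.prems qr 3 by fastforce
    qed
  qed
  have "inverse y \<in> adjoin E x" if "y \<in> adjoin E x" for y
  proof (cases "y = 0")
    case False
    thus ?thesis using that inv by (auto simp: adjoin_def)
  qed (use zero in simp)
  thus ?thesis unfolding is_subfield_def
    using sub adjoin_mem(1)[OF E, of x] is_subfieldD(2)[OF E] by blast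
qed

lemma polys_mono: "E \<subseteq> K \<Longrightarrow> polys E \<subseteq> polys K"
  by (auto simp: polys_def)

definition spans :: "'a::field set \<Rightarrow> nat \<Rightarrow> (nat \<Rightarrow> 'a) \<Rightarrow> 'a set \<Rightarrow> bool" where
  "spans E n u K \<longleftrightarrow> (\<forall>i<n. u i \<in> K) \<and> (\<forall>x\<in>K. \<exists>c. (\<forall>i<n. c i \<in> E) \<and> x = (\<Sum>i<n. c i * u i))"

lemma spans_if_dimension:
  fixes E :: "'a::field_char_0 set"
  assumes E: "is_subfield E" and dim: "ring.dimension class_ring n E K"
  shows "\<exists>u. spans E n u K \<and> (\<forall>c. (\<forall>i<n. c i \<in> E) \<longrightarrow> (\<Sum>i<n. c i * u i) \<in> K)"
  using dim E
proof (induction rule: ring.dimension.induct[OF class_ring.ring_axioms, consumes 1, case_names zero_dim Suc_dim])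
  case (zero_dim E)
  show ?case by (auto simp: spans_def)
next
  case (Suc_dim v M n E)
  note E = Suc_dim.prems
  from Suc_dim obtain u where u: "spans E n u M" "\<And>c. (\<forall>i<n. c i \<in> E) \<Longrightarrow> (\<Sum>i<n. c i * u i) \<in> M" by blast
  have mem: "x \<in> ring.line_extension class_ring E v M \<longleftrightarrow> (\<exists>k\<in>E. \<exists>w\<in>M. x = k * v + w)" for x
    using ring.line_extension_mem_iff[OF class_ring.ring_axioms, of x E v M] by simp
  define u' where "u' = u(n := v)"
  have sum: "(\<Sum>i<Suc n. c i * u' i) = c n * v + (\<Sum>i<n. c i * u i)" for c
    by (simp add: u'_def)
  have zero: "0 \<in> M" using u(2)[of "\<lambda>_. 0"] is_subfieldD(1)[OF E] by simp
  have "u' i \<in> ring.line_extension class_ring E v M" if "i < Suc n" for i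
  proof (cases "i = n")
    case True
    thus ?thesis unfolding mem using zero is_subfieldD(2)[OF E]
      by (intro bexI[of _ 1] bexI[of _ 0]) (auto simp: u'_def)
  next
    case False
    hence "u i \<in> M" using that u(1) by (auto simp: spans_def)
    thus ?thesis unfolding mem using is_subfieldD(1)[OF E] False
      by (intro bexI[of _ 0] bexI[of _ "u i"]) (auto simp: u'_def)
  qed
  moreover have "\<exists>c. (\<forall>i<Suc n. c i \<in> E) \<and> x = (\<Sum>i<Suc n. c i * u' i)"
    if "x \<in> ring.line_extension class_ring E v M" for x
  proof -
    obtain k w where kw: "k \<in> E" "w \<in> M" "x = k * v + w" using \<open>x \<in> _\<close> unfolding mem by blast
    then obtain c where c: "\<forall>i<n. c i \<in> E" "w = (\<Sum>i<n. c i * u i)" using u(1) by (auto simp: spans_def)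
    show ?thesis unfolding sum using kw c
      by (intro exI[of _ "c(n := k)"]) auto
  qed
  moreover have "(\<Sum>i<Suc n. c i * u' i) \<in> ring.line_extension class_ring E v M" if "\<forall>i<Suc n. c i \<in> E" for c
    unfolding sum mem using that u(2)[of c] by auto
  ultimately show ?case unfolding spans_def by blast
qed

lemma algebraic_if_spans:
  assumes E: "is_subfield E" and K: "is_subfield K" "spans E d u K" and x: "x \<in> K"
  shows "\<exists>f\<in>polys E. f \<noteq> 0 \<and> poly f x = 0 \<and> degree f \<le> d"
proof -
  have "\<exists>c. (\<forall>j<d. c j \<in> E) \<and> x ^ i = (\<Sum>j<d. c j * u j)" for i
    using K(2) is_subfieldD(9)[OF K(1) x, of i] by (auto simp: spans_def)
  then obtain a where a: "\<And>i j. j < d \<Longrightarrow> a i j \<in> E" "\<And>i. x ^ i = (\<Sum>j<d. a i j * u j)" by metis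
  obtain c where c: "\<forall>i\<in>{..d}. c i \<in> E" "\<exists>i\<in>{..d}. c i \<noteq> 0" "\<forall>j\<in>{..<d}. (\<Sum>i\<le>d. c i * a i j) = 0"
    using nontrivial_solution[OF E, of "{..<d}" "{..d}" a] a(1) by auto
  define f where "f = (\<Sum>i\<le>d. monom (c i) i)"
  have coeff: "coeff f k = (if k \<le> d then c k else 0)" for k
    unfolding f_def coeff_sum by (simp add: coeff_monom)
  have "poly f x = (\<Sum>i\<le>d. c i * x ^ i)" by (simp add: f_def poly_sum poly_monom)
  also have "\<dots> = (\<Sum>i\<le>d. \<Sum>j<d. c i * a i j * u j)"
    unfolding a(2) by (simp add: sum_distrib_left mult.assoc)
  also have "\<dots> = (\<Sum>j<d. (\<Sum>i\<le>d. c i * a i j) * u j)"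
    by (subst sum.swap) (simp add: sum_distrib_right)
  finally have "poly f x = 0" using c(3) by simp
  moreover have "f \<in> polys E" using c(1) is_subfieldD(1)[OF E] by (auto simp: polys_def coeff)
  moreover have "f \<noteq> 0" using c(2) coeff by (metis atMost_iff coeff_0)
  moreover have "degree f \<le> d" by (rule degree_le) (simp add: coeff)
  ultimately show ?thesis by blast
qed

lemma spans_trans:
  assumes F: "is_subfield F" "spans E f w F" and K: "is_subfield K" "F \<subseteq> K" "spans F d u K"
  shows "spans E (f * d) (\<lambda>k. w (k mod f) * u (k div f)) K"
  unfolding spans_def
proof (intro conjI allI impI ballI)
  fix k assume k: "k < f * d"
  hence "f > 0" "k div f < d" by (auto simp: less_mult_imp_div_less mult.commute intro: Nat.gr0I)
  thus "w (k mod f) * u (k div f) \<in> K"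
    using F(2) K by (intro is_subfieldD(4)[OF K(1)]) (auto simp: spans_def)
next
  fix x assume "x \<in> K"
  then obtain c where c: "\<forall>j<d. c j \<in> F" "x = (\<Sum>j<d. c j * u j)" using K(3) unfolding spans_def by blast
  have "\<forall>j. \<exists>a. j < d \<longrightarrow> (\<forall>i<f. a i \<in> E) \<and> c j = (\<Sum>i<f. a i * w i)"
    using c(1) F(2) by (auto simp: spans_def)
  then obtain a where a: "\<And>j i. j < d \<Longrightarrow> i < f \<Longrightarrow> a j i \<in> E" "\<And>j. j < d \<Longrightarrow> c j = (\<Sum>i<f. a j i * w i)" by metis
  have "x = (\<Sum>j<d. \<Sum>i<f. a j i * (w i * u j))"
    unfolding c(2) using a(2) by (intro sum.cong refl) (simp add: sum_distrib_right mult.assoc)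
  also have "\<dots> = (\<Sum>(j,i)\<in>{..<d} \<times> {..<f}. a j i * (w i * u j))" by (rule sum.cartesian_product)
  also have "\<dots> = (\<Sum>k<f * d. a (k div f) (k mod f) * (w (k mod f) * u (k div f)))"
  proof (rule sum.reindex_bij_witness[of _ "\<lambda>k. (k div f, k mod f)" "\<lambda>(j,i). j * f + i"]; clarsimp)
    fix j i assume ji: "j < d" "i < f"
    hence "j * f + i < Suc j * f" by simp
    also have "\<dots> \<le> d * f" using ji by (intro mult_right_mono) auto
    finally show "j * f + i < f * d" by (simp add: mult.commute)
  next
    fix k assume k: "k < f * d"
    hence "f > 0" by (auto intro: Nat.gr0I)
    thus "k div f < d \<and> k mod f < f" using k by (simp add: less_mult_imp_div_less mult.commute)
  qed
  finally have "x = (\<Sum>k<f * d. a (k div f) (k mod f) * (w (k mod f) * u (k div f)))" .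
  moreover have "a (k div f) (k mod f) \<in> E" if "k < f * d" for k
  proof -
    have "f > 0" using that by (auto intro: Nat.gr0I)
    thus ?thesis using that by (intro a) (auto simp: less_mult_imp_div_less mult.commute)
  qed
  ultimately show "\<exists>c. (\<forall>k<f * d. c k \<in> E) \<and> x = (\<Sum>k<f * d. c k * (w (k mod f) * u (k div f)))"
    by (intro exI[of _ "\<lambda>k. a (k div f) (k mod f)"]) auto
qed

section \<open>Extending embeddings, and families of embeddings with rational sums\<close>

lemma embeddings_iff:
  "\<sigma> \<in> embeddings E \<longleftrightarrow> \<sigma> 1 = 1 \<and> (\<forall>x\<in>E. \<forall>y\<in>E. \<sigma> (x + y) = \<sigma> x + \<sigma> y \<and> \<sigma> (x * y) = \<sigma> x * \<sigma> y)"
  by (auto simp: embeddings_def Ring.ring_hom_def)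

lemma embeddings_mono: "E \<subseteq> K \<Longrightarrow> \<sigma> \<in> embeddings K \<Longrightarrow> \<sigma> \<in> embeddings E"
  by (auto simp: embeddings_iff)

lemma embedding_simps:
  assumes E: "is_subfield E" and \<sigma>: "\<sigma> \<in> embeddings E"
  shows "\<sigma> 0 = 0" "\<sigma> 1 = 1" "x \<in> E \<Longrightarrow> y \<in> E \<Longrightarrow> \<sigma> (x + y) = \<sigma> x + \<sigma> y"
    "x \<in> E \<Longrightarrow> y \<in> E \<Longrightarrow> \<sigma> (x * y) = \<sigma> x * \<sigma> y" "x \<in> E \<Longrightarrow> \<sigma> (- x) = - \<sigma> x"
    "x \<in> E \<Longrightarrow> y \<in> E \<Longrightarrow> \<sigma> (x - y) = \<sigma> x - \<sigma> y" "x \<in> E \<Longrightarrow> \<sigma> (x ^ n) = \<sigma> x ^ n"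
    "x \<in> E \<Longrightarrow> \<sigma> x = 0 \<longleftrightarrow> x = 0" "x \<in> E \<Longrightarrow> \<sigma> (inverse x) = inverse (\<sigma> x)"
proof -
  have "\<sigma> (0 + 0) = \<sigma> 0 + \<sigma> 0" using \<sigma> is_subfieldD(1)[OF E] unfolding embeddings_iff by blast
  thus zero: "\<sigma> 0 = 0" by (simp only: add_0 add_cancel_right_right)
  show one: "\<sigma> 1 = 1" using \<sigma> by (simp add: embeddings_iff)
  show add: "\<sigma> (x + y) = \<sigma> x + \<sigma> y" and mult: "\<sigma> (x * y) = \<sigma> x * \<sigma> y"
    if "x \<in> E" "y \<in> E" for x y using \<sigma> that by (auto simp: embeddings_iff)
  show neg: "\<sigma> (- x) = - \<sigma> x" if "x \<in> E" for x
    using add[of x "- x"] zero that is_subfieldD(6)[OF E] by (simp add: eq_neg_iff_add_eq_0 add.commute)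
  show "\<sigma> (x - y) = \<sigma> x - \<sigma> y" if "x \<in> E" "y \<in> E"
    using add[of x "- y"] neg that is_subfieldD(6)[OF E] by simp
  show "\<sigma> (x ^ n) = \<sigma> x ^ n" if "x \<in> E"
    using that by (induction n) (auto simp: one mult is_subfieldD(9)[OF E])
  have inv: "\<sigma> x * \<sigma> (inverse x) = 1" if "x \<in> E" "x \<noteq> 0" for x
    using mult[of x "inverse x"] that one is_subfieldD(5)[OF E] by simp
  show nz: "\<sigma> x = 0 \<longleftrightarrow> x = 0" if "x \<in> E" for x
    using inv[OF that] zero by (cases "x = 0") auto
  show "\<sigma> (inverse x) = inverse (\<sigma> x)" if "x \<in> E"
    using inv[OF that, THEN inverse_unique] zero by (cases "x = 0") auto
qed

lemma embedding_inj:
  assumes E: "is_subfield E" and \<sigma>: "\<sigma> \<in> embeddings E" and "x \<in> E" "y \<in> E" "\<sigma> x = \<sigma> y"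
  shows "x = y"
  using embedding_simps(6)[OF E \<sigma> assms(3,4)] embedding_simps(8)[OF E \<sigma> is_subfieldD(3)[OF E assms(3,4)]] assms(5)
  by simp

lemma embedding_sum:
  assumes E: "is_subfield E" and \<sigma>: "\<sigma> \<in> embeddings E" and "\<And>i. i \<in> I \<Longrightarrow> f i \<in> E"
  shows "\<sigma> (sum f I) = (\<Sum>i\<in>I. \<sigma> (f i))"
  using assms(3)
proof (induction I rule: infinite_finite_induct)
  case (insert i I)
  have "sum f I \<in> E" by (intro is_subfield_sum[OF E]) (use insert in auto)
  thus ?case using insert by (simp add: embedding_simps[OF E \<sigma>])
qed (simp_all add: embedding_simps[OF E \<sigma>])

lemma embedding_of_int:
  assumes E: "is_subfield E" and \<sigma>: "\<sigma> \<in> embeddings E"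
  shows "\<sigma> (of_int k) = of_int k"
proof (induction k rule: int_induct[of _ 0])
  case (step1 i)
  thus ?case by (simp add: embedding_simps[OF E \<sigma>] is_subfield_of_int[OF E] is_subfieldD(2)[OF E])
next
  case (step2 i)
  thus ?case by (simp add: embedding_simps[OF E \<sigma>] is_subfield_of_int[OF E] is_subfieldD(2)[OF E])
qed (simp add: embedding_simps[OF E \<sigma>])

lemma embedding_of_rat:
  assumes E: "is_subfield (E :: 'a::field_char_0 set)" and \<sigma>: "(\<sigma> :: 'a \<Rightarrow> 'b::field_char_0) \<in> embeddings E"
  shows "\<sigma> (of_rat r) = of_rat r"
proof -
  obtain a b where r: "r = Rat.Fract a b" "b > 0" by (cases r) auto
  hence "\<sigma> (of_rat r) = \<sigma> (of_int a * inverse (of_int b))" by (simp add: of_rat_rat divide_inverse)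
  also have "\<dots> = of_int a * inverse (of_int b)"
    by (simp add: embedding_simps[OF E \<sigma>] embedding_of_int[OF E \<sigma>] is_subfield_of_int[OF E] is_subfieldD(5)[OF E])
  finally show ?thesis using r by (simp add: of_rat_rat divide_inverse)
qed

lemma poly_map_embedding:
  assumes E: "is_subfield E" and \<sigma>: "\<sigma> \<in> embeddings E" and p: "p \<in> polys E" "q \<in> polys E"
  shows "map_poly \<sigma> (p + q) = map_poly \<sigma> p + map_poly \<sigma> q"
    and "map_poly \<sigma> (p * q) = map_poly \<sigma> p * map_poly \<sigma> q"
    and "degree (map_poly \<sigma> p) = degree p"
    and "x \<in> E \<Longrightarrow> poly (map_poly \<sigma> p) (\<sigma> x) = \<sigma> (poly p x)"
proof -
  note s = embedding_simps[OF E \<sigma>]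
  note c = polysD[OF p(1)] polysD[OF p(2)]
  show "map_poly \<sigma> (p + q) = map_poly \<sigma> p + map_poly \<sigma> q"
    using c by (intro poly_eqI) (simp add: coeff_map_poly s)
  show "map_poly \<sigma> (p * q) = map_poly \<sigma> p * map_poly \<sigma> q"
    using c by (intro poly_eqI)
      (simp add: coeff_map_poly s coeff_mult embedding_sum[OF E \<sigma>] is_subfieldD(4)[OF E])
  show deg: "degree (map_poly \<sigma> p) = degree p"
  proof (cases "p = 0")
    case False
    thus ?thesis using c(1) by (intro map_poly_degree_eq) (simp add: s)
  qed simp
  show "poly (map_poly \<sigma> p) (\<sigma> x) = \<sigma> (poly p x)" if x: "x \<in> E"
    unfolding poly_altdef deg using c x
    by (simp add: coeff_map_poly s embedding_sum[OF E \<sigma>] is_subfieldD(4,9)[OF E])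
qed

text \<open>
The value at \<open>g(x)\<close> has to be the image of \<open>g\<close> at \<open>z\<close>. This depends only on \<open>g(x)\<close>: by minimality,
\<open>p\<close> divides every polynomial over \<open>E\<close> that vanishes at \<open>x\<close>, and the image of \<open>p\<close> vanishes at \<open>z\<close>.
\<close>

lemma extend_embedding:
  fixes \<sigma> :: "'a::field_char_0 \<Rightarrow> 'b::field_char_0"
  assumes E: "is_subfield E" and \<sigma>: "\<sigma> \<in> embeddings E"
    and p: "p \<in> polys E" "p \<noteq> 0" "poly p x = 0"
    and min: "\<And>g. g \<in> polys E \<Longrightarrow> poly g x = 0 \<Longrightarrow> g \<noteq> 0 \<Longrightarrow> degree p \<le> degree g"
    and z: "poly (map_poly \<sigma> p) z = 0"
  obtains \<tau> where "\<tau> \<in> embeddings (adjoin E x)"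
    "\<And>g. g \<in> polys E \<Longrightarrow> \<tau> (poly g x) = poly (map_poly \<sigma> g) z"
proof -
  note s = embedding_simps[OF E \<sigma>]
  have kernel: "poly (map_poly \<sigma> g) z = 0" if g: "g \<in> polys E" "poly g x = 0" for g
  proof -
    obtain q r where qr: "q \<in> polys E" "r \<in> polys E" "g = p * q + r" "r = 0 \<or> degree r < degree p"
      using polys_division[OF E p(1,2) g(1)] by blast
    have "poly r x = 0" using arg_cong[OF qr(3), of "\<lambda>p. poly p x"] g p by simp
    hence "r = 0" using min[OF qr(2)] qr(4) by force
    thus ?thesis using qr(1,3) p(1) z by (simp add: poly_map_embedding[OF E \<sigma>])
  qed
  have well_defined: "poly (map_poly \<sigma> g) z = poly (map_poly \<sigma> h) z"
    if "g \<in> polys E" "h \<in> polys E" "poly g x = poly h x" for g h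
  proof -
    have gh: "g - h \<in> polys E" by (rule polys_closed(4)[OF E that(1,2)])
    hence "poly (map_poly \<sigma> (g - h)) z = 0" using that(3) by (intro kernel) auto
    moreover have "map_poly \<sigma> g = map_poly \<sigma> (g - h) + map_poly \<sigma> h"
      using poly_map_embedding(1)[OF E \<sigma> gh that(2)] by simp
    ultimately show ?thesis by simp
  qed
  define rep where "rep = (\<lambda>y. SOME g. g \<in> polys E \<and> poly g x = y)"
  define \<tau> where "\<tau> = (\<lambda>y. poly (map_poly \<sigma> (rep y)) z)"
  have \<tau>: "\<tau> (poly g x) = poly (map_poly \<sigma> g) z" if g: "g \<in> polys E" for g
  proof -
    have "rep (poly g x) \<in> polys E \<and> poly (rep (poly g x)) x = poly g x"
      unfolding rep_def using g by (intro someI[of "\<lambda>h. h \<in> polys E \<and> poly h x = poly g x"]) auto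
    thus ?thesis unfolding \<tau>_def using g well_defined by blast
  qed
  have "\<tau> \<in> embeddings (adjoin E x)"
    unfolding embeddings_iff
  proof (intro conjI ballI)
    have "\<tau> (poly 1 x) = poly (map_poly \<sigma> 1) z" by (intro \<tau> polys_closed(2)[OF E])
    moreover have "map_poly \<sigma> 1 = 1" by (simp add: map_poly_1 s)
    ultimately show "\<tau> 1 = 1" by simp
  next
    fix u v assume "u \<in> adjoin E x" "v \<in> adjoin E x"
    then obtain g h where gh: "u = poly g x" "v = poly h x" "g \<in> polys E" "h \<in> polys E"
      by (auto simp: adjoin_def)
    show "\<tau> (u + v) = \<tau> u + \<tau> v"
      using \<tau>[OF polys_closed(3)[OF E gh(3,4)]] \<tau>[OF gh(3)] \<tau>[OF gh(4)] gh
      by (simp add: poly_map_embedding[OF E \<sigma>])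
    show "\<tau> (u * v) = \<tau> u * \<tau> v"
      using \<tau>[OF polys_closed(6)[OF E gh(3,4)]] \<tau>[OF gh(3)] \<tau>[OF gh(4)] gh
      by (simp add: poly_map_embedding[OF E \<sigma>])
  qed
  thus thesis using \<tau> by (rule that)
qed

text \<open>
Newton's identity expresses the power sums by the coefficients, in the same way for every embedding, so
one element \<open>s\<close> of \<open>E\<close> serves them all. This is how traces are computed inside \<open>E\<close>.
\<close>

lemma power_sums_in_subfield:
  fixes E :: "'a::field_char_0 set"
  assumes E: "is_subfield E" and p: "p \<in> polys E" "lead_coeff p = 1" and m: "m < degree p"
  shows "\<exists>s\<in>E. \<forall>(\<sigma> :: 'a \<Rightarrow> 'b::field_char_0)\<in>embeddings E. \<forall>zs. map_poly \<sigma> p = (\<Prod>z\<leftarrow>zs. [:- z, 1:]) \<longrightarrow>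
     (\<Sum>z\<leftarrow>zs. z ^ m) = \<sigma> s"
  using m
proof (induction m rule: less_induct)
  case (less m)
  let ?n = "degree p"
  define P where "P = (\<lambda>i s. \<forall>(\<sigma> :: 'a \<Rightarrow> 'b)\<in>embeddings E. \<forall>zs. map_poly \<sigma> p = (\<Prod>z\<leftarrow>zs. [:- z, 1:]) \<longrightarrow>
     (\<Sum>z\<leftarrow>zs. z ^ i) = \<sigma> s)"
  have "\<exists>s\<in>E. P i s" if "i < m" for i
    unfolding P_def using less.IH[OF that] that less.prems by simp
  then obtain s where s: "\<And>i. i < m \<Longrightarrow> s i \<in> E" and Ps: "\<And>i. i < m \<Longrightarrow> P i (s i)" by metis
  let ?c = "coeff p"
  define t where "t = of_nat (?n - m) * ?c (?n - m) - (\<Sum>i<m. ?c (?n - m + i) * s i)"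
  have t: "t \<in> E" unfolding t_def using s polysD[OF p(1)]
    by (auto intro!: is_subfieldD(3,4)[OF E] is_subfield_sum[OF E] is_subfield_of_nat[OF E])
  have "(\<Sum>z\<leftarrow>zs. z ^ m) = \<sigma> t"
    if \<sigma>: "\<sigma> \<in> embeddings E" and zs: "map_poly \<sigma> p = (\<Prod>z\<leftarrow>zs. [:- z, 1:])" for \<sigma> :: "'a \<Rightarrow> 'b" and zs
  proof -
    note \<sigma>s = embedding_simps[OF E \<sigma>]
    have len: "length zs = ?n"
      using degree_prod_list_linear(1)[of zs] zs poly_map_embedding(3)[OF E \<sigma> p(1) p(1)] by simp
    let ?k = "?n - m - 1"
    have k: "Suc ?k = ?n - m" using less.prems by simp
    have "of_nat (?n - m) * \<sigma> (?c (?n - m)) =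
        (\<Sum>j\<in>{?k<..?n}. \<sigma> (?c j) * (\<Sum>z\<leftarrow>zs. z ^ (j - (?n - m))))"
      using newton_identity[OF zs, of ?k] unfolding len k by (simp add: coeff_map_poly \<sigma>s)
    also have "\<dots> = (\<Sum>i<Suc m. \<sigma> (?c (?n - m + i)) * (\<Sum>z\<leftarrow>zs. z ^ i))"
      by (rule sum.reindex_bij_witness[of _ "\<lambda>i. ?n - m + i" "\<lambda>j. j - (?n - m)"]) (use less.prems in auto)
    also have "\<dots> = (\<Sum>i<m. \<sigma> (?c (?n - m + i)) * (\<Sum>z\<leftarrow>zs. z ^ i)) + (\<Sum>z\<leftarrow>zs. z ^ m)"
      using less.prems p(2) by (simp add: \<sigma>s)
    also have "(\<Sum>i<m. \<sigma> (?c (?n - m + i)) * (\<Sum>z\<leftarrow>zs. z ^ i)) = (\<Sum>i<m. \<sigma> (?c (?n - m + i)) * \<sigma> (s i))"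
      using Ps \<sigma> zs by (simp add: P_def)
    finally have "(\<Sum>z\<leftarrow>zs. z ^ m) = of_nat (?n - m) * \<sigma> (?c (?n - m)) - (\<Sum>i<m. \<sigma> (?c (?n - m + i)) * \<sigma> (s i))"
      by simp
    also have "\<dots> = \<sigma> t"
    proof -
      have nat: "\<sigma> (of_nat k) = of_nat k" "of_nat k \<in> E" for k
        using embedding_of_int[OF E \<sigma>, of "int k"] is_subfield_of_nat[OF E] by simp_all
      have c: "?c k \<in> E" for k using polysD[OF p(1)] .
      have cs: "?c (?n - m + i) * s i \<in> E" if "i < m" for i
        using s[OF that] c by (intro is_subfieldD(4)[OF E])
      have "\<sigma> t = \<sigma> (of_nat (?n - m) * ?c (?n - m)) - \<sigma> (\<Sum>i<m. ?c (?n - m + i) * s i)"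
        unfolding t_def
      proof (rule \<sigma>s(6))
        show "of_nat (?n - m) * ?c (?n - m) \<in> E" using nat(2) c by (rule is_subfieldD(4)[OF E])
        show "(\<Sum>i<m. ?c (?n - m + i) * s i) \<in> E" using cs by (intro is_subfield_sum[OF E]) simp
      qed
      also have "\<sigma> (\<Sum>i<m. ?c (?n - m + i) * s i) = (\<Sum>i<m. \<sigma> (?c (?n - m + i) * s i))"
        using cs by (intro embedding_sum[OF E \<sigma>]) auto
      also have "\<dots> = (\<Sum>i<m. \<sigma> (?c (?n - m + i)) * \<sigma> (s i))"
        using s c by (intro sum.cong refl \<sigma>s(4)) auto
      finally show ?thesis using nat c by (simp add: \<sigma>s(4))
    qed
    finally show ?thesis .
  qed
  thus ?case using t by blast
qed

lemma complex_poly_splits: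
  fixes p :: "complex poly"
  assumes "lead_coeff p = 1"
  obtains zs where "p = (\<Prod>z\<leftarrow>zs. [:- z, 1:])"
proof -
  have "p \<noteq> 0" using assms by auto
  then obtain A where A: "p = Polynomial.smult (lead_coeff p) (\<Prod>x\<in>#A. [:- x, 1:])"
    using alg_closed_imp_factorization[of p] by blast
  obtain zs where zs: "A = mset zs" by (metis ex_mset)
  have "p = (\<Prod>z\<leftarrow>zs. [:- z, 1:])"
    by (subst A) (simp add: assms zs mset_map[symmetric] prod_mset_prod_list del: mset_map)
  thus thesis by (rule that)
qed

text \<open>
The sum over such a list is a substitute for the trace to \<open>\<rat>\<close>. Repetitions are allowed, so that a list for a
smaller field can be obtained from one for a larger field by restriction.
\<close>

definition trace_list :: "'a::field_char_0 set \<Rightarrow> ('a \<Rightarrow> 'b::field_char_0) list \<Rightarrow> bool" where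
  "trace_list E Xs \<longleftrightarrow> Xs \<noteq> [] \<and> set Xs \<subseteq> embeddings E \<and> (\<forall>y\<in>E. (\<Sum>\<sigma>\<leftarrow>Xs. \<sigma> y) \<in> \<rat>)"

text \<open>
Every embedding \<open>\<sigma>\<close> in the list is extended once for each root \<open>z\<close> of the image of the minimal polynomial.
For \<open>y = \<Sum> c\<^sub>k x\<^sup>k\<close> with exponents below the degree, the extensions of \<open>\<sigma>\<close> sum to
\<open>\<Sum> \<sigma>(c\<^sub>k) \<Sum> z\<^sup>k\<close>, which is \<open>\<sigma>(\<Sum> c\<^sub>k s\<^sub>k)\<close> with the power sums \<open>s\<^sub>k\<close> in \<open>E\<close>. So the new sum
at \<open>y\<close> is the old one at an element of \<open>E\<close>.
\<close>

lemma trace_list_adjoin: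
  fixes Xs :: "('a::field_char_0 \<Rightarrow> complex) list"
  assumes E: "is_subfield E" and Xs: "trace_list E Xs"
    and f: "f \<in> polys E" "f \<noteq> 0" "poly f x = 0" "degree f \<le> d"
  obtains Ys m where "trace_list (adjoin E x) Ys" "1 \<le> m" "m \<le> d" "length Ys = m * length Xs"
    "\<And>y. y \<in> E \<Longrightarrow> (\<Sum>\<sigma>\<leftarrow>Ys. \<sigma> y) = of_nat m * (\<Sum>\<sigma>\<leftarrow>Xs. \<sigma> y)"
proof -
  obtain p where p: "p \<in> polys E" "lead_coeff p = 1" "poly p x = 0"
      "degree p \<le> degree f" "degree p > 0"
    and min: "\<And>g. g \<in> polys E \<Longrightarrow> poly g x = 0 \<Longrightarrow> g \<noteq> 0 \<Longrightarrow> degree p \<le> degree g"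
    using minimal_polynomial[OF E f(1-3)] by metis
  have p0: "p \<noteq> 0" using p by auto
  let ?n = "degree p"
  have emb: "\<sigma> \<in> embeddings E" if "\<sigma> \<in> set Xs" for \<sigma> using that Xs by (auto simp: trace_list_def)
  have "\<exists>zs. map_poly \<sigma> p = (\<Prod>z\<leftarrow>zs. [:- z, 1:])" if "\<sigma> \<in> set Xs" for \<sigma>
  proof -
    note \<sigma> = emb[OF that]
    have "lead_coeff (map_poly \<sigma> p) = 1"
      using poly_map_embedding(3)[OF E \<sigma> p(1) p(1)] p(2)
      by (simp add: coeff_map_poly embedding_simps[OF E \<sigma>])
    thus ?thesis using complex_poly_splits by metis
  qed
  then obtain R where R: "\<And>\<sigma>. \<sigma> \<in> set Xs \<Longrightarrow> map_poly \<sigma> p = (\<Prod>z\<leftarrow>R \<sigma>. [:- z, 1:])" by metis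
  have len: "length (R \<sigma>) = ?n" if "\<sigma> \<in> set Xs" for \<sigma>
    using degree_prod_list_linear(1)[of "R \<sigma>"] R[OF that] poly_map_embedding(3)[OF E emb[OF that] p(1) p(1)] by simp
  have ex: "\<exists>\<tau>. \<tau> \<in> embeddings (adjoin E x) \<and> (\<forall>g\<in>polys E. \<tau> (poly g x) = poly (map_poly \<sigma> g) z)"
    if "\<sigma> \<in> set Xs" "z \<in> set (R \<sigma>)" for \<sigma> z
  proof -
    have root: "poly (map_poly \<sigma> p) z = 0"
      unfolding R[OF that(1)] using that(2) by (rule poly_prod_list_linear_root)
    show ?thesis
      by (rule extend_embedding[OF E emb[OF that(1)] p(1) p0 p(3) min root]) blast+
  qed
  define T :: "('a \<Rightarrow> complex) \<Rightarrow> complex \<Rightarrow> 'a \<Rightarrow> complex" where "T = (\<lambda>\<sigma> z. SOME \<tau>. \<tau> \<in> embeddings (adjoin E x) \<and> (\<forall>g\<in>polys E. \<tau> (poly g x) = poly (map_poly \<sigma> g) z))"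
  have T: "T \<sigma> z \<in> embeddings (adjoin E x)" "g \<in> polys E \<Longrightarrow> T \<sigma> z (poly g x) = poly (map_poly \<sigma> g) z"
    if "\<sigma> \<in> set Xs" "z \<in> set (R \<sigma>)" for \<sigma> z g
    using someI_ex[OF ex[OF that]] unfolding T_def by blast+
  define Ys where "Ys = concat (map (\<lambda>\<sigma>. map (T \<sigma>) (R \<sigma>)) Xs)"
  have sum_concat: "(\<Sum>\<tau>\<leftarrow>concat (map (\<lambda>\<sigma>. map (T \<sigma>) (R \<sigma>)) zs). \<tau> y) = (\<Sum>\<sigma>\<leftarrow>zs. \<Sum>z\<leftarrow>R \<sigma>. T \<sigma> z y)" for y zs
    by (induction zs) (auto simp: comp_def)
  have Ys_sum: "(\<Sum>\<tau>\<leftarrow>Ys. \<tau> (poly g x)) = (\<Sum>\<sigma>\<leftarrow>Xs. \<Sum>z\<leftarrow>R \<sigma>. poly (map_poly \<sigma> g) z)" if "g \<in> polys E" for g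
    unfolding Ys_def sum_concat using T(2)[OF _ _ that] by (auto intro!: arg_cong[of _ _ sum_list] map_cong)
  have "\<exists>s\<in>E. \<forall>\<sigma>\<in>set Xs. (\<Sum>z\<leftarrow>R \<sigma>. z ^ k) = \<sigma> s" if "k < ?n" for k
    using power_sums_in_subfield[OF E p(1,2) that, where 'b = complex] emb R by blast
  then obtain s where s: "\<And>k. k < ?n \<Longrightarrow> s k \<in> E" "\<And>k \<sigma>. k < ?n \<Longrightarrow> \<sigma> \<in> set Xs \<Longrightarrow> (\<Sum>z\<leftarrow>R \<sigma>. z ^ k) = \<sigma> (s k)"
    by metis
  have rat: "(\<Sum>\<tau>\<leftarrow>Ys. \<tau> y) \<in> \<rat>" if "y \<in> adjoin E x" for y
  proof -
    obtain g0 where g0: "g0 \<in> polys E" "y = poly g0 x" using \<open>y \<in> adjoin E x\<close> by (auto simp: adjoin_def)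
    obtain q g where g: "q \<in> polys E" "g \<in> polys E" "g0 = p * q + g" "g = 0 \<or> degree g < ?n"
      using polys_division[OF E p(1) p0 g0(1)] by blast
    have y: "y = poly g x" using arg_cong[OF g(3), of "\<lambda>p. poly p x"] g0 p by simp
    have dg: "degree g < ?n" using g(4) p(5) by auto
    have "(\<Sum>z\<leftarrow>R \<sigma>. poly (map_poly \<sigma> g) z) = \<sigma> (\<Sum>k\<le>degree g. coeff g k * s k)"
      if \<sigma>: "\<sigma> \<in> set Xs" for \<sigma>
    proof -
      have "(\<Sum>z\<leftarrow>R \<sigma>. poly (map_poly \<sigma> g) z) =
          (\<Sum>k\<le>degree g. \<sigma> (coeff g k) * (\<Sum>z\<leftarrow>R \<sigma>. z ^ k))"
        unfolding poly_altdef poly_map_embedding(3)[OF E emb[OF \<sigma>] g(2) g(2)]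
        by (simp add: coeff_map_poly embedding_simps[OF E emb[OF \<sigma>]] sum_list_sum_commute sum_list_const_mult)
      also have "\<dots> = (\<Sum>k\<le>degree g. \<sigma> (coeff g k) * \<sigma> (s k))"
        using s(2)[OF _ \<sigma>] dg by (intro sum.cong) auto
      also have "\<dots> = \<sigma> (\<Sum>k\<le>degree g. coeff g k * s k)"
        using s(1) dg polysD[OF g(2)]
        by (subst embedding_sum[OF E emb[OF \<sigma>]]) (auto simp: embedding_simps(4)[OF E emb[OF \<sigma>]] intro!: is_subfieldD(4)[OF E])
      finally show ?thesis .
    qed
    hence "(\<Sum>\<tau>\<leftarrow>Ys. \<tau> y) = (\<Sum>\<sigma>\<leftarrow>Xs. \<sigma> (\<Sum>k\<le>degree g. coeff g k * s k))"
      unfolding y Ys_sum[OF g(2)] by (simp cong: map_cong)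
    moreover have "(\<Sum>k\<le>degree g. coeff g k * s k) \<in> E"
      using s(1) dg polysD[OF g(2)] by (auto intro!: is_subfield_sum[OF E] is_subfieldD(4)[OF E])
    ultimately show ?thesis using Xs by (auto simp: trace_list_def)
  qed
  have length_concat: "length (concat (map (\<lambda>\<sigma>. map (T \<sigma>) (R \<sigma>)) zs)) = ?n * length zs" if "set zs \<subseteq> set Xs" for zs
    using that by (induction zs) (auto simp: len)
  hence length: "length Ys = ?n * length Xs" unfolding Ys_def by simp
  show thesis
  proof (rule that[of Ys ?n])
    show "trace_list (adjoin E x) Ys" unfolding trace_list_def
    proof (intro conjI ballI)
      show "Ys \<noteq> []" using length p(5) Xs by (auto simp: trace_list_def)
      show "set Ys \<subseteq> embeddings (adjoin E x)" unfolding Ys_def using T(1) by auto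
    qed (rule rat)
    fix y assume y: "y \<in> E"
    hence "[:y:] \<in> polys E" using polys_closed(1,9)[OF E] by blast
    from Ys_sum[OF this] have "(\<Sum>\<tau>\<leftarrow>Ys. \<tau> y) = (\<Sum>\<sigma>\<leftarrow>Xs. \<Sum>z\<leftarrow>R \<sigma>. poly (map_poly \<sigma> [:y:]) z)" by simp
    also have "\<dots> = (\<Sum>\<sigma>\<leftarrow>Xs. \<Sum>z\<leftarrow>R \<sigma>. \<sigma> y)"
    proof (intro arg_cong[of _ _ sum_list] map_cong refl)
      fix \<sigma> z assume "\<sigma> \<in> set Xs"
      hence "map_poly \<sigma> [:y:] = [:\<sigma> y:]"
        using embedding_simps(1)[OF E emb] by (intro poly_eqI) (simp add: coeff_map_poly coeff_pCons split: nat.splits)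
      thus "poly (map_poly \<sigma> [:y:]) z = \<sigma> y" by simp
    qed
    also have "\<dots> = (\<Sum>\<sigma>\<leftarrow>Xs. of_nat ?n * \<sigma> y)"
      by (intro arg_cong[of _ _ sum_list] map_cong refl) (simp add: sum_list_triv len)
    finally show "(\<Sum>\<tau>\<leftarrow>Ys. \<tau> y) = of_nat ?n * (\<Sum>\<sigma>\<leftarrow>Xs. \<sigma> y)" by (simp add: sum_list_const_mult)
  qed (use p f(4) length in auto)
qed

text \<open>
Adjoin the members of the spanning family one after the other; each has degree at most \<open>d\<close> over \<open>F\<close>,
hence over every field in between. The bounds on \<open>m\<close> and on the length make all later constants
independent of \<open>K\<close>.
\<close>

theorem trace_list_extension:
  fixes Xs :: "('a::field_char_0 \<Rightarrow> complex) list"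
  assumes F: "is_subfield F" and K: "is_subfield K" "F \<subseteq> K" "spans F d u K" and Xs: "trace_list F Xs"
  obtains Ys m where "trace_list K Ys" "1 \<le> m" "m \<le> d ^ d" "length Ys = m * length Xs"
    "\<And>y. y \<in> F \<Longrightarrow> (\<Sum>\<sigma>\<leftarrow>Ys. \<sigma> y) = of_nat m * (\<Sum>\<sigma>\<leftarrow>Xs. \<sigma> y)"
proof -
  have "\<exists>E (Ys :: ('a \<Rightarrow> complex) list) m. is_subfield E \<and> F \<subseteq> E \<and> E \<subseteq> K \<and> (\<forall>i<k. u i \<in> E) \<and> trace_list E Ys \<and>
      1 \<le> m \<and> m \<le> d ^ k \<and> length Ys = m * length Xs \<and>
      (\<forall>y\<in>F. (\<Sum>\<sigma>\<leftarrow>Ys. \<sigma> y) = of_nat m * (\<Sum>\<sigma>\<leftarrow>Xs. \<sigma> y))" if "k \<le> d" for k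
    using that
  proof (induction k)
    case 0
    show ?case using F K Xs by (intro exI[of _ F] exI[of _ Xs] exI[of _ 1]) auto
  next
    case (Suc k)
    then obtain E m and Ys :: "('a \<Rightarrow> complex) list" where E: "is_subfield E" "F \<subseteq> E" "E \<subseteq> K" "\<forall>i<k. u i \<in> E"
      and Ys: "trace_list E Ys" and m: "1 \<le> m" "m \<le> d ^ k" "length Ys = m * length Xs"
      and sum: "\<And>y. y \<in> F \<Longrightarrow> (\<Sum>\<sigma>\<leftarrow>Ys. \<sigma> y) = of_nat m * (\<Sum>\<sigma>\<leftarrow>Xs. \<sigma> y)"
      by fastforce
    have uk: "u k \<in> K" using K(3) Suc.prems by (auto simp: spans_def)
    obtain f where f: "f \<in> polys F" "f \<noteq> 0" "poly f (u k) = 0" "degree f \<le> d"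
      using algebraic_if_spans[OF F K(1,3) uk] by blast
    hence f': "f \<in> polys E" using polys_mono[OF E(2)] by blast
    obtain Zs n where Zs: "trace_list (adjoin E (u k)) Zs" "1 \<le> n" "n \<le> d" "length Zs = n * length Ys"
      "\<And>y. y \<in> E \<Longrightarrow> (\<Sum>\<sigma>\<leftarrow>Zs. \<sigma> y) = of_nat n * (\<Sum>\<sigma>\<leftarrow>Ys. \<sigma> y)"
      using trace_list_adjoin[OF E(1) Ys f' f(2-4)] by metis
    show ?case
    proof (intro exI[of _ "adjoin E (u k)"] exI[of _ Zs] exI[of _ "n * m"] conjI ballI allI impI)
      show "is_subfield (adjoin E (u k))" by (rule is_subfield_adjoin[OF E(1) f' f(2,3)])
      show "F \<subseteq> adjoin E (u k)" using adjoin_mem(1)[OF E(1)] E(2) by blast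
      show "adjoin E (u k) \<subseteq> K" by (rule adjoin_minimal[OF K(1) E(3) uk])
      show "u i \<in> adjoin E (u k)" if "i < Suc k" for i
      proof (cases "i = k")
        case False
        hence "u i \<in> E" using that E(4) by simp
        thus ?thesis using adjoin_mem(1)[OF E(1)] by blast
      qed (use adjoin_mem(2)[OF E(1)] in simp)
      show "1 \<le> n * m" using Zs m by simp
      show "n * m \<le> d ^ Suc k" using Zs m by (simp add: mult_le_mono)
      show "(\<Sum>\<sigma>\<leftarrow>Zs. \<sigma> y) = of_nat (n * m) * (\<Sum>\<sigma>\<leftarrow>Xs. \<sigma> y)" if "y \<in> F" for y
        using Zs(5)[of y] sum[OF that] that E(2) by auto
    qed (use Zs m in auto)
  qed
  from this[of d] obtain E m and Ys :: "('a \<Rightarrow> complex) list" where E: "is_subfield E" "F \<subseteq> E" "E \<subseteq> K" "\<forall>i<d. u i \<in> E"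
    and Ys: "trace_list E Ys" and m: "1 \<le> m" "m \<le> d ^ d" "length Ys = m * length Xs"
    and sum: "\<And>y. y \<in> F \<Longrightarrow> (\<Sum>\<sigma>\<leftarrow>Ys. \<sigma> y) = of_nat m * (\<Sum>\<sigma>\<leftarrow>Xs. \<sigma> y)"
    by auto
  have "K \<subseteq> E"
  proof
    fix x assume "x \<in> K"
    then obtain c where c: "\<forall>i<d. c i \<in> F" "x = (\<Sum>i<d. c i * u i)" using K(3) by (auto simp: spans_def)
    show "x \<in> E" unfolding c(2) using c(1) E by (intro is_subfield_sum is_subfieldD(4)) auto
  qed
  hence "E = K" using E(3) by blast
  with Ys m sum show thesis by (intro that[of Ys m]) auto
qed

lemma trace_list_Rats:
  obtains Xs :: "('a::field_char_0 \<Rightarrow> complex) list" where "trace_list \<rat> Xs"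
proof -
  define \<sigma> :: "'a \<Rightarrow> complex" where "\<sigma> = (\<lambda>y. of_rat (THE r. y = of_rat r))"
  have \<sigma>: "\<sigma> (of_rat r) = of_rat r" for r by (simp add: \<sigma>_def)
  have "\<sigma> \<in> embeddings \<rat>"
    unfolding embeddings_iff
  proof (intro conjI ballI)
    show "\<sigma> 1 = 1" using \<sigma>[of 1] by simp
    fix x y :: 'a assume "x \<in> \<rat>" "y \<in> \<rat>"
    then obtain r s where "x = of_rat r" "y = of_rat s" by (auto elim!: Rats_cases)
    thus "\<sigma> (x + y) = \<sigma> x + \<sigma> y" "\<sigma> (x * y) = \<sigma> x * \<sigma> y"
      by (simp_all add: \<sigma> flip: of_rat_add of_rat_mult)
  qed
  moreover have "\<sigma> y \<in> \<rat>" if "y \<in> \<rat>" for y using that \<sigma> by (auto elim!: Rats_cases)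
  ultimately show thesis by (intro that[of "[\<sigma>]"]) (simp add: trace_list_def)
qed

lemma number_field_spans:
  assumes "number_field K"
  obtains n u where "is_subfield K" "spans \<rat> n u K"
  using assms is_subfield_if_subfield spans_if_dimension[OF is_subfield_Rats]
  unfolding number_field_def ring.finite_dimension_def[OF class_ring.ring_axioms] by metis

lemma number_field_trace_list:
  assumes "number_field K"
  obtains Xs :: "('a::field_char_0 \<Rightarrow> complex) list" where "trace_list K Xs"
proof -
  obtain n u where K: "is_subfield K" "spans \<rat> n u K" using number_field_spans[OF assms] .
  obtain Xs :: "('a \<Rightarrow> complex) list" where Xs: "trace_list \<rat> Xs" by (rule trace_list_Rats)
  show thesis
    using trace_list_extension[OF is_subfield_Rats K(1) is_subfield_Rats_subset[OF K(1)] K(2) Xs] that by metis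
qed

lemma real_trace_list:
  fixes Xs :: "('a::field_char_0 \<Rightarrow> complex) list"
  assumes K: "totally_real K" and Xs: "trace_list K Xs"
  shows "trace_list K (map (\<lambda>\<sigma> y. Re (\<sigma> y)) Xs)"
    and "\<And>y. y \<in> K \<Longrightarrow> (\<Sum>\<sigma>\<leftarrow>map (\<lambda>\<sigma> y. Re (\<sigma> y)) Xs. \<sigma> y) = Re (\<Sum>\<sigma>\<leftarrow>Xs. \<sigma> y)"
proof -
  have real: "Im (\<sigma> y) = 0" if "\<sigma> \<in> set Xs" "y \<in> K" for \<sigma> y
  proof -
    have "\<sigma> y \<in> \<real>" using that K Xs by (auto simp: totally_real_def trace_list_def)
    thus ?thesis by (auto simp: complex_is_Real_iff)
  qed
  show sum: "(\<Sum>\<sigma>\<leftarrow>map (\<lambda>\<sigma> y. Re (\<sigma> y)) Xs. \<sigma> y) = Re (\<Sum>\<sigma>\<leftarrow>Xs. \<sigma> y)" for y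
    by (induction Xs) auto
  show "trace_list K (map (\<lambda>\<sigma> y. Re (\<sigma> y)) Xs)"
    unfolding trace_list_def
  proof (intro conjI ballI subsetI)
    fix \<rho> assume "\<rho> \<in> set (map (\<lambda>\<sigma> y. Re (\<sigma> y)) Xs)"
    then obtain \<sigma> where \<sigma>: "\<sigma> \<in> set Xs" "\<rho> = (\<lambda>y. Re (\<sigma> y))" by auto
    have "\<sigma> \<in> embeddings K" using Xs \<sigma>(1) by (auto simp: trace_list_def)
    thus "\<rho> \<in> embeddings K" unfolding embeddings_iff \<sigma>(2) using real[OF \<sigma>(1)] by simp
  next
    fix y assume "y \<in> K"
    hence "(\<Sum>\<sigma>\<leftarrow>Xs. \<sigma> y) \<in> \<rat>" using Xs by (auto simp: trace_list_def)
    then obtain r where "(\<Sum>\<sigma>\<leftarrow>Xs. \<sigma> y) = of_rat r" by (rule Rats_cases)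
    moreover have "Re (of_rat r) = of_rat r" for r :: rat
    proof (cases r)
      case (Fract a b)
      thus ?thesis using Re_complex_of_real[of "of_int a / of_int b"] by (simp add: of_rat_rat)
    qed
    ultimately show "(\<Sum>\<sigma>\<leftarrow>map (\<lambda>\<sigma> y. Re (\<sigma> y)) Xs. \<sigma> y) \<in> \<rat>" unfolding sum by simp
  qed (use Xs in \<open>auto simp: trace_list_def\<close>)
qed

section \<open>Conjugates in a totally real field\<close>

lemma algebraic_int_coeff_prod_list_linear:
  fixes zs :: "'a::field_char_0 list"
  assumes "\<And>z. z \<in> set zs \<Longrightarrow> algebraic_int z"
  shows "algebraic_int (coeff (\<Prod>z\<leftarrow>zs. [:- z, 1:]) k)"
  using assms
proof (induction zs arbitrary: k)
  case Nil
  show ?case by (simp add: coeff_pCons one_pCons int_imp_algebraic_int split: nat.splits)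
next
  case (Cons z zs)
  let ?q = "\<Prod>z\<leftarrow>zs. [:- z, 1:]"
  have IH: "algebraic_int (coeff ?q k)" for k using Cons by simp
  have "algebraic_int (z * coeff ?q k)" using Cons.prems IH by (intro algebraic_int_mult) auto
  moreover have "coeff ([:- z, 1:] * ?q) k =
      (case k of 0 \<Rightarrow> 0 | Suc j \<Rightarrow> coeff ?q j) - z * coeff ?q k"
    by (simp add: coeff_pCons split: nat.splits)
  moreover have "algebraic_int (case k of 0 \<Rightarrow> 0 | Suc j \<Rightarrow> coeff ?q j)"
    using IH by (cases k) simp_all
  ultimately show ?case using algebraic_int_diff by simp
qed

text \<open>
Multiplication by \<open>X - z\<close> enlarges the largest coefficient at most by the factor \<open>1 + \<bar>z\<bar>\<close>.
\<close>

lemma abs_coeff_prod_list_linear: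
  fixes zs :: "real list"
  assumes "\<And>z. z \<in> set zs \<Longrightarrow> \<bar>z\<bar> \<le> B"
  shows "\<bar>coeff (\<Prod>z\<leftarrow>zs. [:- z, 1:]) k\<bar> \<le> (1 + B) ^ length zs"
  using assms
proof (induction zs arbitrary: k)
  case Nil
  show ?case by (simp add: coeff_pCons one_pCons split: nat.splits)
next
  case (Cons z zs)
  let ?q = "\<Prod>z\<leftarrow>zs. [:- z, 1:]"
  let ?M = "(1 + B) ^ length zs"
  have IH: "\<bar>coeff ?q k\<bar> \<le> ?M" for k using Cons by simp
  have z: "\<bar>z\<bar> \<le> B" using Cons by simp
  have M: "?M \<ge> 0" using IH[of 0] by linarith
  have "coeff ([:- z, 1:] * ?q) k =
      (case k of 0 \<Rightarrow> 0 | Suc j \<Rightarrow> coeff ?q j) - z * coeff ?q k"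
    by (simp add: coeff_pCons split: nat.splits)
  moreover have "\<bar>case k of 0 \<Rightarrow> 0 | Suc j \<Rightarrow> coeff ?q j\<bar> \<le> ?M"
    using IH M by (auto split: nat.splits)
  moreover have "\<bar>z * coeff ?q k\<bar> \<le> B * ?M"
    unfolding abs_mult using IH z by (intro mult_mono) auto
  ultimately have "\<bar>coeff ([:- z, 1:] * ?q) k\<bar> \<le> ?M + B * ?M" by linarith
  thus ?case by (simp add: distrib_right)
qed

lemma coeff_prod_list_linear_scaled:
  fixes c :: "'a::field"
  shows "coeff (\<Prod>z\<leftarrow>map (\<lambda>z. c * z) zs. [:- z, 1:]) k * c ^ k = c ^ length zs * coeff (\<Prod>z\<leftarrow>zs. [:- z, 1:]) k"
proof (induction zs arbitrary: k)
  case Nil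
  show ?case by (simp add: coeff_pCons one_pCons split: nat.splits)
next
  case (Cons z zs)
  show ?case
  proof (cases k)
    case 0
    thus ?thesis using Cons.IH[of 0] by simp
  next
    case (Suc j)
    thus ?thesis using Cons.IH[of j] Cons.IH[of k] by (simp add: algebra_simps)
  qed
qed

lemma embedding_algebraic_int:
  fixes \<sigma> :: "'a::field_char_0 \<Rightarrow> 'b::field_char_0"
  assumes E: "is_subfield E" and \<sigma>: "\<sigma> \<in> embeddings E" and x: "x \<in> E"
  shows "poly (map_poly of_int g) (\<sigma> x) = \<sigma> (poly (map_poly of_int g) x)"
    and "algebraic_int x \<Longrightarrow> algebraic_int (\<sigma> x)"
proof -
  have g: "map_poly of_int g \<in> polys E" for g by (simp add: polys_def coeff_map_poly is_subfield_of_int[OF E])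
  have m: "map_poly \<sigma> (map_poly of_int g) = map_poly of_int g" for g
    by (intro poly_eqI) (simp add: coeff_map_poly embedding_simps(1)[OF E \<sigma>] embedding_of_int[OF E \<sigma>])
  show eq: "poly (map_poly of_int g) (\<sigma> x) = \<sigma> (poly (map_poly of_int g) x)" for g
    using poly_map_embedding(4)[OF E \<sigma> g g x] by (simp add: m)
  show "algebraic_int x \<Longrightarrow> algebraic_int (\<sigma> x)"
    unfolding algebraic_int_altdef_ipoly using eq embedding_simps(1)[OF E \<sigma>] by metis
qed

lemma common_denominator:
  assumes "finite I" "\<And>i. i \<in> I \<Longrightarrow> c i \<in> (\<rat> :: 'a::field_char_0 set)"
  shows "\<exists>n::int. n > 0 \<and> (\<forall>i\<in>I. of_int n * c i \<in> \<int>)"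
  using assms
proof (induction I rule: finite_induct)
  case empty
  show ?case by (intro exI[of _ 1]) auto
next
  case (insert j I)
  then obtain n :: int where n: "n > 0" "\<And>i. i \<in> I \<Longrightarrow> of_int n * c i \<in> \<int>" by auto
  obtain r where r: "c j = of_rat r" using insert.prems by (auto elim: Rats_cases)
  obtain a m where m: "r = Rat.Fract a m" "m > 0" by (cases r) auto
  have "of_int (n * m) * c i \<in> \<int>" if "i \<in> insert j I" for i
  proof (cases "i = j")
    case True
    have "of_int (n * m) * c i = of_int (n * a)" using m by (simp add: True r of_rat_rat)
    thus ?thesis by (metis Ints_of_int)
  next
    case False
    hence "of_int n * c i \<in> \<int>" using that n by blast
    hence "of_int m * (of_int n * c i) \<in> \<int>" by (rule Ints_mult[OF Ints_of_int])
    thus ?thesis by (simp add: mult_ac)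
  qed
  thus ?case using n(1) m(2) by (intro exI[of _ "n * m"]) auto
qed

text \<open>
The form \<open>tr (x * y)\<close> is positive definite on \<open>K\<close> because \<open>tr (x * x)\<close> is a sum of squares of real
conjugates. On the ring of integers its values are rational algebraic integers, hence integers.
\<close>

locale real_traces =
  fixes K :: "'a::field_char_0 set" and Rs :: "('a \<Rightarrow> real) list"
  assumes K: "is_subfield K" and Rs: "trace_list K Rs"
begin

lemmas K_mult = is_subfieldD(4)[OF K] and K_diff = is_subfieldD(3)[OF K]
  and K_sum = is_subfield_sum[OF K] and K_of_int = is_subfield_of_int[OF K]

definition tr :: "'a \<Rightarrow> real" where "tr y = (\<Sum>\<rho>\<leftarrow>Rs. \<rho> y)"

lemma emb: "\<rho> \<in> set Rs \<Longrightarrow> \<rho> \<in> embeddings K"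
  using Rs by (auto simp: trace_list_def)

lemma tr_rat: "y \<in> K \<Longrightarrow> tr y \<in> \<rat>"
  using Rs by (auto simp: trace_list_def tr_def)

lemma tr_add: "x \<in> K \<Longrightarrow> y \<in> K \<Longrightarrow> tr (x + y) = tr x + tr y"
proof -
  have "x \<in> K \<Longrightarrow> y \<in> K \<Longrightarrow> set Xs \<subseteq> set Rs \<Longrightarrow> (\<Sum>\<rho>\<leftarrow>Xs. \<rho> (x + y)) = (\<Sum>\<rho>\<leftarrow>Xs. \<rho> x) + (\<Sum>\<rho>\<leftarrow>Xs. \<rho> y)" for Xs
    by (induction Xs) (auto simp: embedding_simps(3)[OF K emb])
  thus "x \<in> K \<Longrightarrow> y \<in> K \<Longrightarrow> tr (x + y) = tr x + tr y" by (simp add: tr_def)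
qed

lemma tr_0: "tr 0 = 0"
  using tr_add[of 0 0] is_subfieldD(1)[OF K] by simp

lemma tr_sum: "(\<And>i. i \<in> I \<Longrightarrow> f i \<in> K) \<Longrightarrow> tr (sum f I) = (\<Sum>i\<in>I. tr (f i))"
  by (induction I rule: infinite_finite_induct) (auto simp: tr_0 tr_add K_sum)

lemma tr_scale: "y \<in> K \<Longrightarrow> tr (of_rat r * y) = of_rat r * tr y"
proof -
  assume y: "y \<in> K"
  have r: "of_rat r \<in> K" using is_subfield_Rats_subset[OF K] by auto
  have "set Xs \<subseteq> set Rs \<Longrightarrow> (\<Sum>\<rho>\<leftarrow>Xs. \<rho> (of_rat r * y)) = of_rat r * (\<Sum>\<rho>\<leftarrow>Xs. \<rho> y)" for Xs
    by (induction Xs) (auto simp: embedding_simps(4)[OF K emb] r y embedding_of_rat[OF K emb] distrib_left)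
  thus ?thesis by (simp add: tr_def)
qed

lemma tr_mono:
  assumes "\<And>\<rho>. \<rho> \<in> set Rs \<Longrightarrow> \<rho> x \<le> c * \<rho> y"
  shows "tr x \<le> c * tr y"
proof -
  have "set Xs \<subseteq> set Rs \<Longrightarrow> (\<Sum>\<rho>\<leftarrow>Xs. \<rho> x) \<le> c * (\<Sum>\<rho>\<leftarrow>Xs. \<rho> y)" for Xs
    using assms by (induction Xs) (auto simp: distrib_left add_mono)
  thus ?thesis by (simp add: tr_def)
qed

lemma tr_ge:
  assumes "\<And>\<rho>. \<rho> \<in> set Rs \<Longrightarrow> \<rho> x \<ge> 0" and "\<rho> \<in> set Rs"
  shows "\<rho> x \<le> tr x"
  unfolding tr_def using assms by (intro member_le_sum_list) auto

lemma tr_pos: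
  assumes "\<And>\<rho>. \<rho> \<in> set Rs \<Longrightarrow> \<rho> x > 0" shows "tr x > 0"
proof -
  obtain \<rho> where "\<rho> \<in> set Rs" using Rs by (cases Rs) (auto simp: trace_list_def)
  thus ?thesis using tr_ge[of x \<rho>] assms by (meson less_eq_real_def order_less_le_trans)
qed

lemma square_embedding: "x \<in> K \<Longrightarrow> \<rho> \<in> set Rs \<Longrightarrow> \<rho> (x * x) = (\<rho> x)\<^sup>2"
  by (simp add: embedding_simps(4)[OF K emb] power2_eq_square)

lemma tr_square_pos: "x \<in> K \<Longrightarrow> x \<noteq> 0 \<Longrightarrow> tr (x * x) > 0"
  by (intro tr_pos) (simp add: square_embedding embedding_simps(8)[OF K emb])

lemma square_le_tr: "x \<in> K \<Longrightarrow> \<rho> \<in> set Rs \<Longrightarrow> (\<rho> x)\<^sup>2 \<le> tr (x * x)"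
  using tr_ge[of "x * x" \<rho>] by (simp add: square_embedding)

lemma tr_Ints: "y \<in> K \<Longrightarrow> algebraic_int y \<Longrightarrow> tr y \<in> \<int>"
proof (rule rational_algebraic_int_is_int)
  assume y: "y \<in> K" "algebraic_int y"
  have "algebraic_int (\<Sum>\<rho>\<leftarrow>Xs. \<rho> y)" if "set Xs \<subseteq> set Rs" for Xs
    using that
  proof (induction Xs)
    case (Cons \<rho> Xs)
    have "algebraic_int (\<rho> y)" using embedding_algebraic_int(2)[OF K emb y] Cons.prems by simp
    thus ?case using Cons algebraic_int_add by simp
  qed simp
  thus "algebraic_int (tr y)" by (simp add: tr_def)
qed (rule tr_rat)

lemma tr_ge_1:
  assumes "y \<in> K" "algebraic_int y" "tr y > 0" shows "tr y \<ge> 1"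
  using tr_Ints[OF assms(1,2)] assms(3) by (auto elim!: Ints_cases)

definition conj_poly :: "'a \<Rightarrow> real poly" where
  "conj_poly x = (\<Prod>z\<leftarrow>map (\<lambda>\<rho>. \<rho> x) Rs. [:- z, 1:])"

lemma conj_poly_Rats:
  assumes x: "x \<in> K" shows "coeff (conj_poly x) k \<in> \<rat>"
proof (rule Rats_coeff_if_power_sums)
  show "conj_poly x = (\<Prod>z\<leftarrow>map (\<lambda>\<rho>. \<rho> x) Rs. [:- z, 1:])" by (simp add: conj_poly_def)
  fix m
  have "(\<Sum>z\<leftarrow>map (\<lambda>\<rho>. \<rho> x) Rs. z ^ m) = tr (x ^ m)"
    unfolding tr_def map_map comp_def
    by (intro arg_cong[of _ _ sum_list] map_cong refl) (simp add: embedding_simps(7)[OF K emb x])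
  thus "(\<Sum>z\<leftarrow>map (\<lambda>\<rho>. \<rho> x) Rs. z ^ m) \<in> \<rat>" using tr_rat is_subfieldD(9)[OF K x] by simp
qed

lemma conj_poly_root: "\<rho> \<in> set Rs \<Longrightarrow> poly (conj_poly x) (\<rho> x) = 0"
  unfolding conj_poly_def by (intro poly_prod_list_linear_root) auto

lemma conj_poly_degree:
  "degree (conj_poly x) = length Rs" "lead_coeff (conj_poly x) = 1"
  using degree_prod_list_linear[of "map (\<lambda>\<rho>. \<rho> x) Rs"] unfolding conj_poly_def length_map by blast+

text \<open>
Embeddings are injective, so \<open>x\<close> is a root of every polynomial over \<open>\<int>\<close> that vanishes at one of its conjugates.
\<close>

lemma conj_poly_Ints:
  assumes x: "x \<in> K" and int: "\<And>k. coeff (conj_poly x) k \<in> \<int>"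
  obtains g :: "int poly" where "map_poly of_int g = conj_poly x" "poly (map_poly of_int g) x = 0"
proof -
  have fl: "of_int \<lfloor>coeff (conj_poly x) k\<rfloor> = coeff (conj_poly x) k" for k using int by simp
  define g where "g = map_poly floor (conj_poly x)"
  have g: "map_poly of_int g = conj_poly x"
    by (intro poly_eqI) (simp add: g_def coeff_map_poly fl)
  obtain \<rho> where \<rho>: "\<rho> \<in> set Rs" using Rs by (cases Rs) (auto simp: trace_list_def)
  have "\<rho> (poly (map_poly of_int g) x) = 0"
    using embedding_algebraic_int(1)[OF K emb[OF \<rho>] x, of g] conj_poly_root[OF \<rho>] g by simp
  moreover have "poly (map_poly of_int g) x \<in> K"
    using x by (auto simp: poly_altdef coeff_map_poly intro!: K_sum is_subfieldD(4,9)[OF K] K_of_int)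
  ultimately have "poly (map_poly of_int g) x = 0" using embedding_simps(8)[OF K emb[OF \<rho>]] by simp
  with g show thesis by (rule that)
qed

text \<open>
The coefficients are rational by Newton's identity and algebraic integers as polynomials in the conjugates,
hence integers.
\<close>

lemma conj_poly_algebraic_int:
  assumes x: "x \<in> K" "algebraic_int x"
  obtains g :: "int poly" where "map_poly of_int g = conj_poly x" "poly (map_poly of_int g) x = 0"
proof -
  have "coeff (conj_poly x) k \<in> \<int>" for k
  proof (rule rational_algebraic_int_is_int)
    show "algebraic_int (coeff (conj_poly x) k)" unfolding conj_poly_def
      using embedding_algebraic_int(2)[OF K emb x] by (intro algebraic_int_coeff_prod_list_linear) auto
  qed (rule conj_poly_Rats[OF x(1)])
  from conj_poly_Ints[OF x(1) this] that show thesis by blast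
qed

text \<open>
Total positivity quantifies over all real embeddings, whereas \<open>tr\<close> sees only those in \<open>Rs\<close>. An arbitrary
embedding still maps \<open>x\<close> to a root of the integer polynomial \<open>conj_poly x\<close>.
\<close>

lemma conj_poly_embedding:
  assumes x: "x \<in> K" "algebraic_int x" and \<chi>: "(\<chi> :: 'a \<Rightarrow> real) \<in> embeddings K"
  shows "\<exists>\<rho>\<in>set Rs. \<chi> x = \<rho> x"
proof -
  obtain g :: "int poly" where g: "map_poly of_int g = conj_poly x" "poly (map_poly of_int g) x = 0"
    by (rule conj_poly_algebraic_int[OF x])
  have "poly (conj_poly x) (\<chi> x) = 0"
    using embedding_algebraic_int(1)[OF K \<chi> x(1), of g] g embedding_simps(1)[OF K \<chi>] by simp
  moreover have "poly (\<Prod>z\<leftarrow>zs. [:- z, 1:]) w = 0 \<Longrightarrow> w \<in> set zs" for zs and w :: real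
    by (induction zs) auto
  ultimately have "\<chi> x \<in> set (map (\<lambda>\<rho>. \<rho> x) Rs)" unfolding conj_poly_def by blast
  thus ?thesis by auto
qed

text \<open>
Scaling the roots by \<open>N\<close> multiplies the coefficient at \<open>k\<close> by \<open>N\<close> to the power \<open>l - k\<close>, which clears all
denominators below the leading coefficient 1.
\<close>

lemma integer_multiple_algebraic_int:
  assumes x: "x \<in> K" obtains n :: int where "n > 0" "algebraic_int (of_int n * x)"
proof -
  let ?l = "length Rs"
  obtain N :: int where N: "N > 0" "\<And>k. k < ?l \<Longrightarrow> of_int N * coeff (conj_poly x) k \<in> \<int>"
    using common_denominator[of "{..<?l}" "coeff (conj_poly x)"] conj_poly_Rats[OF x] by auto
  have Nx: "of_int N * x \<in> K" using K_of_int x by (rule K_mult)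
  have m: "map (\<lambda>\<rho>. \<rho> (of_int N * x)) Rs = map (\<lambda>z. of_int N * z) (map (\<lambda>\<rho>. \<rho> x) Rs)"
    using x K_of_int by (simp add: embedding_simps(4)[OF K emb] embedding_of_int[OF K emb])
  have scaled: "coeff (conj_poly (of_int N * x)) k * of_int N ^ k = of_int N ^ ?l * coeff (conj_poly x) k" for k
    unfolding conj_poly_def m coeff_prod_list_linear_scaled length_map ..
  have "coeff (conj_poly (of_int N * x)) k \<in> \<int>" for k
  proof (cases k ?l rule: linorder_cases)
    case less
    then obtain i where "?l = Suc (k + i)" using less_imp_Suc_add by blast
    hence "coeff (conj_poly (of_int N * x)) k = of_int N ^ i * (of_int N * coeff (conj_poly x) k)"
      using scaled[of k] N(1) by (simp add: power_add)
    thus ?thesis using N(2)[OF less] by simp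
  next
    case equal
    thus ?thesis using conj_poly_degree[of "of_int N * x"] by simp
  qed (simp add: coeff_eq_0 conj_poly_degree)
  then obtain g :: "int poly" where g: "map_poly of_int g = conj_poly (of_int N * x)" "poly (map_poly of_int g) (of_int N * x) = 0"
    by (rule conj_poly_Ints[OF Nx])
  have "lead_coeff g = 1"
    using conj_poly_degree(2)[of "of_int N * x"] unfolding g(1)[symmetric] by (simp add: degree_map_poly coeff_map_poly)
  hence "algebraic_int (of_int N * x)" unfolding algebraic_int_altdef_ipoly using g(2) by blast
  with N(1) show thesis by (rule that)
qed

end

text \<open>
The trace of \<open>x\<^sup>2\<close> bounds all conjugates of \<open>x\<close>, hence the coefficients of an integer polynomial of degree at
most \<open>l\<close> with root \<open>x\<close>; there are finitely many such polynomials.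
\<close>

theorem finite_bounded_algebraic_ints:
  "finite {x :: 'a::field_char_0. \<exists>K Rs. real_traces K Rs \<and> length Rs \<le> l \<and> x \<in> K \<and> algebraic_int x \<and>
     real_traces.tr Rs (x * x) \<le> B\<^sup>2}" (is "finite ?S")
proof -
  let ?M = "\<lceil>(1 + \<bar>B\<bar>) ^ l\<rceil>"
  define G where "G = Poly ` {xs. set xs \<subseteq> {- ?M..?M} \<and> length xs \<le> Suc l} - {0}"
  have "finite G" unfolding G_def by (intro finite_Diff finite_imageI finite_lists_length_le) auto
  moreover have "finite {x :: 'a. poly (map_poly of_int g) x = 0}" if "g \<in> G" for g
    using that by (intro poly_roots_finite) (auto simp: G_def)
  ultimately have "finite (\<Union>g\<in>G. {x :: 'a. poly (map_poly of_int g) x = 0})" by blast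
  moreover have "?S \<subseteq> (\<Union>g\<in>G. {x :: 'a. poly (map_poly of_int g) x = 0})"
  proof
    fix x :: 'a assume "x \<in> ?S"
    then obtain K Rs where KRs: "real_traces K Rs" and l: "length Rs \<le> l" and x: "x \<in> K" "algebraic_int x"
      and B: "real_traces.tr Rs (x * x) \<le> B\<^sup>2" by blast
    interpret real_traces K Rs by fact
    obtain g :: "int poly" where g: "map_poly of_int g = conj_poly x" "poly (map_poly of_int g) x = 0"
      by (rule conj_poly_algebraic_int[OF x])
    have "\<bar>z\<bar> \<le> \<bar>B\<bar>" if "z \<in> set (map (\<lambda>\<rho>. \<rho> x) Rs)" for z
    proof -
      have "z\<^sup>2 \<le> B\<^sup>2" using that square_le_tr[OF x(1)] B by fastforce
      thus ?thesis by (simp add: abs_le_square_iff)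
    qed
    hence "\<bar>coeff (conj_poly x) k\<bar> \<le> (1 + \<bar>B\<bar>) ^ length Rs" for k
      unfolding conj_poly_def using abs_coeff_prod_list_linear[of "map (\<lambda>\<rho>. \<rho> x) Rs" "\<bar>B\<bar>" k] by simp
    also have "(1 + \<bar>B\<bar>) ^ length Rs \<le> (1 + \<bar>B\<bar>) ^ l" using l by (intro power_increasing) auto
    finally have "\<bar>of_int (coeff g k)\<bar> \<le> (1 + \<bar>B\<bar>) ^ l" for k
      unfolding g(1)[symmetric] by (simp add: coeff_map_poly)
    hence bd: "coeff g k \<in> {- ?M..?M}" for k
      by (smt (verit) atLeastAtMost_iff le_of_int_ceiling of_int_le_iff of_int_minus)
    have "degree g = length Rs"
      using conj_poly_degree(1)[of x] unfolding g(1)[symmetric] by (simp add: degree_map_poly)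
    hence "length (coeffs g) \<le> Suc l" using l by (cases "g = 0") (auto simp: length_coeffs)
    moreover have "set (coeffs g) \<subseteq> {- ?M..?M}"
      using bd by (auto simp: coeffs_def)
    moreover have "g \<noteq> 0" using g(1) conj_poly_degree(2)[of x] by auto
    ultimately have "g \<in> G" unfolding G_def using Poly_coeffs[of g] by (metis (mono_tags, lifting) DiffI image_eqI mem_Collect_eq singletonD)
    thus "x \<in> (\<Union>g\<in>G. {x :: 'a. poly (map_poly of_int g) x = 0})" using g(2) by blast
  qed
  ultimately show ?thesis by (rule rev_finite_subset)
qed

section \<open>Reduced bases of integral forms\<close>

primrec reduction_constant :: "nat \<Rightarrow> real" where
  "reduction_constant 0 = 1"
| "reduction_constant (Suc N) = 2 * (real (Suc N))\<^sup>2 * (1 + reduction_constant N)"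

lemma reduction_constant_ge_1: "reduction_constant N \<ge> 1"
proof (induction N)
  case (Suc N)
  have "1 \<le> (real (Suc N))\<^sup>2" by (rule one_le_power) simp
  hence "1 * 1 \<le> (2 * (real (Suc N))\<^sup>2) * (1 + reduction_constant N)"
    using Suc by (intro mult_mono) (linarith | simp)+
  thus ?case by simp
qed simp

text \<open>
Forms with a kernel are included so that the projection of a lattice along a vector is again an instance on
the same group: one replaces the form by \<open>b(x,y) - b(x,e) b(y,e) / b(e,e)\<close>, which has \<open>e\<close> in its kernel. Bounded
denominators play the part of discreteness.
\<close>

locale integral_psd_form =
  fixes M :: "'a::field_char_0 set" and b :: "'a \<Rightarrow> 'a \<Rightarrow> real"
  assumes zero_mem: "0 \<in> M"
    and diff_mem: "\<And>x y. x \<in> M \<Longrightarrow> y \<in> M \<Longrightarrow> x - y \<in> M"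
    and sym: "\<And>x y. x \<in> M \<Longrightarrow> y \<in> M \<Longrightarrow> b x y = b y x"
    and add: "\<And>x y z. x \<in> M \<Longrightarrow> y \<in> M \<Longrightarrow> z \<in> M \<Longrightarrow> b (x + y) z = b x z + b y z"
    and psd: "\<And>x. x \<in> M \<Longrightarrow> b x x \<ge> 0"
    and bounded_denominators: "\<exists>D::int. D > 0 \<and> (\<forall>x\<in>M. \<forall>y\<in>M. of_int D * b x y \<in> \<int>)"
begin

lemma uminus_mem: "x \<in> M \<Longrightarrow> - x \<in> M"
  using diff_mem[OF zero_mem] by simp

lemma add_mem: "x \<in> M \<Longrightarrow> y \<in> M \<Longrightarrow> x + y \<in> M"
  using diff_mem[of x "- y"] uminus_mem by simp

lemma scale_mem: "x \<in> M \<Longrightarrow> of_int k * x \<in> M"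
proof (induction k rule: int_induct[of _ 0])
  case (step1 i)
  thus ?case using add_mem by (simp add: distrib_right)
next
  case (step2 i)
  thus ?case using diff_mem by (simp add: left_diff_distrib)
qed (use zero_mem in simp)

lemma sum_mem: "(\<And>i. i \<in> I \<Longrightarrow> f i \<in> M) \<Longrightarrow> sum f I \<in> M"
  by (induction I rule: infinite_finite_induct) (auto intro: zero_mem add_mem)

lemma zero_left: "z \<in> M \<Longrightarrow> b 0 z = 0"
  using add[of 0 0 z] zero_mem by simp

lemma diff_left: "x \<in> M \<Longrightarrow> y \<in> M \<Longrightarrow> z \<in> M \<Longrightarrow> b (x - y) z = b x z - b y z"
  using add[of "x - y" y z] diff_mem by simp

lemma scale_left: "x \<in> M \<Longrightarrow> z \<in> M \<Longrightarrow> b (of_int k * x) z = of_int k * b x z"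
proof (induction k rule: int_induct[of _ 0])
  case (step1 i)
  thus ?case using add[of "of_int i * x" x z] scale_mem by (simp add: distrib_right)
next
  case (step2 i)
  thus ?case using diff_left[of "of_int i * x" x z] scale_mem by (simp add: left_diff_distrib)
qed (simp add: zero_left)

lemma sum_left: "(\<And>i. i \<in> I \<Longrightarrow> f i \<in> M) \<Longrightarrow> z \<in> M \<Longrightarrow> b (sum f I) z = (\<Sum>i\<in>I. b (f i) z)"
  by (induction I rule: infinite_finite_induct) (auto simp: zero_left add sum_mem)

lemma diff_right: "x \<in> M \<Longrightarrow> y \<in> M \<Longrightarrow> z \<in> M \<Longrightarrow> b z (x - y) = b z x - b z y"
  using diff_left sym diff_mem by metis

lemma scale_right: "x \<in> M \<Longrightarrow> z \<in> M \<Longrightarrow> b z (of_int k * x) = of_int k * b z x"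
  using scale_left sym scale_mem by metis

lemma exists_shortest:
  assumes "x0 \<in> M" "b x0 x0 > 0"
  obtains e where "e \<in> M" "b e e > 0" "\<And>x. x \<in> M \<Longrightarrow> b x x > 0 \<Longrightarrow> b e e \<le> b x x"
proof -
  obtain D :: int where D: "D > 0" "\<And>x y. x \<in> M \<Longrightarrow> y \<in> M \<Longrightarrow> of_int D * b x y \<in> \<int>"
    using bounded_denominators by blast
  let ?f = "\<lambda>x. nat \<lfloor>of_int D * b x x\<rfloor>"
  have f: "real (?f x) = of_int D * b x x" if "x \<in> M" for x
  proof -
    have "of_int D * b x x \<in> \<int>" "of_int D * b x x \<ge> 0" using D psd[OF that] that by auto
    thus ?thesis by (auto elim!: Ints_cases)
  qed
  obtain e where e: "e \<in> M \<and> b e e > 0" "\<And>x. x \<in> M \<and> b x x > 0 \<Longrightarrow> ?f e \<le> ?f x"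
    using ex_has_least_nat[of "\<lambda>x. x \<in> M \<and> b x x > 0" x0 ?f] assms by blast
  show thesis
  proof (rule that)
    fix x assume x: "x \<in> M" "b x x > 0"
    hence "real (?f e) \<le> real (?f x)" using e(2) by simp
    hence "of_int D * b e e \<le> of_int D * b x x" using f x e by simp
    thus "b e e \<le> b x x" using D by simp
  qed (use e in auto)
qed

lemma project_orthogonal:
  assumes e: "e \<in> M" "b e e > 0"
  shows "integral_psd_form M (\<lambda>x y. b x y - b x e * b y e / b e e)"
proof
  obtain D :: int where D: "D > 0" "\<And>x y. x \<in> M \<Longrightarrow> y \<in> M \<Longrightarrow> of_int D * b x y \<in> \<int>"
    using bounded_denominators by blast
  have int: "\<exists>k. of_int D * b x y = of_int k" if "x \<in> M" "y \<in> M" for x y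
    using D(2)[OF that] by (auto elim: Ints_cases)
  obtain n where n: "of_int D * b e e = of_int n" using int e by blast
  have n0: "n > 0" using n D e by (metis mult_pos_pos of_int_0_less_iff)
  show "b x x - b x e * b x e / b e e \<ge> 0" if x: "x \<in> M" for x
  proof -
    obtain k where k: "of_int D * b x e = of_int k" using int e x by blast
    \<comment> \<open>The projection of \<open>x\<close> may lie outside \<open>M\<close>, but its multiple by \<open>n\<close> is the following element.\<close>
    let ?w = "of_int n * x - of_int k * e"
    have "0 \<le> b ?w ?w" using x e by (intro psd diff_mem scale_mem)
    also have "b ?w ?w = of_int n * of_int n * b x x - 2 * of_int n * of_int k * b x e + of_int k * of_int k * b e e"
      using x e by (simp add: diff_left diff_right scale_left scale_right scale_mem diff_mem sym[of e x])
        (simp add: algebra_simps)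
    also have "\<dots> = (of_int D)\<^sup>2 * b e e * (b x x * b e e - b x e * b x e)"
      unfolding n[symmetric] k[symmetric] by (simp add: power2_eq_square algebra_simps)
    finally have "0 \<le> (of_int D)\<^sup>2 * b e e * (b x x * b e e - b x e * b x e)" .
    moreover have "(of_int D)\<^sup>2 * b e e > 0" using D e by simp
    ultimately have "0 \<le> b x x * b e e - b x e * b x e" by (metis mult_pos_neg not_le)
    thus ?thesis using e by (simp add: field_simps)
  qed
  show "\<exists>D::int. D > 0 \<and> (\<forall>x\<in>M. \<forall>y\<in>M. of_int D * (b x y - b x e * b y e / b e e) \<in> \<int>)"
  proof (intro exI[of _ "D * n"] conjI ballI)
    fix x y assume xy: "x \<in> M" "y \<in> M"
    obtain i j k where ijk: "of_int D * b x y = of_int i" "of_int D * b x e = of_int j" "of_int D * b y e = of_int k"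
      using int xy e by metis
    have "of_int (D * n) * (b x y - b x e * b y e / b e e) = of_int n * (of_int D * b x y) - of_int D * (of_int D * b e e) * (b x e * b y e / b e e)"
      unfolding n by (simp add: algebra_simps)
    also have "\<dots> = of_int n * (of_int D * b x y) - (of_int D * b x e) * (of_int D * b y e)" using e by simp
    also have "\<dots> = of_int (n * i - j * k)" unfolding ijk by simp
    finally show "of_int (D * n) * (b x y - b x e * b y e / b e e) \<in> \<int>" by simp
  qed (use D n0 in simp)
qed (use assms in \<open>auto simp: sym add zero_mem diff_mem add_divide_distrib distrib_right\<close>)

end

text \<open>
Hermite-Korkine-Zolotarev reduction. Let \<open>f\<close> be a shortest vector, take a reduced basis of the projection
\<open>b'\<close> along \<open>f\<close>, and lift it to vectors \<open>g\<^sub>i\<close> whose component along \<open>f\<close> has a coefficient of at most one half. Then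
\<open>b(g\<^sub>i,g\<^sub>i) \<le> b'(g\<^sub>i,g\<^sub>i) + b(f,f)/4\<close> and \<open>b(f,f) \<le> b(g\<^sub>i,g\<^sub>i)\<close>, so lifting costs only the factor 4/3, and the
coordinate bounds for \<open>b'\<close> carry over to the \<open>g\<^sub>i\<close>. The coordinate at \<open>f\<close> is the component of the vector
along \<open>f\<close> minus those of the \<open>g\<^sub>i\<close>, which are already bounded. The hypothesis bounds the rank of \<open>M\<close> modulo
the kernel by \<open>N\<close>.
\<close>

theorem reduced_basis:
  assumes "integral_psd_form M b"
    and "\<And>x. (\<forall>i\<le>N. x i \<in> M) \<Longrightarrow> \<exists>c::nat \<Rightarrow> int. (\<exists>i\<le>N. c i \<noteq> 0) \<and>
            b (\<Sum>i\<le>N. of_int (c i) * x i) (\<Sum>i\<le>N. of_int (c i) * x i) = 0"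
  shows "\<exists>(r::nat) e. r \<le> N \<and> (\<forall>i<r. e i \<in> M \<and> b (e i) (e i) > 0) \<and>
    (\<forall>x\<in>M. \<exists>y::nat \<Rightarrow> int. b (x - (\<Sum>i<r. of_int (y i) * e i)) (x - (\<Sum>i<r. of_int (y i) * e i)) = 0) \<and>
    (\<forall>(y::nat \<Rightarrow> int) i. i < r \<longrightarrow> (of_int (y i))\<^sup>2 * b (e i) (e i) \<le>
       reduction_constant N * b (\<Sum>j<r. of_int (y j) * e j) (\<Sum>j<r. of_int (y j) * e j))"
  using assms
proof (induction N arbitrary: b)
  case 0
  interpret integral_psd_form M b by fact
  have "b x x = 0" if x: "x \<in> M" for x
  proof -
    obtain c :: "nat \<Rightarrow> int" where c: "c 0 \<noteq> 0" "b (of_int (c 0) * x) (of_int (c 0) * x) = 0"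
      using 0(2)[of "\<lambda>_. x"] x by auto
    thus ?thesis using x by (simp add: scale_left scale_right scale_mem)
  qed
  thus ?case by (intro exI[of _ 0]) auto
next
  case (Suc N)
  interpret integral_psd_form M b by fact
  show ?case
  proof (cases "\<exists>x0\<in>M. b x0 x0 > 0")
    case False
    hence "b x x = 0" if "x \<in> M" for x using psd[OF that] that by force
    thus ?thesis by (intro exI[of _ 0]) auto
  next
    case True
    then obtain f where f: "f \<in> M" "b f f > 0" and fmin: "\<And>x. x \<in> M \<Longrightarrow> b x x > 0 \<Longrightarrow> b f f \<le> b x x"
      using exists_shortest by blast
    define \<mu> where "\<mu> = (\<lambda>x. b x f / b f f)"
    define b' where "b' = (\<lambda>x y. b x y - b x f * b y f / b f f)"
    have b'_form: "integral_psd_form M b'" unfolding b'_def by (rule project_orthogonal[OF f])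
    interpret b': integral_psd_form M b' by fact
    have split: "b x x = b' x x + (\<mu> x)\<^sup>2 * b f f" for x
      using f by (simp add: b'_def \<mu>_def power2_eq_square)
    have \<mu>_diff: "\<mu> (x - of_int k * f) = \<mu> x - of_int k" if "x \<in> M" for x k
      using f that by (simp add: \<mu>_def diff_left scale_left scale_mem diff_divide_distrib)
    have b'_shift: "b' (x - of_int k * f) (x - of_int k * f) = b' x x" if "x \<in> M" for x k
      using f that by (simp add: b'_def diff_left diff_right scale_left scale_right scale_mem
        diff_mem sym[of f x]) (simp add: field_simps)
    have near: "\<bar>\<mu> x - of_int (round (\<mu> x))\<bar> \<le> 1/2" for x
      using of_int_round_abs_le[of "\<mu> x"] by (simp add: abs_minus_commute)
    have sq: "t\<^sup>2 \<le> 1/4" if "\<bar>t\<bar> \<le> 1/2" for t :: real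
      using power_mono[OF that, of 2] by (simp add: power2_eq_square)
    \<comment> \<open>Adding \<open>f\<close> to a family of \<open>N + 1\<close> vectors gives a relation for \<open>b\<close>. It is a relation for \<open>b'\<close> among the
      others, and it involves one of them because \<open>f\<close> is not in the kernel of \<open>b\<close>.\<close>
    have rank': "\<exists>c::nat \<Rightarrow> int. (\<exists>i\<le>N. c i \<noteq> 0) \<and>
        b' (\<Sum>i\<le>N. of_int (c i) * x i) (\<Sum>i\<le>N. of_int (c i) * x i) = 0"
      if x: "\<forall>i\<le>N. x i \<in> M" for x
    proof -
      define x' where "x' = case_nat f x"
      have "\<forall>i\<le>Suc N. x' i \<in> M" using x f by (auto simp: x'_def split: nat.splits)
      from Suc.prems(2)[OF this] obtain c :: "nat \<Rightarrow> int" where c: "\<exists>i\<le>Suc N. c i \<noteq> 0"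
        "b (\<Sum>i\<le>Suc N. of_int (c i) * x' i) (\<Sum>i\<le>Suc N. of_int (c i) * x' i) = 0" by blast
      define w where "w = (\<Sum>i\<le>N. of_int (c (Suc i)) * x i)"
      have w: "w \<in> M" unfolding w_def using x by (auto intro!: sum_mem scale_mem)
      have "(\<Sum>i\<le>Suc N. of_int (c i) * x' i) = w - of_int (- c 0) * f"
        by (subst sum.atMost_Suc_shift) (simp add: x'_def w_def)
      with c(2) have z: "b (w - of_int (- c 0) * f) (w - of_int (- c 0) * f) = 0" by simp
      have "b' (w - of_int (- c 0) * f) (w - of_int (- c 0) * f) \<ge> 0"
        using w f by (intro b'.psd diff_mem scale_mem)
      hence "b' (w - of_int (- c 0) * f) (w - of_int (- c 0) * f) = 0"
        using split[of "w - of_int (- c 0) * f"] z f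
        by (smt (verit) mult_nonneg_nonneg zero_le_power2)
      hence "b' w w = 0" unfolding b'_shift[OF w] .
      moreover have "\<exists>i\<le>N. c (Suc i) \<noteq> 0"
      proof (rule ccontr)
        assume "\<not> ?thesis"
        hence 0: "\<forall>i\<le>N. c (Suc i) = 0" by auto
        hence "w = 0" by (simp add: w_def)
        moreover have "c 0 \<noteq> 0" using c(1) 0 by (metis Suc_le_mono not0_implies_Suc)
        moreover have "0 - of_int (- c 0) * f = of_int (c 0) * f" by simp
        ultimately show False using z f by (metis (no_types, lifting) scale_left scale_right scale_mem mult_eq_0_iff of_int_eq_0_iff less_irrefl)
      qed
      ultimately show ?thesis unfolding w_def by (intro exI[of _ "\<lambda>i. c (Suc i)"]) auto
    qed
    from Suc.IH[OF b'_form rank'] obtain r e' where r: "r \<le> N"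
      and e': "\<And>i. i < r \<Longrightarrow> e' i \<in> M" "\<And>i. i < r \<Longrightarrow> b' (e' i) (e' i) > 0"
      and gen': "\<And>x. x \<in> M \<Longrightarrow> \<exists>y::nat \<Rightarrow> int. b' (x - (\<Sum>i<r. of_int (y i) * e' i)) (x - (\<Sum>i<r. of_int (y i) * e' i)) = 0"
      and bd': "\<And>(y::nat \<Rightarrow> int) i. i < r \<Longrightarrow> (of_int (y i))\<^sup>2 * b' (e' i) (e' i) \<le>
         reduction_constant N * b' (\<Sum>j<r. of_int (y j) * e' j) (\<Sum>j<r. of_int (y j) * e' j)"
      by blast
    let ?C = "reduction_constant N"
    have C1: "?C \<ge> 1" by (rule reduction_constant_ge_1)
    \<comment> \<open>Lift the basis of the projection so that the components along \<open>f\<close> are at most one half.\<close>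
    define g where "g = (\<lambda>i. e' i - of_int (round (\<mu> (e' i))) * f)"
    have g: "g i \<in> M" "b' (g i) (g i) = b' (e' i) (e' i)" "(\<mu> (g i))\<^sup>2 \<le> 1/4" if "i < r" for i
      unfolding g_def \<mu>_diff[OF e'(1)[OF that]] b'_shift[OF e'(1)[OF that]]
      using e'(1)[OF that] f by (auto simp only: intro!: diff_mem scale_mem sq[OF near])
    have g_long: "b (g i) (g i) > 0" "b f f \<le> b (g i) (g i)" "b (g i) (g i) \<le> 4/3 * b' (g i) (g i)"
      if i: "i < r" for i
    proof -
      show pos: "b (g i) (g i) > 0"
        using split[of "g i"] g[OF i] e'(2)[OF i] f by (smt (verit) mult_nonneg_nonneg zero_le_power2)
      show fg: "b f f \<le> b (g i) (g i)" using fmin[OF g(1)[OF i] pos] .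
      have "(\<mu> (g i))\<^sup>2 * b f f \<le> 1/4 * b f f" using g[OF i] f by (intro mult_right_mono) auto
      thus "b (g i) (g i) \<le> 4/3 * b' (g i) (g i)" using split[of "g i"] fg by linarith
    qed
    have g_sum: "\<exists>k::int. (\<Sum>i<r. of_int (y i) * g i) = (\<Sum>i<r. of_int (y i) * e' i) - of_int k * f" for y :: "nat \<Rightarrow> int"
      by (intro exI[of _ "\<Sum>i<r. y i * round (\<mu> (e' i))"])
        (simp add: g_def right_diff_distrib sum_subtractf sum_distrib_right mult.assoc)
    have e'_mem: "(\<Sum>i<r. of_int (y i) * e' i) \<in> M" for y :: "nat \<Rightarrow> int"
      using e' by (auto intro!: sum_mem scale_mem)
    have g_mem: "(\<Sum>i<r. of_int (y i) * g i) \<in> M" for y :: "nat \<Rightarrow> int"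
      using g by (auto intro!: sum_mem scale_mem)
    define e where "e = case_nat f g"
    have e_sum: "(\<Sum>i<Suc r. of_int (y i) * e i) = (\<Sum>i<r. of_int (y (Suc i)) * g i) - of_int (- y 0) * f" for y :: "nat \<Rightarrow> int"
      by (subst sum.lessThan_Suc_shift) (simp add: e_def)
    show ?thesis
    proof (intro exI[of _ "Suc r"] exI[of _ e] conjI ballI allI impI)
      show "e i \<in> M" "b (e i) (e i) > 0" if "i < Suc r" for i
        using that f g(1) g_long(1) by (auto simp: e_def split: nat.splits)
    next
      fix x assume x: "x \<in> M"
      obtain y :: "nat \<Rightarrow> int" where y: "b' (x - (\<Sum>i<r. of_int (y i) * e' i)) (x - (\<Sum>i<r. of_int (y i) * e' i)) = 0"
        using gen'[OF x] by blast
      obtain k where k: "(\<Sum>i<r. of_int (y i) * g i) = (\<Sum>i<r. of_int (y i) * e' i) - of_int k * f"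
        using g_sum by blast
      define w where "w = x - (\<Sum>i<r. of_int (y i) * g i)"
      have w: "w \<in> M" using x g_mem by (simp add: w_def diff_mem)
      have "w = (x - (\<Sum>i<r. of_int (y i) * e' i)) - of_int (- k) * f" by (simp add: w_def k)
      hence "b' w w = 0" using y b'_shift x e'_mem diff_mem by metis
      \<comment> \<open>Rounding the component along \<open>f\<close> leaves a vector shorter than the shortest, hence one of length zero.\<close>
      let ?l = "round (\<mu> w)"
      let ?z = "w - of_int ?l * f"
      have z: "?z \<in> M" using w f by (intro diff_mem scale_mem)
      have "b ?z ?z = (\<mu> w - of_int ?l)\<^sup>2 * b f f"
        using split[of ?z] b'_shift[OF w] \<mu>_diff[OF w] \<open>b' w w = 0\<close> by simp
      also have "\<dots> \<le> 1/4 * b f f" using f near by (intro mult_right_mono sq) auto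
      finally have "b ?z ?z = 0" using fmin[OF z] psd[OF z] f by fastforce
      moreover have "?z = x - (\<Sum>i<Suc r. of_int (case_nat ?l y i) * e i)"
        unfolding e_sum by (simp add: w_def)
      ultimately show "\<exists>y::nat \<Rightarrow> int. b (x - (\<Sum>i<Suc r. of_int (y i) * e i)) (x - (\<Sum>i<Suc r. of_int (y i) * e i)) = 0"
        by (intro exI[of _ "case_nat ?l y"]) simp
    next
      fix y :: "nat \<Rightarrow> int" and i assume i: "i < Suc r"
      define s where "s = (\<Sum>i<Suc r. of_int (y i) * e i)"
      define s' where "s' = (\<Sum>i<r. of_int (y (Suc i)) * g i)"
      have s': "s' \<in> M" by (simp add: s'_def g_mem)
      have s_eq: "s = s' - of_int (- y 0) * f" unfolding s_def s'_def by (rule e_sum)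
      obtain k where "s' = (\<Sum>i<r. of_int (y (Suc i)) * e' i) - of_int k * f"
        using g_sum[of "\<lambda>i. y (Suc i)"] unfolding s'_def by blast
      hence b's: "b' s s = b' (\<Sum>i<r. of_int (y (Suc i)) * e' i) (\<Sum>i<r. of_int (y (Suc i)) * e' i)"
        using b'_shift s' e'_mem s_eq by metis
      have s: "s \<in> M" using s' f unfolding s_eq by (intro diff_mem scale_mem)
      have b's_le: "b' s s \<le> b s s" "0 \<le> b s s" using split[of s] f psd[OF s] by auto
      have tail: "(of_int (y (Suc j)))\<^sup>2 * b (g j) (g j) \<le> 4/3 * ?C * b s s" if j: "j < r" for j
      proof -
        have "(of_int (y (Suc j)))\<^sup>2 * b (g j) (g j) \<le> (of_int (y (Suc j)))\<^sup>2 * (4/3 * b' (e' j) (e' j))"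
          using g_long(3)[OF j] g(2)[OF j] by (intro mult_left_mono) auto
        also have "\<dots> = 4/3 * ((of_int (y (Suc j)))\<^sup>2 * b' (e' j) (e' j))" by simp
        also have "\<dots> \<le> 4/3 * (?C * b' s s)" unfolding b's by (intro mult_left_mono bd'[OF j, of "\<lambda>i. y (Suc i)"]) simp
        also have "\<dots> \<le> 4/3 * (?C * b s s)" using b's_le C1 by (intro mult_left_mono) auto
        finally show ?thesis by simp
      qed
      let ?R = "real (Suc N)"
      have C_ge: "4/3 * ?C \<le> reduction_constant (Suc N)"
      proof -
        have "4/3 * ?C \<le> 2 * (1 * (1 + ?C))" using C1 by simp
        also have "\<dots> \<le> 2 * (?R\<^sup>2 * (1 + ?C))"
          using C1 one_le_power[of ?R 2] by (intro mult_left_mono mult_right_mono) auto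
        finally show ?thesis by simp
      qed
      have "(of_int (y i))\<^sup>2 * b (e i) (e i) \<le> reduction_constant (Suc N) * b s s"
      proof (cases i)
        case (Suc j)
        hence "(of_int (y i))\<^sup>2 * b (e i) (e i) \<le> 4/3 * ?C * b s s" using tail[of j] i by (simp add: e_def)
        also have "\<dots> \<le> reduction_constant (Suc N) * b s s" using C_ge b's_le by (intro mult_right_mono)
        finally show ?thesis .
      next
        case 0
        have \<mu>s': "\<mu> s' = (\<Sum>j<r. of_int (y (Suc j)) * \<mu> (g j))"
          using g f unfolding s'_def \<mu>_def
          by (subst sum_left) (auto simp: scale_mem scale_left sum_divide_distrib)
        define a where "a = (\<lambda>j. if j < r then - of_int (y (Suc j)) * \<mu> (g j) else \<mu> s)"
        have "\<mu> s = \<mu> s' + of_int (y 0)" using \<mu>_diff[OF s', of "- y 0"] by (simp add: s_eq)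
        hence y0: "of_int (y 0) = (\<Sum>j<Suc r. a j)" by (simp add: \<mu>s' a_def sum_negf)
        have a_bd: "(a j)\<^sup>2 * b f f \<le> (1 + ?C) * b s s" if "j < Suc r" for j
        proof (cases "j < r")
          case True
          have "(a j)\<^sup>2 * b f f = (\<mu> (g j))\<^sup>2 * ((of_int (y (Suc j)))\<^sup>2 * b f f)"
            using True by (simp add: a_def power_mult_distrib)
          also have "\<dots> \<le> 1/4 * ((of_int (y (Suc j)))\<^sup>2 * b (g j) (g j))"
            using g(3)[OF True] g_long(2)[OF True] f by (intro mult_mono mult_left_mono) auto
          also have "\<dots> \<le> 1/4 * (4/3 * ?C * b s s)" using tail[OF True] by simp
          also have "\<dots> \<le> 1 * (?C * b s s)" using C1 b's_le by (simp add: mult_nonneg_nonneg)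
          also have "\<dots> \<le> (1 + ?C) * b s s" using b's_le by (simp add: distrib_right)
          finally show ?thesis .
        next
          case False
          have "(a j)\<^sup>2 * b f f \<le> b s s"
            using False split[of s] b'.psd[OF s] by (simp add: a_def)
          also have "\<dots> \<le> (1 + ?C) * b s s" using b's_le C1 by (simp add: distrib_right)
          finally show ?thesis .
        qed
        have "(of_int (y 0))\<^sup>2 \<le> real (Suc r) * (\<Sum>j<Suc r. (a j)\<^sup>2)"
          using sum_squared_le_sum_of_squares[of a "{..<Suc r}"] unfolding y0
          by (simp only: finite_lessThan card_lessThan mult.commute)
        hence "(of_int (y 0))\<^sup>2 * b f f \<le> (real (Suc r) * (\<Sum>j<Suc r. (a j)\<^sup>2)) * b f f"
          using f by (intro mult_right_mono) auto
        also have "\<dots> = real (Suc r) * (\<Sum>j<Suc r. (a j)\<^sup>2 * b f f)"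
          by (simp only: sum_distrib_right mult.assoc)
        also have "\<dots> \<le> real (Suc r) * (\<Sum>j<Suc r. (1 + ?C) * b s s)"
          using a_bd by (intro mult_left_mono sum_mono) auto
        also have "\<dots> = ((real (Suc r))\<^sup>2 * (1 + ?C)) * b s s" by (simp add: power2_eq_square)
        also have "\<dots> \<le> reduction_constant (Suc N) * b s s"
        proof (intro mult_right_mono b's_le)
          have "(real (Suc r))\<^sup>2 \<le> ?R\<^sup>2" using r by (intro power_mono) auto
          hence "(real (Suc r))\<^sup>2 \<le> 2 * ?R\<^sup>2" using zero_le_power2[of ?R] by linarith
          hence "(real (Suc r))\<^sup>2 * (1 + ?C) \<le> (2 * ?R\<^sup>2) * (1 + ?C)"
            using C1 by (intro mult_right_mono) auto
          thus "(real (Suc r))\<^sup>2 * (1 + ?C) \<le> reduction_constant (Suc N)" by simp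
        qed
        finally show ?thesis using 0 by (simp add: e_def)
      qed
      thus "(of_int (y i))\<^sup>2 * b (e i) (e i) \<le> reduction_constant (Suc N) *
          b (\<Sum>i<Suc r. of_int (y i) * e i) (\<Sum>i<Suc r. of_int (y i) * e i)"
        unfolding s_def .
    next
      show "Suc r \<le> Suc N" using r by simp
    qed
  qed
qed

section \<open>Reduced integral bases and trace duality\<close>

definition rat_linear_on :: "'a::field_char_0 set \<Rightarrow> ('a \<Rightarrow> rat) \<Rightarrow> bool" where
  "rat_linear_on E \<phi> \<longleftrightarrow> (\<forall>x\<in>E. \<forall>y\<in>E. \<phi> (x + y) = \<phi> x + \<phi> y) \<and> (\<forall>r. \<forall>x\<in>E. \<phi> (of_rat r * x) = r * \<phi> x)"

lemma rat_linear_on_sum: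
  assumes E: "is_subfield E" and \<phi>: "rat_linear_on E \<phi>" and "\<And>i. i \<in> I \<Longrightarrow> f i \<in> E"
  shows "\<phi> (sum f I) = (\<Sum>i\<in>I. \<phi> (f i))"
proof -
  have 0: "\<phi> 0 = 0" using \<phi> is_subfieldD(1)[OF E] unfolding rat_linear_on_def by (metis mult_zero_left mult_zero_right)
  show ?thesis using assms(3)
  proof (induction I rule: infinite_finite_induct)
    case (insert i I)
    have "sum f I \<in> E" by (intro is_subfield_sum[OF E]) (use insert in auto)
    thus ?case using insert \<phi> by (simp add: rat_linear_on_def)
  qed (simp_all add: 0)
qed

context real_traces begin

lemma of_rat_mem: "of_rat r \<in> K"
  using is_subfield_Rats_subset[OF K] by auto

lemma tr_square_eq_0: "x \<in> K \<Longrightarrow> tr (x * x) = 0 \<Longrightarrow> x = 0"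
  using tr_square_pos by force

lemma integral_psd_form_ring_of_integers: "integral_psd_form (ring_of_integers K) (\<lambda>x y. tr (x * y))"
proof
  show "0 \<in> ring_of_integers K" using is_subfieldD(1)[OF K] by (simp add: ring_of_integers_def)
  show "x - y \<in> ring_of_integers K" if "x \<in> ring_of_integers K" "y \<in> ring_of_integers K" for x y
    using that is_subfieldD(3)[OF K, of x y] algebraic_int_diff[of x y] by (simp add: ring_of_integers_def)
  show "tr (x * x) \<ge> 0" if "x \<in> ring_of_integers K" for x
  proof (cases "x = 0")
    case False
    thus ?thesis using that tr_square_pos[of x] by (simp add: ring_of_integers_def)
  qed (simp add: tr_0)
  have "tr (x * y) \<in> \<int>" if "x \<in> ring_of_integers K" "y \<in> ring_of_integers K" for x y
    using that by (intro tr_Ints K_mult algebraic_int_mult) (auto simp: ring_of_integers_def)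
  thus "\<exists>D::int. 0 < D \<and> (\<forall>x\<in>ring_of_integers K. \<forall>y\<in>ring_of_integers K. of_int D * tr (x * y) \<in> \<int>)"
    by (intro exI[of _ 1]) simp
  show "tr ((x + y) * z) = tr (x * z) + tr (y * z)"
    if "x \<in> ring_of_integers K" "y \<in> ring_of_integers K" "z \<in> ring_of_integers K" for x y z
    unfolding distrib_right using that by (intro tr_add K_mult) (auto simp: ring_of_integers_def)
qed (simp add: mult.commute)

text \<open>
Coordinates with respect to a reduced basis of the ring of integers extend to \<open>K\<close> by clearing denominators,
because every element of \<open>K\<close> has an integral multiple. The bound is homogeneous, so it persists; it
also shows that the coordinates are unique and hence additive.
\<close>

theorem reduced_integral_basis:
  assumes u: "spans \<rat> N u K"
  shows "\<exists>(r::nat) e Y. (\<forall>i<r. e i \<in> ring_of_integers K \<and> e i \<noteq> 0 \<and> rat_linear_on K (Y i) \<and>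
      (\<forall>x\<in>ring_of_integers K. Y i x \<in> \<int>) \<and>
      (\<forall>x\<in>K. (of_rat (Y i x))\<^sup>2 * tr (e i * e i) \<le> reduction_constant N * tr (x * x))) \<and>
    (\<forall>x\<in>K. x = (\<Sum>i<r. of_rat (Y i x) * e i))"
proof -
  let ?O = "ring_of_integers K"
  interpret form: integral_psd_form ?O "\<lambda>x y. tr (x * y)" by (rule integral_psd_form_ring_of_integers)
  have O: "x \<in> ?O \<longleftrightarrow> x \<in> K \<and> algebraic_int x" for x by (simp add: ring_of_integers_def)
  have rank: "\<exists>c::nat \<Rightarrow> int. (\<exists>i\<le>N. c i \<noteq> 0) \<and>
      tr ((\<Sum>i\<le>N. of_int (c i) * x i) * (\<Sum>i\<le>N. of_int (c i) * x i)) = 0"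
    if x: "\<forall>i\<le>N. x i \<in> ?O" for x
  proof -
    have "\<forall>i. \<exists>a. i \<le> N \<longrightarrow> (\<forall>j<N. a j \<in> \<rat>) \<and> x i = (\<Sum>j<N. a j * u j)"
      using x u by (auto simp: spans_def O)
    then obtain a where a: "\<And>i j. i \<le> N \<Longrightarrow> j < N \<Longrightarrow> a i j \<in> \<rat>" "\<And>i. i \<le> N \<Longrightarrow> x i = (\<Sum>j<N. a i j * u j)" by metis
    obtain c where c: "\<forall>i\<in>{..N}. c i \<in> \<rat>" "\<exists>i\<in>{..N}. c i \<noteq> 0" "\<forall>j\<in>{..<N}. (\<Sum>i\<le>N. c i * a i j) = 0"
      using nontrivial_solution[OF is_subfield_Rats, of "{..<N}" "{..N}" a] a(1) by auto
    obtain n :: int where n: "n > 0" "\<And>i. i \<le> N \<Longrightarrow> of_int n * c i \<in> \<int>"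
      using common_denominator[of "{..N}" c] c(1) by auto
    have "\<forall>i. \<exists>k::int. i \<le> N \<longrightarrow> of_int n * c i = of_int k" using n(2) by (auto elim: Ints_cases)
    then obtain k :: "nat \<Rightarrow> int" where k: "\<And>i. i \<le> N \<Longrightarrow> of_int n * c i = of_int (k i)" by metis
    have "(\<Sum>i\<le>N. of_int (k i) * x i) = (\<Sum>i\<le>N. (of_int n * c i) * (\<Sum>j<N. a i j * u j))"
      using k a(2) by (intro sum.cong) auto
    also have "\<dots> = (\<Sum>i\<le>N. \<Sum>j<N. of_int n * (c i * a i j) * u j)"
      by (simp add: sum_distrib_left mult.assoc)
    also have "\<dots> = (\<Sum>j<N. of_int n * (\<Sum>i\<le>N. c i * a i j) * u j)"
      by (subst sum.swap) (simp add: sum_distrib_left sum_distrib_right)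
    also have "\<dots> = 0" using c(3) by simp
    finally have "(\<Sum>i\<le>N. of_int (k i) * x i) = 0" .
    moreover have "\<exists>i\<le>N. k i \<noteq> 0" using c(2) k n(1)
      by (metis atMost_iff mult_eq_0_iff of_int_0 of_int_eq_0_iff order_less_irrefl)
    ultimately show ?thesis by (intro exI[of _ k]) (auto simp: tr_0)
  qed
  obtain r e where e: "\<And>i. i < r \<Longrightarrow> e i \<in> ?O" "\<And>i. i < r \<Longrightarrow> tr (e i * e i) > 0"
    and gen: "\<And>x. x \<in> ?O \<Longrightarrow> \<exists>y::nat \<Rightarrow> int. tr ((x - (\<Sum>i<r. of_int (y i) * e i)) * (x - (\<Sum>i<r. of_int (y i) * e i))) = 0"
    and bd: "\<And>(y::nat \<Rightarrow> int) i. i < r \<Longrightarrow> (of_int (y i))\<^sup>2 * tr (e i * e i) \<le>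
       reduction_constant N * tr ((\<Sum>j<r. of_int (y j) * e j) * (\<Sum>j<r. of_int (y j) * e j))"
    using reduced_basis[OF form.integral_psd_form_axioms rank] by blast
  have eK: "e i \<in> K" if "i < r" for i using e(1)[OF that] O by simp
  have int_coords: "\<exists>y::nat \<Rightarrow> int. x = (\<Sum>i<r. of_int (y i) * e i)" if "x \<in> ?O" for x
  proof -
    obtain y :: "nat \<Rightarrow> int" where y: "tr ((x - (\<Sum>i<r. of_int (y i) * e i)) * (x - (\<Sum>i<r. of_int (y i) * e i))) = 0"
      using gen[OF \<open>x \<in> ?O\<close>] by blast
    have "x - (\<Sum>i<r. of_int (y i) * e i) \<in> K"
      using that eK O by (intro is_subfieldD(3,4)[OF K] K_sum K_of_int) auto
    from tr_square_eq_0[OF this y] show ?thesis by auto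
  qed
  have rat_coords: "\<exists>c. x = (\<Sum>i<r. of_rat (c i) * e i)" if x: "x \<in> K" for x
  proof -
    obtain n :: int where n: "n > 0" "algebraic_int (of_int n * x)" by (rule integer_multiple_algebraic_int[OF x])
    hence "of_int n * x \<in> ?O" using x by (simp add: O K_mult K_of_int)
    then obtain y :: "nat \<Rightarrow> int" where y: "of_int n * x = (\<Sum>i<r. of_int (y i) * e i)" using int_coords by blast
    have "x = of_rat (1 / of_int n) * (of_int n * x)" using n(1) by (simp add: of_rat_divide)
    also have "\<dots> = (\<Sum>i<r. of_rat (of_int (y i) / of_int n) * e i)"
      unfolding y by (simp add: sum_distrib_left of_rat_divide)
    finally show ?thesis by (rule exI[of _ "\<lambda>i. of_int (y i) / of_int n"])
  qed
  have rat_bd: "(of_rat (c i))\<^sup>2 * tr (e i * e i) \<le>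
      reduction_constant N * tr ((\<Sum>j<r. of_rat (c j) * e j) * (\<Sum>j<r. of_rat (c j) * e j))" if i: "i < r" for c i
  proof -
    have rat: "c j \<in> \<rat>" for j using Rats_of_rat[of "c j", where 'a = rat] by (simp add: of_rat_eq_id)
    obtain n :: int where n: "n > 0" "\<And>j. j < r \<Longrightarrow> of_int n * c j \<in> \<int>"
      using common_denominator[of "{..<r}" c] rat by auto
    have "\<forall>j. \<exists>k::int. j < r \<longrightarrow> of_int n * c j = of_int k" using n(2) by (auto elim: Ints_cases)
    then obtain k :: "nat \<Rightarrow> int" where k: "\<And>j. j < r \<Longrightarrow> of_int n * c j = of_int (k j)" by metis
    hence c: "c j = of_int (k j) / of_int n" if "j < r" for j using that n(1) by (metis nonzero_mult_div_cancel_left of_int_eq_0_iff order_less_irrefl)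
    let ?w = "\<Sum>j<r. of_int (k j) * e j"
    have w: "?w * ?w \<in> K"
      using eK by (intro K_mult K_sum K_of_int) auto
    have sum: "(\<Sum>j<r. of_rat (c j) * e j) = of_rat (1 / of_int n) * ?w"
      by (simp add: sum_distrib_left c of_rat_divide)
    have "(\<Sum>j<r. of_rat (c j) * e j) * (\<Sum>j<r. of_rat (c j) * e j) = of_rat (1 / of_int (n * n)) * (?w * ?w)"
      unfolding sum by (simp add: of_rat_divide of_rat_mult)
    hence "tr ((\<Sum>j<r. of_rat (c j) * e j) * (\<Sum>j<r. of_rat (c j) * e j)) = tr (?w * ?w) / of_int (n * n)"
      using tr_scale[OF w, of "1 / of_int (n * n)"] by (simp add: of_rat_divide of_rat_mult)
    moreover have "(of_rat (c i))\<^sup>2 * tr (e i * e i) = (of_int (k i))\<^sup>2 * tr (e i * e i) / of_int (n * n)"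
      by (simp add: c[OF i] of_rat_divide power2_eq_square)
    ultimately show ?thesis using divide_right_mono[OF bd[OF i, of k], of "of_int (n * n)"] by simp
  qed
  have unique: "c i = c' i" if eq: "(\<Sum>j<r. of_rat (c j) * e j) = (\<Sum>j<r. of_rat (c' j) * e j)" and i: "i < r" for c c' i
  proof -
    have "(\<Sum>j<r. of_rat (c j - c' j) * e j) = 0"
      using eq by (simp add: of_rat_diff left_diff_distrib sum_subtractf)
    hence "(of_rat (c i - c' i))\<^sup>2 * tr (e i * e i) \<le> 0"
      using rat_bd[OF i, of "\<lambda>j. c j - c' j"] by (simp add: tr_0)
    hence "(of_rat (c i - c' i) :: real)\<^sup>2 \<le> 0" using e(2)[OF i] by (simp add: mult_le_0_iff)
    thus ?thesis by simp
  qed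
  define C where "C = (\<lambda>x. SOME c. x = (\<Sum>i<r. of_rat (c i) * e i))"
  have C: "x = (\<Sum>i<r. of_rat (C x i) * e i)" if "x \<in> K" for x
    unfolding C_def using someI_ex[OF rat_coords[OF that]] .
  have C_eq: "C x i = c i" if "x = (\<Sum>i<r. of_rat (c i) * e i)" "i < r" for x c i
  proof -
    have "x \<in> K" unfolding that(1) using eK
      by (intro K_sum K_mult of_rat_mem) auto
    thus ?thesis using C[of x] unique[of "C x" c] that by metis
  qed
  show ?thesis
  proof (intro exI[of _ r] exI[of _ e] exI[of _ "\<lambda>i x. C x i"] conjI allI impI ballI)
    show "e i \<in> ?O" "e i \<noteq> 0" if "i < r" for i using e[OF that] by (auto simp: tr_0)
    show "rat_linear_on K (\<lambda>x. C x i)" if i: "i < r" for i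
      unfolding rat_linear_on_def
    proof (intro conjI ballI allI)
      fix x y assume xy: "x \<in> K" "y \<in> K"
      have "x + y = (\<Sum>i<r. of_rat (C x i + C y i) * e i)"
        using C[OF xy(1)] C[OF xy(2)] by (simp add: of_rat_add distrib_right sum.distrib)
      from C_eq[OF this i] show "C (x + y) i = C x i + C y i" .
    next
      fix s x assume x: "x \<in> K"
      have "of_rat s * x = (\<Sum>i<r. of_rat (s * C x i) * e i)"
        by (subst C[OF x]) (simp add: of_rat_mult sum_distrib_left mult.assoc)
      from C_eq[OF this i] show "C (of_rat s * x) i = s * C x i" .
    qed
    show "C x i \<in> \<int>" if i: "i < r" and x: "x \<in> ?O" for i x
    proof -
      obtain y :: "nat \<Rightarrow> int" where y: "x = (\<Sum>i<r. of_int (y i) * e i)" using int_coords[OF x] by blast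
      have "C x i = of_int (y i)" by (rule C_eq[OF _ i]) (simp add: y)
      thus ?thesis by simp
    qed
    show "(of_rat (C x i))\<^sup>2 * tr (e i * e i) \<le> reduction_constant N * tr (x * x)" if "i < r" "x \<in> K" for i x
      using rat_bd[OF that(1), of "C x"] C[OF that(2)] by simp
  qed (rule C)
qed

text \<open>
Gram-Schmidt, with every new vector multiplied by a positive integer to make it integral.
\<close>

lemma orthogonal_basis:
  assumes u: "spans \<rat> N u K"
  obtains B where "finite B" "B \<subseteq> ring_of_integers K - {0}"
    "\<And>x y. x \<in> B \<Longrightarrow> y \<in> B \<Longrightarrow> x \<noteq> y \<Longrightarrow> tr (x * y) = 0"
    "\<And>x. x \<in> K \<Longrightarrow> \<exists>c. x = (\<Sum>w\<in>B. of_rat (c w) * w)"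
proof -
  have "\<exists>B. finite B \<and> B \<subseteq> ring_of_integers K - {0} \<and> (\<forall>x\<in>B. \<forall>y\<in>B. x \<noteq> y \<longrightarrow> tr (x * y) = 0) \<and>
      (\<forall>i<k. \<exists>c. u i = (\<Sum>w\<in>B. of_rat (c w) * w))" if "k \<le> N" for k
    using that
  proof (induction k)
    case 0
    show ?case by (intro exI[of _ "{}"]) auto
  next
    case (Suc k)
    then obtain B where B: "finite B" "B \<subseteq> ring_of_integers K - {0}"
      "\<And>x y. x \<in> B \<Longrightarrow> y \<in> B \<Longrightarrow> x \<noteq> y \<Longrightarrow> tr (x * y) = 0"
      "\<And>i. i < k \<Longrightarrow> \<exists>c. u i = (\<Sum>w\<in>B. of_rat (c w) * w)" by (metis Suc_leD)
    have BK: "w \<in> K" if "w \<in> B" for w using B(2) that by (auto simp: ring_of_integers_def)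
    have uk: "u k \<in> K" using u Suc.prems by (auto simp: spans_def)
    have "\<forall>w. \<exists>c. w \<in> B \<longrightarrow> tr (u k * w) / tr (w * w) = of_rat c"
    proof
      fix w
      have "w \<in> B \<Longrightarrow> tr (u k * w) / tr (w * w) \<in> \<rat>"
        using BK uk by (intro Rats_divide tr_rat K_mult) auto
      thus "\<exists>c. w \<in> B \<longrightarrow> tr (u k * w) / tr (w * w) = of_rat c" by (auto elim: Rats_cases)
    qed
    then obtain c where c: "\<And>w. w \<in> B \<Longrightarrow> tr (u k * w) / tr (w * w) = of_rat (c w)" by metis
    define s where "s = (\<Sum>w\<in>B. of_rat (c w) * w)"
    define v where "v = u k - s"
    have sK: "s \<in> K" unfolding s_def using BK by (intro K_sum K_mult of_rat_mem)
    have v: "v \<in> K" unfolding v_def using sK uk by (rule is_subfieldD(3)[OF K, rotated])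
    have orth: "tr (v * x) = 0" if x: "x \<in> B" for x
    proof -
      have x0: "tr (x * x) > 0" using B(2) x by (intro tr_square_pos) (auto simp: ring_of_integers_def)
      have "tr (s * x) = (\<Sum>w\<in>B. tr (of_rat (c w) * (w * x)))"
        unfolding s_def sum_distrib_right mult.assoc
        using BK x by (intro tr_sum K_mult of_rat_mem)
      also have "\<dots> = (\<Sum>w\<in>B. of_rat (c w) * tr (w * x))"
        using BK x by (intro sum.cong refl tr_scale K_mult)
      also have "\<dots> = (\<Sum>w\<in>B. if w = x then of_rat (c x) * tr (x * x) else 0)"
        using B(3) x by (intro sum.cong) auto
      also have "\<dots> = tr (u k * x)" using B(1) x c[OF x, symmetric] x0 by simp
      finally have s: "tr (s * x) = tr (u k * x)" .
      have "tr (u k * x) = tr (v * x + s * x)" by (simp add: v_def algebra_simps)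
      also have "\<dots> = tr (v * x) + tr (s * x)"
        using v sK BK[OF x] by (intro tr_add K_mult)
      finally show ?thesis using s by simp
    qed
    show ?case
    proof (cases "v = 0")
      case True
      hence "u k = (\<Sum>w\<in>B. of_rat (c w) * w)" by (simp add: v_def s_def)
      hence "\<forall>i<Suc k. \<exists>c. u i = (\<Sum>w\<in>B. of_rat (c w) * w)" using B(4) less_Suc_eq by auto
      thus ?thesis using B(1-3) by (intro exI[of _ B]) auto
    next
      case False
      obtain n :: int where n: "n > 0" "algebraic_int (of_int n * v)" by (rule integer_multiple_algebraic_int[OF v])
      define z where "z = of_int n * v"
      have z: "z \<in> ring_of_integers K" "z \<noteq> 0" using n v False
        by (auto simp: z_def ring_of_integers_def K_mult K_of_int)
      have oz: "tr (z * x) = 0" "tr (x * z) = 0" if x: "x \<in> B" for x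
      proof -
        have "tr (of_rat (of_int n) * (v * x)) = 0"
          using v BK[OF x] orth[OF x] by (subst tr_scale) (auto intro: K_mult)
        thus "tr (z * x) = 0" "tr (x * z) = 0" by (simp_all add: z_def mult_ac)
      qed
      have zB: "z \<notin> B" using oz(1)[of z] tr_square_pos[of z] z by (auto simp: ring_of_integers_def)
      have "\<exists>c. u i = (\<Sum>w\<in>insert z B. of_rat (c w) * w)" if "i < Suc k" for i
      proof (cases "i = k")
        case True
        have "u k = of_rat (1 / of_int n) * z + s" using n(1) by (simp add: z_def v_def of_rat_divide)
        also have "s = (\<Sum>w\<in>B. of_rat ((c(z := 1 / of_int n)) w) * w)"
          unfolding s_def using zB by (intro sum.cong) auto
        finally have "u k = (\<Sum>w\<in>insert z B. of_rat ((c(z := 1 / of_int n)) w) * w)"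
          using zB B(1) by simp
        thus ?thesis unfolding True by (rule exI[of _ "c(z := 1 / of_int n)"])
      next
        case False
        hence "i < k" using that by simp
        from B(4)[OF this] obtain c where c: "u i = (\<Sum>w\<in>B. of_rat (c w) * w)" ..
        have "(\<Sum>w\<in>B. of_rat ((c(z := 0)) w) * w) = (\<Sum>w\<in>B. of_rat (c w) * w)"
          using zB by (intro sum.cong) auto
        hence "u i = (\<Sum>w\<in>insert z B. of_rat ((c(z := 0)) w) * w)"
          using zB B(1) c by simp
        thus ?thesis by (rule exI[of _ "c(z := 0)"])
      qed
      thus ?thesis using B(1-3) z oz by (intro exI[of _ "insert z B"]) auto
    qed
  qed
  from this[of N] obtain B where B: "finite B" "B \<subseteq> ring_of_integers K - {0}"
      "\<And>x y. x \<in> B \<Longrightarrow> y \<in> B \<Longrightarrow> x \<noteq> y \<Longrightarrow> tr (x * y) = 0"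
      "\<And>i. i < N \<Longrightarrow> \<exists>c. u i = (\<Sum>w\<in>B. of_rat (c w) * w)" by auto
  show thesis
  proof (rule that[OF B(1-3)])
    fix x assume "x \<in> K"
    then obtain a where a: "\<forall>i<N. a i \<in> \<rat>" "x = (\<Sum>i<N. a i * u i)" using u by (auto simp: spans_def)
    have "\<forall>i. \<exists>r. i < N \<longrightarrow> a i = of_rat r" using a(1) by (auto elim: Rats_cases)
    then obtain r where r: "\<And>i. i < N \<Longrightarrow> a i = of_rat (r i)" by metis
    obtain c where c: "\<And>i. i < N \<Longrightarrow> u i = (\<Sum>w\<in>B. of_rat (c i w) * w)" using B(4) by metis
    have "x = (\<Sum>i<N. \<Sum>w\<in>B. of_rat (r i * c i w) * w)"
      unfolding a(2) using r c by (simp add: sum_distrib_left of_rat_mult mult.assoc)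
    also have "\<dots> = (\<Sum>w\<in>B. of_rat (\<Sum>i<N. r i * c i w) * w)"
      by (subst sum.swap) (simp add: of_rat_sum sum_distrib_right)
    finally show "\<exists>c. x = (\<Sum>w\<in>B. of_rat (c w) * w)" by (intro exI[of _ "\<lambda>w. \<Sum>i<N. r i * c i w"])
  qed
qed

text \<open>
In an orthogonal basis of integral elements \<open>w\<close>, the functional \<open>\<phi>\<close> is represented by
\<open>\<Sum> (\<phi>(w) / tr(w\<^sup>2)) w\<close>. If the values of \<open>\<phi>\<close> are integers, the product \<open>D\<close> of the integers \<open>tr(w\<^sup>2)\<close>
clears all denominators; it depends on the field alone.
\<close>

theorem trace_representation:
  assumes u: "spans \<rat> N u K"
  obtains D :: int where "D > 0"
    "\<And>\<phi>. rat_linear_on K \<phi> \<Longrightarrow> \<exists>z\<in>K. (\<forall>x\<in>K. tr (x * z) = of_rat (\<phi> x)) \<and>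
       ((\<forall>x\<in>ring_of_integers K. \<phi> x \<in> \<int>) \<longrightarrow> algebraic_int (of_int D * z))"
proof -
  obtain B where B: "finite B" "B \<subseteq> ring_of_integers K - {0}"
      "\<And>x y. x \<in> B \<Longrightarrow> y \<in> B \<Longrightarrow> x \<noteq> y \<Longrightarrow> tr (x * y) = 0"
    and gen: "\<And>x. x \<in> K \<Longrightarrow> \<exists>c. x = (\<Sum>w\<in>B. of_rat (c w) * w)"
    using orthogonal_basis[OF u] by metis
  have BK: "w \<in> K" if "w \<in> B" for w using B(2) that by (auto simp: ring_of_integers_def)
  have "\<exists>n::int. n > 0 \<and> tr (w * w) = of_int n" if "w \<in> B" for w
  proof -
    have "tr (w * w) \<in> \<int>" using B(2) that
      by (intro tr_Ints K_mult algebraic_int_mult) (auto simp: ring_of_integers_def)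
    moreover have "tr (w * w) > 0" using B(2) that by (intro tr_square_pos) (auto simp: ring_of_integers_def)
    ultimately show ?thesis by (auto elim!: Ints_cases)
  qed
  then obtain n :: "'a \<Rightarrow> int" where n: "\<And>w. w \<in> B \<Longrightarrow> n w > 0" "\<And>w. w \<in> B \<Longrightarrow> tr (w * w) = of_int (n w)" by metis
  define D where "D = (\<Prod>w\<in>B. n w)"
  have "D > 0" unfolding D_def using n(1) by (intro prod_pos) auto
  moreover have "\<exists>z\<in>K. (\<forall>x\<in>K. tr (x * z) = of_rat (\<phi> x)) \<and>
       ((\<forall>x\<in>ring_of_integers K. \<phi> x \<in> \<int>) \<longrightarrow> algebraic_int (of_int D * z))" if \<phi>: "rat_linear_on K \<phi>" for \<phi>
  proof -
    define z where "z = (\<Sum>w\<in>B. of_rat (\<phi> w / of_int (n w)) * w)"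
    have z: "z \<in> K" unfolding z_def using BK by (intro K_sum K_mult of_rat_mem)
    have base: "tr (v * z) = of_rat (\<phi> v)" if v: "v \<in> B" for v
    proof -
      have "tr (v * z) = tr (\<Sum>w\<in>B. of_rat (\<phi> w / of_int (n w)) * (v * w))"
        by (simp add: z_def sum_distrib_left mult_ac)
      also have "\<dots> = (\<Sum>w\<in>B. tr (of_rat (\<phi> w / of_int (n w)) * (v * w)))"
        using BK v by (intro tr_sum K_mult of_rat_mem)
      also have "\<dots> = (\<Sum>w\<in>B. of_rat (\<phi> w / of_int (n w)) * tr (v * w))"
        using BK v by (intro sum.cong refl tr_scale K_mult)
      also have "\<dots> = (\<Sum>w\<in>B. if w = v then of_rat (\<phi> v) else 0)"
        using B(3) v n(2) n(1)[OF v] by (intro sum.cong) (auto simp: of_rat_divide)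
      finally show ?thesis using B(1) v by simp
    qed
    have "tr (x * z) = of_rat (\<phi> x)" if x: "x \<in> K" for x
    proof -
      obtain c where c: "x = (\<Sum>w\<in>B. of_rat (c w) * w)" using gen[OF x] by blast
      have "tr (x * z) = (\<Sum>w\<in>B. tr (of_rat (c w) * (w * z)))"
        unfolding c sum_distrib_right mult.assoc
        using BK z by (intro tr_sum K_mult of_rat_mem)
      also have "\<dots> = (\<Sum>w\<in>B. of_rat (c w) * tr (w * z))"
        using BK z by (intro sum.cong refl tr_scale K_mult)
      also have "\<dots> = (\<Sum>w\<in>B. of_rat (\<phi> (of_rat (c w) * w)))"
        using base \<phi> BK by (intro sum.cong refl) (simp add: rat_linear_on_def of_rat_mult)
      also have "\<dots> = of_rat (\<phi> x)"
      proof -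
        have "of_rat (c w) * w \<in> K" if "w \<in> B" for w
          using of_rat_mem BK[OF that] by (rule K_mult)
        thus ?thesis unfolding c by (simp add: rat_linear_on_sum[OF K \<phi>] of_rat_sum)
      qed
      finally show ?thesis .
    qed
    moreover have "algebraic_int (of_int D * z)" if int: "\<forall>x\<in>ring_of_integers K. \<phi> x \<in> \<int>"
    proof -
      have "algebraic_int (of_int D * (of_rat (\<phi> w / of_int (n w)) * w))" if w: "w \<in> B" for w
      proof -
        have "\<phi> w \<in> \<int>" using int B(2) w by auto
        then obtain k where k: "\<phi> w = of_int k" by (rule Ints_cases)
        have "D = n w * (\<Prod>v\<in>B - {w}. n v)" unfolding D_def using B(1) w by (rule prod.remove)
        hence "of_int D * (of_rat (\<phi> w / of_int (n w)) * w) = of_int ((\<Prod>v\<in>B - {w}. n v) * k) * w"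
          using n(1)[OF w] by (simp add: k of_rat_divide)
        also have "algebraic_int \<dots>" using B(2) w
          by (intro algebraic_int_mult) (auto simp: ring_of_integers_def int_imp_algebraic_int simp del: of_int_mult)
        finally show ?thesis .
      qed
      thus ?thesis unfolding z_def sum_distrib_left by (intro algebraic_int_sum)
    qed
    ultimately show ?thesis using z by blast
  qed
  ultimately show thesis by (rule that)
qed

end

section \<open>Quadratic forms over a totally real field\<close>

text \<open>
Vectors and Gram matrices are functions of which only the values below \<open>n\<close> count.
\<close>

definition form :: "nat \<Rightarrow> (nat \<Rightarrow> nat \<Rightarrow> 'a::comm_ring_1) \<Rightarrow> (nat \<Rightarrow> 'a) \<Rightarrow> (nat \<Rightarrow> 'a) \<Rightarrow> 'a" where
  "form n g v w = (\<Sum>k<n. \<Sum>l<n. v k * g k l * w l)"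

lemma form_linear:
  "form n g (\<lambda>k. a * v k + b * w k) z = a * form n g v z + b * form n g w z"
  unfolding form_def sum_distrib_left sum.distrib[symmetric]
  by (intro sum.cong refl) (simp add: algebra_simps)

lemma form_scale: "form n g (\<lambda>k. a * v k) (\<lambda>k. a * v k) = a * a * form n g v v"
  unfolding form_def sum_distrib_left by (intro sum.cong refl) (simp add: algebra_simps)

lemma form_commute:
  assumes "\<And>k l. k < n \<Longrightarrow> l < n \<Longrightarrow> g k l = g l k"
  shows "form n g v w = form n g w v"
  unfolding form_def by (subst sum.swap) (auto simp: assms mult_ac intro!: sum.cong)

lemma form_combination:
  assumes "\<And>k l. k < n \<Longrightarrow> l < n \<Longrightarrow> g k l = g l k"
  shows "form n g (\<lambda>k. a * v k + b * w k) (\<lambda>k. a * v k + b * w k) =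
    a * a * form n g v v + 2 * a * b * form n g v w + b * b * form n g w w"
proof -
  let ?z = "\<lambda>k. a * v k + b * w k"
  have "form n g ?z ?z = a * form n g v ?z + b * form n g w ?z" by (rule form_linear)
  also have "form n g v ?z = a * form n g v v + b * form n g w v"
    by (subst form_commute[OF assms]) (auto simp: form_linear)
  also have "form n g w ?z = a * form n g v w + b * form n g w w"
    by (subst form_commute[OF assms]) (auto simp: form_linear)
  also have "form n g w v = form n g v w" by (rule form_commute[OF assms])
  finally show ?thesis by (simp add: algebra_simps)
qed

lemma form_Cauchy_Schwarz:
  fixes g :: "nat \<Rightarrow> nat \<Rightarrow> real"
  assumes sym: "\<And>k l. k < n \<Longrightarrow> l < n \<Longrightarrow> g k l = g l k" and psd: "\<And>x. form n g x x \<ge> 0"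
  shows "(form n g v w)\<^sup>2 \<le> form n g v v * form n g w w"
proof -
  let ?V = "form n g v v" and ?W = "form n g w w" and ?B = "form n g v w"
  have comb: "a * a * ?V + 2 * a * b * ?B + b * b * ?W \<ge> 0" for a b
    using psd[of "\<lambda>k. a * v k + b * w k"] form_combination[of n g a v b w] sym by simp
  have V: "?V * (?V * ?W - ?B\<^sup>2) \<ge> 0" using comb[of "- ?B" ?V] by (simp add: power2_eq_square algebra_simps)
  have W: "?W * (?V * ?W - ?B\<^sup>2) \<ge> 0" using comb[of ?W "- ?B"] by (simp add: power2_eq_square algebra_simps)
  consider "?V > 0" | "?W > 0" | "?V = 0" "?W = 0" using psd[of v] psd[of w] by linarith
  thus ?thesis
  proof cases
    case 3
    thus ?thesis using comb[of 1 "- ?B"] by (simp add: power2_eq_square)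
  qed (use V W in \<open>auto simp: zero_le_mult_iff\<close>)
qed

text \<open>
Positivity of a form over \<open>F\<close> says something about the real form obtained through an embedding only at
vectors with entries in the image of \<open>F\<close>; the rational ones are dense. Real vectors are
needed because the embedded vectors have entries in \<open>K\<close>.
\<close>

lemma form_psd_if_rational:
  fixes g :: "nat \<Rightarrow> nat \<Rightarrow> real"
  assumes rat: "\<And>r :: nat \<Rightarrow> rat. form n g (\<lambda>k. of_rat (r k)) (\<lambda>k. of_rat (r k)) \<ge> 0"
  shows "form n g x x \<ge> 0"
proof -
  have "\<exists>q::rat. x k < of_rat q \<and> of_rat q < x k + 1 / real (Suc m)" for k m
  proof -
    obtain s where "s \<in> \<rat>" "x k < s" "s < x k + 1 / real (Suc m)"
      using Rats_dense_in_real[of "x k" "x k + 1 / real (Suc m)"] by auto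
    thus ?thesis by (metis Rats_cases)
  qed
  then obtain q where q: "\<And>k m. x k < of_rat (q k m :: rat)" "\<And>k m. of_rat (q k m) < x k + 1 / real (Suc m)"
    by metis
  have lim: "(\<lambda>m. of_rat (q k m)) \<longlonglongrightarrow> x k" for k
  proof (rule tendsto_sandwich)
    show "\<forall>\<^sub>F m in sequentially. x k \<le> of_rat (q k m)" using q(1) by (intro always_eventually allI less_imp_le)
    show "\<forall>\<^sub>F m in sequentially. of_rat (q k m) \<le> x k + 1 / real (Suc m)"
      using q(2) by (intro always_eventually allI less_imp_le)
    show "(\<lambda>m. x k + 1 / real (Suc m)) \<longlonglongrightarrow> x k"
      using tendsto_add[OF tendsto_const LIMSEQ_Suc[OF lim_1_over_n], of "x k"] by simp
  qed simp
  have "(\<lambda>m. form n g (\<lambda>k. of_rat (q k m)) (\<lambda>k. of_rat (q k m))) \<longlonglongrightarrow> form n g x x"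
    unfolding form_def by (intro tendsto_intros lim)
  thus ?thesis by (rule LIMSEQ_le_const) (use rat in auto)
qed

lemma form_cong:
  "(\<And>k. k < n \<Longrightarrow> v k = v' k) \<Longrightarrow> (\<And>k. k < n \<Longrightarrow> w k = w' k) \<Longrightarrow> form n g v w = form n g v' w'"
  unfolding form_def by (intro sum.cong refl) auto

lemma form_mem:
  assumes E: "is_subfield E"
    and "\<And>k l. k < n \<Longrightarrow> l < n \<Longrightarrow> g k l \<in> E" "\<And>k. k < n \<Longrightarrow> v k \<in> E" "\<And>k. k < n \<Longrightarrow> w k \<in> E"
  shows "form n g v w \<in> E"
  unfolding form_def using assms by (intro is_subfield_sum[OF E] is_subfieldD(4)[OF E]) auto

lemma form_embedding:
  assumes E: "is_subfield E" and \<sigma>: "\<sigma> \<in> embeddings E"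
    and g: "\<And>k l. k < n \<Longrightarrow> l < n \<Longrightarrow> g k l \<in> E" and v: "\<And>k. k < n \<Longrightarrow> v k \<in> E" and w: "\<And>k. k < n \<Longrightarrow> w k \<in> E"
  shows "\<sigma> (form n g v w) = form n (\<lambda>k l. \<sigma> (g k l)) (\<lambda>k. \<sigma> (v k)) (\<lambda>k. \<sigma> (w k))"
proof -
  have mem: "v k * g k l * w l \<in> E" if "k < n" "l < n" for k l
    using that g v w by (intro is_subfieldD(4)[OF E]) auto
  have inner: "(\<Sum>l<n. v k * g k l * w l) \<in> E" if "k < n" for k
    using mem[OF that] by (intro is_subfield_sum[OF E]) auto
  have "\<sigma> (form n g v w) = (\<Sum>k<n. \<sigma> (\<Sum>l<n. v k * g k l * w l))"
    unfolding form_def using inner by (intro embedding_sum[OF E \<sigma>]) auto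
  also have "\<dots> = (\<Sum>k<n. \<Sum>l<n. \<sigma> (v k * g k l * w l))"
    using mem by (intro sum.cong refl embedding_sum[OF E \<sigma>]) auto
  also have "\<dots> = (\<Sum>k<n. \<Sum>l<n. \<sigma> (v k) * \<sigma> (g k l) * \<sigma> (w l))"
    using g v w by (intro sum.cong refl) (simp add: embedding_simps(4)[OF E \<sigma>] is_subfieldD(4)[OF E])
  finally show "\<sigma> (form n g v w) = form n (\<lambda>k l. \<sigma> (g k l)) (\<lambda>k. \<sigma> (v k)) (\<lambda>k. \<sigma> (w k))"
    by (simp add: form_def)
qed

context real_traces begin

text \<open>
Write \<open>v = \<Sum> x\<^sub>a l\<^sub>a\<close>. Trace duality over \<open>F\<close> gives \<open>z\<^sub>a\<close> in \<open>F\<close> with \<open>tr (f z\<^sub>a) = Y (f x\<^sub>a)\<close> for all \<open>f\<close> in \<open>F\<close>.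
The vector \<open>p = \<Sum> z\<^sub>a l\<^sub>a\<close> satisfies \<open>tr (f p\<^sub>k) = Y (f v\<^sub>k)\<close>, whence \<open>tr (Q(p)) = Y (B(p,v))\<close>.
With the bound on \<open>Y\<close> and Cauchy-Schwarz at each embedding, \<open>tr (Q(p))\<^sup>2 q \<le> C T tr (Q(p))\<close>. If \<open>p\<close> were not zero,
\<open>D p\<close> would be a nonzero lattice vector, so \<open>D\<^sup>2 tr (Q(p)) \<ge> 1\<close> and \<open>q \<le> D\<^sup>2 C T\<close>.
\<close>

theorem long_coordinate_vanishes:
  assumes F: "is_subfield F" "F \<subseteq> K"
    and D: "D > (0::int)" "\<And>\<phi>. rat_linear_on F \<phi> \<Longrightarrow> \<exists>z\<in>F. (\<forall>x\<in>F. tr (x * z) = of_rat (\<phi> x)) \<and>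
       ((\<forall>x\<in>ring_of_integers F. \<phi> x \<in> \<int>) \<longrightarrow> algebraic_int (of_int D * z))"
    and Y: "rat_linear_on K Y" "\<And>x. x \<in> ring_of_integers K \<Longrightarrow> Y x \<in> \<int>"
      "\<And>x. x \<in> K \<Longrightarrow> (of_rat (Y x))\<^sup>2 * q \<le> C * tr (x * x)"
    and g: "\<And>k l. k < n \<Longrightarrow> l < n \<Longrightarrow> g k l \<in> F" "\<And>k l. k < n \<Longrightarrow> l < n \<Longrightarrow> g k l = g l k"
    and pos: "\<And>v. (\<And>k. k < n \<Longrightarrow> v k \<in> F) \<Longrightarrow> (\<exists>k<n. v k \<noteq> 0) \<Longrightarrow> totally_positive F (form n g v v)"
    and L: "finite A" "\<And>a k. a \<in> A \<Longrightarrow> k < n \<Longrightarrow> l a k \<in> F"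
      "\<And>c. (\<And>a. a \<in> A \<Longrightarrow> c a \<in> ring_of_integers F) \<Longrightarrow>
        algebraic_int (form n g (\<lambda>k. \<Sum>a\<in>A. c a * l a k) (\<lambda>k. \<Sum>a\<in>A. c a * l a k))"
    and v: "\<And>a. a \<in> A \<Longrightarrow> x a \<in> ring_of_integers K" "\<And>k. k < n \<Longrightarrow> v k = (\<Sum>a\<in>A. x a * l a k)"
    and T: "\<And>\<rho>. \<rho> \<in> set Rs \<Longrightarrow> \<rho> (form n g v v) \<le> T"
    and long: "(of_int D)\<^sup>2 * C * T < q" and C: "C \<ge> 0" and q: "q > 0"
    and k: "k < n"
  shows "Y (v k) = 0"
proof -
  note FK = subsetD[OF F(2)]
  have xK: "x a \<in> K" if "a \<in> A" for a using v(1)[OF that] by (simp add: ring_of_integers_def)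
  have lK: "l a k \<in> K" if "a \<in> A" "k < n" for a k using L(2)[OF that] FK by blast
  have vK: "v k \<in> K" if "k < n" for k
    unfolding v(2)[OF that] using xK lK that by (intro K_sum K_mult) auto
  \<comment> \<open>Contract the coordinate functional against the coefficients to obtain a vector over \<open>F\<close>.\<close>
  have "\<exists>z\<in>F. (\<forall>f\<in>F. tr (f * z) = of_rat (Y (f * x a))) \<and> algebraic_int (of_int D * z)" if a: "a \<in> A" for a
  proof -
    have "rat_linear_on F (\<lambda>f. Y (f * x a))"
      using Y(1) xK[OF a] FK K_mult
      by (auto simp: rat_linear_on_def distrib_right mult.assoc)
    moreover have "Y (f * x a) \<in> \<int>" if "f \<in> ring_of_integers F" for f
      using that v(1)[OF a] FK by (intro Y(2)) (auto simp: ring_of_integers_def algebraic_int_mult K_mult)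
    ultimately show ?thesis using D(2)[of "\<lambda>f. Y (f * x a)"] by blast
  qed
  then obtain z where z: "\<And>a. a \<in> A \<Longrightarrow> z a \<in> F" "\<And>a f. a \<in> A \<Longrightarrow> f \<in> F \<Longrightarrow> tr (f * z a) = of_rat (Y (f * x a))"
    "\<And>a. a \<in> A \<Longrightarrow> algebraic_int (of_int D * z a)" by metis
  have Y_sum: "(of_rat (Y (sum f I)) :: real) = (\<Sum>i\<in>I. of_rat (Y (f i)))" if "\<And>i. i \<in> I \<Longrightarrow> f i \<in> K"
    for f and I :: "nat set"
    using rat_linear_on_sum[OF K Y(1), of I f, OF that] by (simp add: of_rat_sum)
  define p where "p = (\<lambda>k. \<Sum>a\<in>A. z a * l a k)"
  have pF: "p k \<in> F" if "k < n" for k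
    unfolding p_def using z L that by (intro is_subfield_sum[OF F(1)] is_subfieldD(4)[OF F(1)]) auto
  have tr_p: "tr (f * p k) = of_rat (Y (f * v k))" if f: "f \<in> F" and k: "k < n" for f k
  proof -
    have fl: "f * l a k \<in> F" if "a \<in> A" for a using f k that L(2) by (intro is_subfieldD(4)[OF F(1)]) auto
    have "f * p k = (\<Sum>a\<in>A. (f * l a k) * z a)"
      unfolding p_def sum_distrib_left by (intro sum.cong refl) (simp only: mult_ac)
    also have "tr \<dots> = (\<Sum>a\<in>A. tr ((f * l a k) * z a))"
    proof (rule tr_sum)
      fix a assume a: "a \<in> A"
      show "(f * l a k) * z a \<in> K" by (rule K_mult[OF FK[OF fl[OF a]] FK[OF z(1)[OF a]]])
    qed
    finally have "tr (f * p k) = (\<Sum>a\<in>A. tr ((f * l a k) * z a))" .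
    also have "\<dots> = (\<Sum>a\<in>A. of_rat (Y ((f * l a k) * x a)))"
      by (rule sum.cong[OF refl]) (rule z(2)[OF _ fl])
    also have "\<dots> = of_rat (Y (\<Sum>a\<in>A. (f * l a k) * x a))"
    proof -
      have "(f * l a k) * x a \<in> K" if "a \<in> A" for a
        by (rule K_mult[OF FK[OF fl[OF that]] xK[OF that]])
      thus ?thesis by (simp add: rat_linear_on_sum[OF K Y(1)] of_rat_sum)
    qed
    also have "(\<Sum>a\<in>A. (f * l a k) * x a) = f * v k"
      unfolding v(2)[OF k] by (simp add: sum_distrib_left mult_ac)
    finally show ?thesis .
  qed
  let ?P = "tr (form n g p p)"
  have gK: "g k l \<in> K" if "k < n" "l < n" for k l using g(1)[OF that] FK by blast
  have pK: "p k \<in> K" if "k < n" for k using pF[OF that] FK by blast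
  have fpv: "form n g p v \<in> K" and fpp: "form n g p p \<in> K"
    using gK pK vK by (intro form_mem[OF K]; simp)+
  have PY: "?P = of_rat (Y (form n g p v))"
  proof -
    have pg: "p k * g k l \<in> F" if "k < n" "l < n" for k l using that pF g(1) by (intro is_subfieldD(4)[OF F(1)]) auto
    have mem: "p k * g k l * p l \<in> K" "p k * g k l * v l \<in> K" if "k < n" "l < n" for k l
      using that gK pK vK by (auto intro!: K_mult)
    have "?P = (\<Sum>k<n. tr (\<Sum>l<n. p k * g k l * p l))"
      unfolding form_def using mem by (intro tr_sum K_sum) auto
    also have "\<dots> = (\<Sum>k<n. \<Sum>l<n. tr (p k * g k l * p l))"
      using mem by (intro sum.cong refl tr_sum) auto
    also have "\<dots> = (\<Sum>k<n. \<Sum>l<n. of_rat (Y (p k * g k l * v l)))"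
      using pg by (intro sum.cong refl tr_p) auto
    also have "\<dots> = (\<Sum>k<n. of_rat (Y (\<Sum>l<n. p k * g k l * v l)))"
      using mem by (intro sum.cong refl Y_sum[symmetric]) auto
    also have "\<dots> = of_rat (Y (form n g p v))"
      unfolding form_def using mem by (intro Y_sum[symmetric] K_sum) auto
    finally show ?thesis .
  qed
  have sym: "\<rho> (g k l) = \<rho> (g l k)" if "k < n" "l < n" for k l and \<rho> :: "'a \<Rightarrow> real" using g(2)[OF that] by simp
  have psd: "form n (\<lambda>k l. \<rho> (g k l)) y y \<ge> 0" if \<rho>: "\<rho> \<in> set Rs" for \<rho> y
  proof (rule form_psd_if_rational)
    fix s :: "nat \<Rightarrow> rat"
    show "form n (\<lambda>k l. \<rho> (g k l)) (\<lambda>k. of_rat (s k)) (\<lambda>k. of_rat (s k)) \<ge> 0"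
    proof (cases "\<exists>k<n. s k \<noteq> 0")
      case False
      thus ?thesis by (simp add: form_def)
    next
      case True
      let ?s = "\<lambda>k. of_rat (s k) :: 'a"
      have s: "?s k \<in> F" for k using is_subfield_Rats_subset[OF F(1)] by auto
      have "totally_positive F (form n g ?s ?s)" using s True by (intro pos) auto
      hence "\<rho> (form n g ?s ?s) > 0" using embeddings_mono[OF F(2) emb[OF \<rho>]] by (auto simp: totally_positive_def)
      also have "\<rho> (form n g ?s ?s) = form n (\<lambda>k l. \<rho> (g k l)) (\<lambda>k. of_rat (s k)) (\<lambda>k. of_rat (s k))"
        by (subst form_embedding[OF K emb[OF \<rho>]]) (use gK s FK in \<open>auto simp: embedding_of_rat[OF K emb[OF \<rho>]]\<close>)
      finally show ?thesis by simp
    qed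
  qed
  have "tr (form n g p v * form n g p v) \<le> T * ?P"
  proof (rule tr_mono)
    fix \<rho> assume \<rho>: "\<rho> \<in> set Rs"
    let ?g = "\<lambda>k l. \<rho> (g k l)" and ?p = "\<lambda>k. \<rho> (p k)" and ?v = "\<lambda>k. \<rho> (v k)"
    note e = form_embedding[OF K emb[OF \<rho>]]
    have "\<rho> (form n g p v * form n g p v) = (form n ?g ?p ?v)\<^sup>2"
      using square_embedding[OF fpv \<rho>] e[of n g p v] gK pK vK by simp
    also have "\<dots> \<le> form n ?g ?p ?p * form n ?g ?v ?v"
      using sym psd[OF \<rho>] by (rule form_Cauchy_Schwarz)
    also have "\<dots> \<le> form n ?g ?p ?p * T"
      using T[OF \<rho>] e[of n g v v] gK vK psd[OF \<rho>] by (intro mult_left_mono) auto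
    also have "form n ?g ?p ?p = \<rho> (form n g p p)" using e[of n g p p] gK pK by simp
    finally show "\<rho> (form n g p v * form n g p v) \<le> T * \<rho> (form n g p p)" by (simp add: mult.commute)
  qed
  hence "?P\<^sup>2 * q \<le> C * (T * ?P)"
    using Y(3)[OF fpv] C unfolding PY by (meson mult_left_mono order_trans)
  moreover have "1 \<le> (of_int D)\<^sup>2 * ?P" if nz: "\<exists>k<n. p k \<noteq> 0"
  proof -
    have tp: "totally_positive F (form n g p p)" using pF nz by (intro pos) auto
    have "tr (form n g p p) > 0"
    proof (rule tr_pos)
      fix \<rho> assume "\<rho> \<in> set Rs"
      thus "\<rho> (form n g p p) > 0" using tp embeddings_mono[OF F(2) emb] by (auto simp: totally_positive_def)
    qed
    moreover have "algebraic_int (of_rat (of_int (D * D)) * form n g p p)"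
    proof -
      have "(\<lambda>k. \<Sum>a\<in>A. (of_int D * z a) * l a k) = (\<lambda>k. of_int D * p k)"
        by (simp add: p_def sum_distrib_left mult.assoc)
      moreover have "of_int D * z a \<in> ring_of_integers F" if "a \<in> A" for a
        using z(1,3)[OF that] is_subfieldD(4)[OF F(1) is_subfield_of_int[OF F(1)]] by (simp add: ring_of_integers_def)
      ultimately show ?thesis using L(3)[of "\<lambda>a. of_int D * z a"] by (simp add: form_scale of_rat_mult)
    qed
    ultimately have "tr (of_rat (of_int (D * D)) * form n g p p) \<ge> 1"
      using D(1) fpp by (intro tr_ge_1) (auto simp: tr_scale intro!: K_mult of_rat_mem mult_pos_pos)
    thus ?thesis unfolding tr_scale[OF fpp] by (simp add: of_rat_mult power2_eq_square)
  qed
  ultimately have "\<not> (\<exists>k<n. p k \<noteq> 0)"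
  proof (intro notI)
    assume nz: "\<exists>k<n. p k \<noteq> 0"
    assume le: "?P\<^sup>2 * q \<le> C * (T * ?P)" and "\<exists>k<n. p k \<noteq> 0 \<Longrightarrow> 1 \<le> (of_int D)\<^sup>2 * ?P"
    hence P: "1 \<le> (of_int D)\<^sup>2 * ?P" using nz by blast
    hence P0: "?P > 0" using D(1) by (smt (verit) mult_nonneg_nonpos zero_le_power2)
    have "?P * q \<le> C * T"
      using le P0 by (simp add: power2_eq_square mult.assoc mult.left_commute mult_le_cancel_left_pos)
    hence "(of_int D)\<^sup>2 * (?P * q) \<le> (of_int D)\<^sup>2 * (C * T)" by (intro mult_left_mono) auto
    moreover have "1 * q \<le> ((of_int D)\<^sup>2 * ?P) * q" using P q by (intro mult_right_mono) auto
    ultimately show False using long by (simp add: mult.assoc)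
  qed
  hence "p k = 0" using k by blast
  hence "tr (1 * p k) = 0" using k by (simp add: tr_0)
  thus ?thesis using tr_p[OF is_subfieldD(2)[OF F(1)] k] by simp
qed

end

section \<open>Lattices in coordinates\<close>

definition is_subring :: "'a::field set \<Rightarrow> bool" where
  "is_subring R \<longleftrightarrow> 1 \<in> R \<and> (\<forall>x\<in>R. \<forall>y\<in>R. x - y \<in> R \<and> x * y \<in> R)"

lemma is_subring_ring_of_integers:
  "is_subfield K \<Longrightarrow> is_subring (ring_of_integers K)"
  by (auto simp: is_subring_def ring_of_integers_def is_subfieldD algebraic_int_mult algebraic_int_diff int_imp_algebraic_int)

lemma module_over_subring:
  fixes R :: "'a::field set"
  assumes R: "is_subring R"
  shows "Module.module (ring_on R) (module_vec TYPE('a) n)"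
proof (rule moduleI)
  have zero: "0 \<in> R" using R unfolding is_subring_def by (metis diff_self)
  have neg: "- x \<in> R" if "x \<in> R" for x using R zero that unfolding is_subring_def by (metis diff_0)
  have add: "x + y \<in> R" if "x \<in> R" "y \<in> R" for x y
    using R neg that unfolding is_subring_def by (metis diff_minus_eq_add)
  show "cring (ring_on R)"
  proof (rule cringI)
    show "abelian_group (ring_on R)"
      by (rule abelian_groupI) (use zero neg add in \<open>auto intro: bexI[of _ "- _"]\<close>)
    show "Group.comm_monoid (ring_on R)"
      by (rule comm_monoidI) (use R in \<open>auto simp: is_subring_def mult_ac\<close>)
  qed (auto simp: distrib_right)
  interpret vec_space "TYPE('a)" n .
  show "abelian_group (module_vec TYPE('a) n)" by (rule abelian_group_axioms)
qed (auto simp: module_vec_def add_smult_distrib_vec smult_add_distrib_vec smult_smult_assoc)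

lemma is_subring_sum:
  assumes R: "is_subring R" and "\<And>i. i \<in> I \<Longrightarrow> f i \<in> R"
  shows "sum f I \<in> R"
proof -
  have zero: "0 \<in> R" using R unfolding is_subring_def by (metis diff_self)
  have add: "x + y \<in> R" if "x \<in> R" "y \<in> R" for x y
  proof -
    have "x - (0 - y) \<in> R" using R zero that unfolding is_subring_def by blast
    thus ?thesis by simp
  qed
  show ?thesis using assms(2) by (induction I rule: infinite_finite_induct) (auto simp: zero add)
qed

text \<open>
The module in question is the whole vector space with scalars from \<open>R\<close>. Its sums are evaluated entry by entry.
\<close>

lemma span_over_iff:
  fixes R :: "'a::field set"
  assumes R: "is_subring R" and S: "S \<subseteq> carrier_vec n"
  shows "v \<in> span_over R n S \<longleftrightarrow> v \<in> carrier_vec n \<and>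
    (\<exists>A a. finite A \<and> A \<subseteq> S \<and> (\<forall>w\<in>A. a w \<in> R) \<and> (\<forall>k<n. v $ k = (\<Sum>w\<in>A. a w * w $ k)))"
proof -
  note M = module_over_subring[OF R, of n]
  interpret vec_space "TYPE('a)" n .
  have comb: "module.lincomb (module_vec TYPE('a) n) a A \<in> carrier_vec n \<and>
      (\<forall>k<n. module.lincomb (module_vec TYPE('a) n) a A $ k = (\<Sum>w\<in>A. a w * w $ k))"
    if A: "finite A" "A \<subseteq> S" for a A
  proof -
    have lin: "module.lincomb (module_vec TYPE('a) n) a A = finsum (module_vec TYPE('a) n) (\<lambda>w. a w \<cdot>\<^sub>v w) A"
      unfolding LinearCombinations.module.lincomb_def[OF M] by (simp add: module_vec_def)
    have f: "(\<lambda>w. a w \<cdot>\<^sub>v w) \<in> A \<rightarrow> carrier_vec n" using A S by auto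
    have "finsum (module_vec TYPE('a) n) (\<lambda>w. a w \<cdot>\<^sub>v w) A \<in> carrier_vec n"
      using finsum_dim[OF A(1) f] by (metis carrier_vec_dim_vec)
    moreover have "finsum (module_vec TYPE('a) n) (\<lambda>w. a w \<cdot>\<^sub>v w) A $ k = (\<Sum>w\<in>A. a w * w $ k)" if "k < n" for k
    proof -
      have "finsum (module_vec TYPE('a) n) (\<lambda>w. a w \<cdot>\<^sub>v w) A $ k = (\<Sum>w\<in>A. (a w \<cdot>\<^sub>v w) $ k)"
        using A S by (intro finsum_index[OF that f]) auto
      also have "\<dots> = (\<Sum>w\<in>A. a w * w $ k)" using A S that by (intro sum.cong) auto
      finally show ?thesis .
    qed
    ultimately show ?thesis unfolding lin by blast
  qed
  show ?thesis
  proof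
    assume "v \<in> span_over R n S"
    then obtain a A where "finite A" "A \<subseteq> S" "a \<in> A \<rightarrow> R" "v = module.lincomb (module_vec TYPE('a) n) a A"
      unfolding LinearCombinations.module.span_def[OF M] by auto
    thus "v \<in> carrier_vec n \<and> (\<exists>A a. finite A \<and> A \<subseteq> S \<and> (\<forall>w\<in>A. a w \<in> R) \<and> (\<forall>k<n. v $ k = (\<Sum>w\<in>A. a w * w $ k)))"
      using comb[of A a] by (intro conjI exI[of _ A] exI[of _ a]) auto
  next
    assume "v \<in> carrier_vec n \<and> (\<exists>A a. finite A \<and> A \<subseteq> S \<and> (\<forall>w\<in>A. a w \<in> R) \<and> (\<forall>k<n. v $ k = (\<Sum>w\<in>A. a w * w $ k)))"
    then obtain A a where v: "v \<in> carrier_vec n" "finite A" "A \<subseteq> S" "\<forall>w\<in>A. a w \<in> R" "\<forall>k<n. v $ k = (\<Sum>w\<in>A. a w * w $ k)" by blast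
    have "v = module.lincomb (module_vec TYPE('a) n) a A"
      using comb[OF v(2,3), of a] v by (intro eq_vecI) auto
    moreover have "a \<in> A \<rightarrow> carrier (ring_on R)" using v(4) by auto
    ultimately show "v \<in> span_over R n S"
      unfolding LinearCombinations.module.span_def[OF M] using v(2,3) by blast
  qed
qed

lemma quad_eq_form:
  assumes "G \<in> carrier_mat n n" "v \<in> carrier_vec n"
  shows "quad G v = form n (\<lambda>k l. G $$ (k, l)) (\<lambda>k. v $ k) (\<lambda>k. v $ k)"
  using assms unfolding quad_def bilin_def form_def scalar_prod_def
  by (auto simp: scalar_prod_def sum_distrib_left mult_ac lessThan_atLeast0 intro!: sum.cong)

lemma span_over_finite_iff:
  fixes R :: "'a::field set"
  assumes R: "is_subring R" and S: "finite S" "S \<subseteq> carrier_vec n"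
  shows "v \<in> span_over R n S \<longleftrightarrow> v \<in> carrier_vec n \<and>
    (\<exists>a. (\<forall>w\<in>S. a w \<in> R) \<and> (\<forall>k<n. v $ k = (\<Sum>w\<in>S. a w * w $ k)))"
proof
  assume "v \<in> span_over R n S"
  then obtain A a where A: "v \<in> carrier_vec n" "A \<subseteq> S" "\<forall>w\<in>A. a w \<in> R" "\<forall>k<n. v $ k = (\<Sum>w\<in>A. a w * w $ k)"
    unfolding span_over_iff[OF R S(2)] by blast
  have zero: "0 \<in> R" using R unfolding is_subring_def by (metis diff_self)
  let ?a = "\<lambda>w. if w \<in> A then a w else 0"
  have "(\<Sum>w\<in>A. a w * w $ k) = (\<Sum>w\<in>S. ?a w * w $ k)" for k
    using A(2) S(1) by (intro sum.mono_neutral_cong_left) auto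
  thus "v \<in> carrier_vec n \<and> (\<exists>a. (\<forall>w\<in>S. a w \<in> R) \<and> (\<forall>k<n. v $ k = (\<Sum>w\<in>S. a w * w $ k)))"
    using A zero by (intro conjI exI[of _ ?a]) auto
next
  assume "v \<in> carrier_vec n \<and> (\<exists>a. (\<forall>w\<in>S. a w \<in> R) \<and> (\<forall>k<n. v $ k = (\<Sum>w\<in>S. a w * w $ k)))"
  thus "v \<in> span_over R n S" unfolding span_over_iff[OF R S(2)] using S(1) by blast
qed

lemma span_over_combination:
  fixes R :: "'a::field set"
  assumes R: "is_subring R" and S: "finite S" "S \<subseteq> carrier_vec n"
    and A: "A \<subseteq> span_over R n S" and c: "\<And>w. w \<in> A \<Longrightarrow> c w \<in> R"
  shows "vec n (\<lambda>k. \<Sum>w\<in>A. c w * w $ k) \<in> span_over R n S"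
proof -
  have "\<forall>w. \<exists>b. w \<in> A \<longrightarrow> (\<forall>y\<in>S. b y \<in> R) \<and> (\<forall>k<n. w $ k = (\<Sum>y\<in>S. b y * y $ k))"
    using A unfolding span_over_finite_iff[OF R S] subset_iff by blast
  then obtain b where b: "\<And>w y. w \<in> A \<Longrightarrow> y \<in> S \<Longrightarrow> b w y \<in> R"
    "\<And>w k. w \<in> A \<Longrightarrow> k < n \<Longrightarrow> w $ k = (\<Sum>y\<in>S. b w y * y $ k)" by metis
  have "(\<Sum>w\<in>A. c w * w $ k) = (\<Sum>y\<in>S. (\<Sum>w\<in>A. c w * b w y) * y $ k)" if "k < n" for k
  proof -
    have "(\<Sum>w\<in>A. c w * w $ k) = (\<Sum>w\<in>A. \<Sum>y\<in>S. c w * b w y * y $ k)"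
      using b(2)[OF _ that] by (intro sum.cong refl) (simp add: sum_distrib_left mult.assoc)
    also have "\<dots> = (\<Sum>y\<in>S. (\<Sum>w\<in>A. c w * b w y) * y $ k)"
      by (subst sum.swap) (simp add: sum_distrib_right)
    finally show ?thesis .
  qed
  moreover have "(\<Sum>w\<in>A. c w * b w y) \<in> R" if "y \<in> S" for y
    using R b(1)[OF _ that] c by (intro is_subring_sum) (auto simp: is_subring_def)
  ultimately show ?thesis unfolding span_over_finite_iff[OF R S]
    by (intro conjI exI[of _ "\<lambda>y. \<Sum>w\<in>A. c w * b w y"]) auto
qed

lemma coord_space_iff: "v \<in> coord_space E n \<longleftrightarrow> v \<in> carrier_vec n \<and> (\<forall>k<n. v $ k \<in> E)"
  by (auto simp: coord_space_def vec_set_def)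

text \<open>
A vector of the extended lattice is a combination over \<open>O\<^sub>K\<close> of finitely many vectors of \<open>L\<close>. Combinations of the
same vectors over \<open>O\<^sub>F\<close> stay in \<open>L\<close>, where \<open>Q\<close> is integral.
\<close>

lemma extended_lattice_representation:
  fixes F K :: "'a::field_char_0 set"
  assumes F: "is_subfield F" and K: "is_subfield K" and L: "integral_lattice F n G L"
    and rep: "represents G (extend_lattice K n L) \<alpha>"
  obtains A x v where "finite A" "\<And>w k. w \<in> A \<Longrightarrow> k < n \<Longrightarrow> w $ k \<in> F"
    "\<And>w. w \<in> A \<Longrightarrow> x w \<in> ring_of_integers K"
    "\<And>k. k < n \<Longrightarrow> v k = (\<Sum>w\<in>A. x w * w $ k)" "form n (\<lambda>k l. G $$ (k, l)) v v = \<alpha>"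
    "\<And>c. (\<And>w. w \<in> A \<Longrightarrow> c w \<in> ring_of_integers F) \<Longrightarrow> algebraic_int
       (form n (\<lambda>k l. G $$ (k, l)) (\<lambda>k. \<Sum>w\<in>A. c w * w $ k) (\<lambda>k. \<Sum>w\<in>A. c w * w $ k))"
proof -
  have G: "G \<in> carrier_mat n n" using L by (simp add: integral_lattice_def pos_def_quadratic_space_def)
  obtain S where S: "finite S" "S \<subseteq> coord_space F n" "L = span_over (ring_of_integers F) n S"
    using L by (auto simp: integral_lattice_def)
  have Sc: "S \<subseteq> carrier_vec n" using S(2) by (auto simp: coord_space_iff)
  note RF = is_subring_ring_of_integers[OF F] and RK = is_subring_ring_of_integers[OF K]
  have LF: "w \<in> carrier_vec n" "k < n \<Longrightarrow> w $ k \<in> F" if w: "w \<in> L" for w k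
  proof -
    obtain a where a: "w \<in> carrier_vec n" "\<forall>y\<in>S. a y \<in> ring_of_integers F" "\<forall>k<n. w $ k = (\<Sum>y\<in>S. a y * y $ k)"
      using w unfolding S(3) span_over_finite_iff[OF RF S(1) Sc] by blast
    show "w \<in> carrier_vec n" by fact
    show "w $ k \<in> F" if "k < n"
      using a that S(2) by (auto simp: ring_of_integers_def coord_space_iff intro!: is_subfield_sum[OF F] is_subfieldD(4)[OF F])
  qed
  have Lc: "L \<subseteq> carrier_vec n" using LF(1) by blast
  obtain v where v: "v \<in> span_over (ring_of_integers K) n L" "quad G v = \<alpha>"
    using rep by (auto simp: represents_def extend_lattice_def)
  then obtain A x where A: "v \<in> carrier_vec n" "finite A" "A \<subseteq> L" "\<forall>w\<in>A. x w \<in> ring_of_integers K"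
      "\<forall>k<n. v $ k = (\<Sum>w\<in>A. x w * w $ k)"
    unfolding span_over_iff[OF RK Lc] by blast
  show thesis
  proof (rule that[of A x "\<lambda>k. v $ k"])
    show "form n (\<lambda>k l. G $$ (k, l)) (\<lambda>k. v $ k) (\<lambda>k. v $ k) = \<alpha>" using quad_eq_form[OF G A(1)] v(2) by simp
  next
    fix c assume c: "\<And>w. w \<in> A \<Longrightarrow> c w \<in> ring_of_integers F"
    let ?w = "vec n (\<lambda>k. \<Sum>w\<in>A. c w * w $ k)"
    have "?w \<in> L" unfolding S(3) using A(3) c unfolding S(3) by (intro span_over_combination[OF RF S(1) Sc])
    hence "algebraic_int (quad G ?w)" using L by (auto simp: integral_lattice_def ring_of_integers_def)
    also have "quad G ?w = form n (\<lambda>k l. G $$ (k, l)) (\<lambda>k. \<Sum>w\<in>A. c w * w $ k) (\<lambda>k. \<Sum>w\<in>A. c w * w $ k)"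
      unfolding quad_eq_form[OF G vec_carrier] by (rule form_cong) auto
    finally show "algebraic_int (form n (\<lambda>k l. G $$ (k, l)) (\<lambda>k. \<Sum>w\<in>A. c w * w $ k) (\<lambda>k. \<Sum>w\<in>A. c w * w $ k))" .
  qed (use A LF(2) in auto)
qed

lemma integral_lattice_form:
  fixes F :: "'a::field_char_0 set"
  assumes L: "integral_lattice F n G L"
  shows "\<And>k l. k < n \<Longrightarrow> l < n \<Longrightarrow> G $$ (k, l) \<in> F" "\<And>k l. k < n \<Longrightarrow> l < n \<Longrightarrow> G $$ (k, l) = G $$ (l, k)"
    "\<And>v. (\<And>k. k < n \<Longrightarrow> v k \<in> F) \<Longrightarrow> (\<exists>k<n. v k \<noteq> 0) \<Longrightarrow> totally_positive F (form n (\<lambda>k l. G $$ (k, l)) v v)"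
proof -
  have G: "G \<in> carrier_mat n n" "elements_mat G \<subseteq> F" "transpose_mat G = G"
    "\<And>v. v \<in> coord_space F n - {0\<^sub>v n} \<Longrightarrow> totally_positive F (quad G v)"
    using L by (auto simp: integral_lattice_def pos_def_quadratic_space_def)
  show "G $$ (k, l) \<in> F" if "k < n" "l < n" for k l using G(2) elements_matI[OF G(1) that refl] by blast
  show "G $$ (k, l) = G $$ (l, k)" if "k < n" "l < n" for k l
  proof -
    have "transpose_mat G $$ (k, l) = G $$ (l, k)" using that G(1) by simp
    thus ?thesis unfolding G(3) .
  qed
  show "totally_positive F (form n (\<lambda>k l. G $$ (k, l)) v v)"
    if v: "\<And>k. k < n \<Longrightarrow> v k \<in> F" "\<exists>k<n. v k \<noteq> 0" for v
  proof -
    have "vec n v \<in> coord_space F n" using v(1) by (simp add: coord_space_iff)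
    moreover have "vec n v \<noteq> 0\<^sub>v n" using v(2) by (auto simp: vec_eq_iff)
    ultimately have "totally_positive F (quad G (vec n v))" by (intro G(4)) simp
    also have "quad G (vec n v) = form n (\<lambda>k l. G $$ (k, l)) v v"
      unfolding quad_eq_form[OF G(1) vec_carrier] by (rule form_cong) auto
    finally show ?thesis .
  qed
qed

section \<open>Fields generated by short integers\<close>

text \<open>
The set \<open>S\<close> collects the algebraic integers \<open>x\<close> with \<open>tr (x\<^sup>2) \<le> B\<^sup>2\<close> from all fields with a list of embeddings as short
as the one that \<open>trace_list_extension\<close> provides for \<open>K\<close>.
\<close>

theorem subfield_of_short_integers:
  fixes F :: "'a::field_char_0 set"
  assumes F: "totally_real F"
  obtains S where "finite S"
    "\<And>K E n G L. F \<subseteq> K \<Longrightarrow> totally_real K \<Longrightarrow> ring.dimension class_ring d F K \<Longrightarrow>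
      integral_lattice F n G L \<Longrightarrow> universal K G (extend_lattice K n L) \<Longrightarrow>
      is_subfield E \<Longrightarrow> F \<subseteq> E \<Longrightarrow> K \<inter> S \<subseteq> E \<Longrightarrow> K \<subseteq> E"
proof -
  have numF: "number_field F" using F by (simp add: totally_real_def)
  obtain f w where subF: "is_subfield F" and w: "spans \<rat> f w F" by (rule number_field_spans[OF numF])
  obtain Xs :: "('a \<Rightarrow> complex) list" where Xs: "trace_list F Xs" by (rule number_field_trace_list[OF numF])
  interpret F: real_traces F "map (\<lambda>\<sigma> y. Re (\<sigma> y)) Xs"
    using subF real_trace_list(1)[OF F Xs] by unfold_locales
  obtain D :: int where D: "D > 0"
    "\<And>\<phi>. rat_linear_on F \<phi> \<Longrightarrow> \<exists>z\<in>F. (\<forall>x\<in>F. F.tr (x * z) = of_rat (\<phi> x)) \<and>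
       ((\<forall>x\<in>ring_of_integers F. \<phi> x \<in> \<int>) \<longrightarrow> algebraic_int (of_int D * z))"
    using F.trace_representation[OF w] by metis
  let ?C = "reduction_constant (f * d)"
  have C: "?C \<ge> 0" using reduction_constant_ge_1[of "f * d"] by simp
  \<comment> \<open>For \<open>T\<close> above \<open>B\<close>, vectors of value at most \<open>3 T\<close> have no coordinate at basis vectors of length at least \<open>T\<close>.\<close>
  define B where "B = 3 * (of_int D * real (d ^ d))\<^sup>2 * ?C"
  define S where "S = {x :: 'a. \<exists>K Rs. real_traces K Rs \<and> length Rs \<le> d ^ d * length Xs \<and> x \<in> K \<and> algebraic_int x \<and>
     real_traces.tr Rs (x * x) \<le> B\<^sup>2}"
  show thesis
  proof (rule that[of S])
    show "finite S" unfolding S_def by (rule finite_bounded_algebraic_ints)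
  next
    fix K E n G L
    assume FK: "F \<subseteq> K" and realK: "totally_real K" and dim: "ring.dimension class_ring d F K"
      and L: "integral_lattice F n G L" and univ: "universal K G (extend_lattice K n L)"
      and E: "is_subfield E" "F \<subseteq> E" and S: "K \<inter> S \<subseteq> E"
    have subK: "is_subfield K"
      using realK by (auto simp: totally_real_def number_field_def intro: is_subfield_if_subfield)
    obtain u where u: "spans F d u K" using spans_if_dimension[OF subF dim] by blast
    obtain Ys m where Ys: "trace_list K Ys" "1 \<le> m" "m \<le> d ^ d" "length Ys = m * length Xs"
      and sumY: "\<And>y. y \<in> F \<Longrightarrow> (\<Sum>\<sigma>\<leftarrow>Ys. \<sigma> y) = of_nat m * (\<Sum>\<sigma>\<leftarrow>Xs. \<sigma> y)"
      using trace_list_extension[OF subF subK FK u Xs] by metis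
    define Rs where "Rs = map (\<lambda>\<sigma> y. Re (\<sigma> y)) Ys"
    interpret real_traces K Rs
      using subK real_trace_list(1)[OF realK Ys(1)] unfolding Rs_def by unfold_locales
    have tr_F: "tr y = real m * F.tr y" if "y \<in> F" for y
    proof -
      have "tr y = Re (\<Sum>\<sigma>\<leftarrow>Ys. \<sigma> y)"
        unfolding tr_def unfolding Rs_def using that FK by (intro real_trace_list(2)[OF realK Ys(1)]) blast
      also have "\<dots> = real m * Re (\<Sum>\<sigma>\<leftarrow>Xs. \<sigma> y)" unfolding sumY[OF that] by simp
      also have "Re (\<Sum>\<sigma>\<leftarrow>Xs. \<sigma> y) = F.tr y"
        unfolding F.tr_def using that by (rule real_trace_list(2)[OF F Xs, symmetric])
      finally show ?thesis .
    qed
    \<comment> \<open>Dualising over \<open>F\<close> with the trace of \<open>K\<close> costs only the bounded factor \<open>m\<close>.\<close>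
    have dual: "\<exists>z\<in>F. (\<forall>x\<in>F. tr (x * z) = of_rat (\<phi> x)) \<and>
       ((\<forall>x\<in>ring_of_integers F. \<phi> x \<in> \<int>) \<longrightarrow> algebraic_int (of_int (D * int m) * z))" if \<phi>: "rat_linear_on F \<phi>" for \<phi>
    proof -
      obtain z where z: "z \<in> F" "\<And>x. x \<in> F \<Longrightarrow> F.tr (x * z) = of_rat (\<phi> x)"
        "(\<forall>x\<in>ring_of_integers F. \<phi> x \<in> \<int>) \<Longrightarrow> algebraic_int (of_int D * z)" using D(2)[OF \<phi>] by blast
      let ?z = "z / of_nat m"
      have m0: "(of_nat m :: 'a) \<noteq> 0" using Ys(2) by simp
      have "?z \<in> F" using z(1) by (intro is_subfieldD(8)[OF subF] is_subfield_of_nat[OF subF])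
      moreover have "tr (x * ?z) = of_rat (\<phi> x)" if x: "x \<in> F" for x
      proof -
        have xz: "x * z \<in> F" using x z(1) by (rule is_subfieldD(4)[OF subF])
        have "x * ?z = of_rat (1 / of_nat m) * (x * z)" by (simp add: of_rat_divide)
        hence "tr (x * ?z) = of_rat (1 / of_nat m) * tr (x * z)" using tr_scale[of "x * z" "1 / of_nat m"] xz FK by auto
        also have "\<dots> = F.tr (x * z)" using Ys(2) tr_F[OF xz] by (simp add: of_rat_divide)
        finally show ?thesis using z(2)[OF x] by simp
      qed
      moreover have "of_int (D * int m) * ?z = of_int D * z" using m0 by simp
      ultimately show ?thesis using z(3) by metis
    qed
    have Dm: "D * int m > 0" using D(1) Ys(2) by simp
    obtain r :: nat and e Y where basis: "\<forall>i<r. e i \<in> ring_of_integers K \<and> e i \<noteq> 0 \<and> rat_linear_on K (Y i) \<and>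
        (\<forall>x\<in>ring_of_integers K. Y i x \<in> \<int>) \<and>
        (\<forall>x\<in>K. (of_rat (Y i x))\<^sup>2 * tr (e i * e i) \<le> ?C * tr (x * x))"
      and coord: "\<forall>x\<in>K. x = (\<Sum>i<r. of_rat (Y i x) * e i)"
      using reduced_integral_basis[OF spans_trans[OF subF w subK FK u]] by (elim exE conjE)
    have e: "e i \<in> ring_of_integers K" "e i \<noteq> 0" if "i < r" for i using basis that by blast+
    have eK: "e i \<in> K" "algebraic_int (e i)" if "i < r" for i using e(1)[OF that] by (auto simp: ring_of_integers_def)
    have "e i \<in> E" if "i < r" for i
    proof (rule ccontr)
      assume "e i \<notin> E"
      let ?bad = "\<lambda>i. i < r \<and> e i \<notin> E"
      define j where "j = arg_min_on (\<lambda>i. tr (e i * e i)) {i. ?bad i}"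
      have fin: "finite {i. ?bad i}" by (rule finite_subset[of _ "{..<r}"]) auto
      have ne: "{i. ?bad i} \<noteq> {}" using that \<open>e i \<notin> E\<close> by blast
      have j: "j < r" "e j \<notin> E" using arg_min_if_finite(1)[OF fin ne, of "\<lambda>i. tr (e i * e i)"] by (auto simp: j_def)
      have min: "tr (e j * e j) \<le> tr (e i * e i)" if "?bad i" for i
        unfolding j_def by (rule arg_min_least[OF fin ne, where f = "\<lambda>i. tr (e i * e i)"]) (use that in simp)
      define T where "T = sqrt (tr (e j * e j))"
      have sqj: "algebraic_int (e j * e j)" "e j * e j \<in> K"
        using eK[OF j(1)] by (auto intro: algebraic_int_mult is_subfieldD(4)[OF subK])
      have "tr (e j * e j) \<ge> 1"
        using tr_ge_1[OF sqj(2,1)] tr_square_pos[OF eK(1)[OF j(1)] e(2)[OF j(1)]] by blast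
      hence T: "T \<ge> 1" "T\<^sup>2 = tr (e j * e j)" by (auto simp: T_def)
      have conj_le: "\<bar>\<rho> (e j)\<bar> \<le> T" if "\<rho> \<in> set Rs" for \<rho>
        using square_le_tr[OF eK(1)[OF j(1)] that] T by (metis abs_le_square_iff abs_of_nonneg order_trans zero_le_one)
      \<comment> \<open>A shortest basis vector outside \<open>E\<close>, shifted by an integer, is totally positive and still outside \<open>E\<close>.\<close>
      define \<alpha> where "\<alpha> = e j + of_int (\<lfloor>T\<rfloor> + 1)"
      have int: "of_int k \<in> K" "of_int k \<in> E" for k
        using is_subfield_of_int[OF subK] is_subfield_of_int[OF E(1)] by auto
      have \<alpha>K: "\<alpha> \<in> K" unfolding \<alpha>_def using eK(1)[OF j(1)] int(1) by (rule is_subfieldD(7)[OF subK])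
      have \<chi>\<alpha>: "\<chi> \<alpha> = \<chi> (e j) + of_int (\<lfloor>T\<rfloor> + 1)" if "\<chi> \<in> embeddings K" for \<chi> :: "'a \<Rightarrow> real"
        unfolding \<alpha>_def using embedding_simps(3)[OF subK that eK(1)[OF j(1)] int(1)] embedding_of_int[OF subK that] by metis
      have "totally_positive K \<alpha>"
        unfolding totally_positive_def
      proof (intro conjI ballI \<alpha>K)
        fix \<chi> :: "'a \<Rightarrow> real" assume \<chi>: "\<chi> \<in> embeddings K"
        obtain \<rho> where "\<rho> \<in> set Rs" "\<chi> (e j) = \<rho> (e j)" using conj_poly_embedding[OF eK[OF j(1)] \<chi>] by blast
        hence "\<chi> (e j) \<ge> - T" using conj_le by fastforce
        thus "\<chi> \<alpha> > 0" unfolding \<chi>\<alpha>[OF \<chi>] by linarith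
      qed
      moreover have "\<alpha> \<in> ring_of_integers K"
        using \<alpha>K algebraic_int_add[OF eK(2)[OF j(1)] int_imp_algebraic_int[OF Ints_of_int]]
        unfolding ring_of_integers_def \<alpha>_def by blast
      ultimately have rep: "represents G (extend_lattice K n L) \<alpha>" using univ by (simp add: universal_def)
      obtain A x v where A: "finite A" "\<And>w k. w \<in> A \<Longrightarrow> k < n \<Longrightarrow> w $ k \<in> F"
        and x: "\<And>w. w \<in> A \<Longrightarrow> x w \<in> ring_of_integers K"
        and v: "\<And>k. k < n \<Longrightarrow> v k = (\<Sum>w\<in>A. x w * w $ k)" and v\<alpha>: "form n (\<lambda>k l. G $$ (k, l)) v v = \<alpha>"
        and int_L: "\<And>c. (\<And>w. w \<in> A \<Longrightarrow> c w \<in> ring_of_integers F) \<Longrightarrow> algebraic_int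
          (form n (\<lambda>k l. G $$ (k, l)) (\<lambda>k. \<Sum>w\<in>A. c w * w $ k) (\<lambda>k. \<Sum>w\<in>A. c w * w $ k))"
        by (rule extended_lattice_representation[OF subF subK L rep]) blast
      have \<alpha>_le: "\<rho> (form n (\<lambda>k l. G $$ (k, l)) v v) \<le> 3 * T" if "\<rho> \<in> set Rs" for \<rho>
        unfolding v\<alpha> \<chi>\<alpha>[OF emb[OF that]] using conj_le[OF that] T(1) by linarith
      have "B < T"
      proof (rule ccontr)
        assume "\<not> B < T"
        hence "T\<^sup>2 \<le> B\<^sup>2" using T(1) by (intro power_mono) auto
        moreover have "length Rs \<le> d ^ d * length Xs" using Ys(3,4) by (simp add: Rs_def)
        ultimately have "e j \<in> S" unfolding S_def T(2) using real_traces_axioms eK[OF j(1)] by blast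
        thus False using S j eK by blast
      qed
      have long: "(of_int (D * int m))\<^sup>2 * ?C * (3 * T) < T\<^sup>2"
      proof -
        have "(of_int D * real m)\<^sup>2 \<le> (of_int D * real (d ^ d))\<^sup>2"
          using Ys(3) D(1) by (intro power_mono mult_left_mono) (auto simp flip: of_nat_power)
        hence "3 * (of_int D * real m)\<^sup>2 * ?C \<le> B" unfolding B_def using C by (intro mult_right_mono) auto
        hence "3 * (of_int D * real m)\<^sup>2 * ?C < T" using \<open>B < T\<close> by linarith
        hence "3 * (of_int D * real m)\<^sup>2 * ?C * T < T * T" using T(1) by (intro mult_strict_right_mono) auto
        thus ?thesis by (simp add: power2_eq_square mult_ac)
      qed
      have vK: "v k \<in> K" if "k < n" for k
        unfolding v[OF that] using x A(2)[OF _ that] FK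
        by (intro is_subfield_sum[OF subK] is_subfieldD(4)[OF subK]) (auto simp: ring_of_integers_def)
      \<comment> \<open>By the choice of \<open>j\<close>, every basis vector outside \<open>E\<close> is at least as long as \<open>e j\<close>.\<close>
      have vanish: "Y i (v k) = 0" if i: "?bad i" and k: "k < n" for i k
      proof (rule long_coordinate_vanishes[where n = n and g = "\<lambda>k l. G $$ (k, l)" and A = A and
            l = "\<lambda>w k. w $ k" and x = x and T = "3 * T" and C = ?C and q = "tr (e i * e i)", OF subF FK Dm])
        show "rat_linear_on K (Y i)" "\<And>x. x \<in> ring_of_integers K \<Longrightarrow> Y i x \<in> \<int>"
          "\<And>x. x \<in> K \<Longrightarrow> (of_rat (Y i x))\<^sup>2 * tr (e i * e i) \<le> ?C * tr (x * x)" using basis i by blast+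
        show "(of_int (D * int m))\<^sup>2 * ?C * (3 * T) < tr (e i * e i)" using long min[OF i] T(2) by linarith
        show "tr (e i * e i) > 0" using tr_square_pos eK e(2) i by blast
      qed (fact dual integral_lattice_form[OF L] A x v \<alpha>_le int_L C k)+
      have vE: "v k \<in> E" if k: "k < n" for k
      proof -
        have "of_rat (Y i (v k)) * e i \<in> E" if "i < r" for i
        proof (cases "e i \<in> E")
          case True
          thus ?thesis using is_subfield_Rats_subset[OF E(1)] by (intro is_subfieldD(4)[OF E(1)]) auto
        next
          case False
          thus ?thesis using vanish[of i k] that k is_subfieldD(1)[OF E(1)] by simp
        qed
        hence "(\<Sum>i<r. of_rat (Y i (v k)) * e i) \<in> E" by (intro is_subfield_sum[OF E(1)]) auto
        thus ?thesis using bspec[OF coord vK[OF k]] by simp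
      qed
      have "\<alpha> \<in> E" unfolding v\<alpha>[symmetric]
        using integral_lattice_form(1)[OF L] E(2) vE by (intro form_mem[OF E(1)]) auto
      hence "\<alpha> - of_int (\<lfloor>T\<rfloor> + 1) \<in> E" using int(2) by (rule is_subfieldD(3)[OF E(1)])
      thus False using j(2) by (simp add: \<alpha>_def)
    qed
    show "K \<subseteq> E"
    proof
      fix x assume "x \<in> K"
      have "(\<Sum>i<r. of_rat (Y i x) * e i) \<in> E"
        using \<open>\<And>i. i < r \<Longrightarrow> e i \<in> E\<close> is_subfield_Rats_subset[OF E(1)]
        by (intro is_subfield_sum[OF E(1)] is_subfieldD(4)[OF E(1)]) auto
      thus "x \<in> E" using bspec[OF coord \<open>x \<in> K\<close>] by simp
    qed
  qed
qed

text \<open>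
Two admissible fields with the same intersection with \<open>S\<close> contain each other.
\<close>

theorem theorem1p1:
  fixes F :: "'a::field_char_0 set" and d :: nat
  assumes "algebraic_closure (class_ring :: 'a ring) F"
    and "totally_real F"
    and "d > 0"
  shows "finite {K. F \<subseteq> K \<and> totally_real K \<and> ring.dimension class_ring d F K \<and>
    (\<exists>n G L. integral_lattice F n G L \<and> universal K G (extend_lattice K n L))}"
    (is "finite ?\<K>")
proof -
  obtain S where S: "finite S"
    "\<And>K E n G L. F \<subseteq> K \<Longrightarrow> totally_real K \<Longrightarrow> ring.dimension class_ring d F K \<Longrightarrow>
      integral_lattice F n G L \<Longrightarrow> universal K G (extend_lattice K n L) \<Longrightarrow>
      is_subfield E \<Longrightarrow> F \<subseteq> E \<Longrightarrow> K \<inter> S \<subseteq> E \<Longrightarrow> K \<subseteq> E"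
    by (rule subfield_of_short_integers[OF assms(2)]) blast
  have sub: "K \<subseteq> K'" if "K \<in> ?\<K>" "K' \<in> ?\<K>" "K \<inter> S = K' \<inter> S" for K K'
  proof -
    have "is_subfield K'"
      using that(2) by (auto simp: totally_real_def number_field_def intro: is_subfield_if_subfield)
    thus ?thesis using that S(2) by blast
  qed
  have "inj_on (\<lambda>K. K \<inter> S) ?\<K>"
    using sub by (intro inj_onI) (metis (no_types, lifting) subset_antisym)
  moreover have "(\<lambda>K. K \<inter> S) ` ?\<K> \<subseteq> Pow S" by blast
  ultimately show ?thesis using S(1) by (meson finite_Pow_iff inj_on_finite)
qed

end
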